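(* Let $\Delta>2$ and let $\Pi$ be an LCL on $\Delta$-regular trees. Assume that $\Pi$ admits a continuous solution on $\mathcal{T}^{\{0,1\}}_\Delta$ (a continuous $\Pi$-coloring of its half-edges) and that $\mathcal{T}$ is a $\Delta$-regular continuous tree. Then $\Pi$ admits a continuous solution on $\mathcal{T}$.
   Context: An LCL is a triple $\Pi=(\Sigma,\mathcal{V},\mathcal{E})$: $\Sigma$ finite, $\mathcal{V}$ a set of size-$\Delta$ multisets over $\Sigma$, $\mathcal{E}$ a set of size-$2$ multisets over $\Sigma$; a $\Pi$-coloring of a $\Delta$-regular graph is a labeling of half-edges (pairs (vertex, incident edge)) by $\Sigma$ whose multiset around each vertex is in $\mathcal{V}$ and on each edge is in $\mathcal{E}$. A graph on a zero-dimensional Polish space $X$ is continuous if the neighborhood of every clopen set is clopen; a continuous tree is an acyclic $\Delta$-regular continuous graph; its half-edges, seen as ordered adjacent pairs $(x,y)$, carry the topology generated by the clopen sets $(U\times V)\cap\mathcal{T}$. A continuous solution is a continuous $\Pi$-coloring of the half-edges. Let $T_\Delta$ be the infinite $\Delta$-regular tree with root $\mathfrak r$, $\operatorname{Aut}^o(T_\Delta)$ the stabilizer of $\mathfrak r$, acting on $\{0,1\}^{T_\Delta}$ by $(g\cdot x)(v)=x(g^{-1}v)$. $\mathrm{Free}(\{0,1\}^{T_\Delta})$ is the set of $x$ with $g\cdot x\neq x$ for all non-identity $g\in\operatorname{Aut}(T_\Delta)$. On the quotient $\{0,1\}^{T_\Delta}/\sim$ by the $\operatorname{Aut}^o(T_\Delta)$-orbit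 relation, $[x],[y]$ are adjacent iff for every $z\in[x]$ some $g\in\operatorname{Aut}(T_\Delta)$ moving $\mathfrak r$ to a neighbor of $\mathfrak r$ satisfies $g\cdot z\in[y]$. $\mathcal{T}^{\{0,1\}}_\Delta$ is the restriction of this graph to $\mathrm{Free}(\{0,1\}^{T_\Delta})/\sim$ (with the quotient topology). *)

theory Defs
  imports "HOL-Analysis.Analysis"
begin

section \<open>Graphs, given as sets of ordered pairs of adjacent vertices\<close>

definition simple_graph :: "'a set \<Rightarrow> ('a \<times> 'a) set \<Rightarrow> bool" where
  "simple_graph V G \<longleftrightarrow> G \<subseteq> V \<times> V \<and> sym G \<and> irrefl G"

definition regular_graph :: "nat \<Rightarrow> 'a set \<Rightarrow> ('a \<times> 'a) set \<Rightarrow> bool" where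
  "regular_graph d V G \<longleftrightarrow> (\<forall>x\<in>V. finite (G `` {x}) \<and> card (G `` {x}) = d)"

text \<open>The library constant \<open>acyclic\<close> is about directed cycles and fails for every
  nonempty symmetric relation; the cycles here are those of an undirected simple graph.\<close>

definition acyclic_graph :: "('a \<times> 'a) set \<Rightarrow> bool" where
  "acyclic_graph G \<longleftrightarrow>
     \<not> (\<exists>xs. length xs \<ge> 3 \<and> distinct xs \<and>
            successively (\<lambda>x y. (x, y) \<in> G) xs \<and> (last xs, hd xs) \<in> G)"


section \<open>Continuous trees\<close>

definition clopenin :: "'a topology \<Rightarrow> 'a set \<Rightarrow> bool" where
  "clopenin X U \<longleftrightarrow> openin X U \<and> closedin X U"

definition zero_dim_polish_space :: "'a topology \<Rightarrow> bool" where
  "zero_dim_polish_space X \<longleftrightarrow>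
     completely_metrizable_space X \<and> separable_space X \<and> X dim_le 0"

definition continuous_graph :: "'a topology \<Rightarrow> ('a \<times> 'a) set \<Rightarrow> bool" where
  "continuous_graph X G \<longleftrightarrow>
     zero_dim_polish_space X \<and> simple_graph (topspace X) G \<and>
     (\<forall>U. clopenin X U \<longrightarrow> clopenin X (G `` U))"

text \<open>Connectedness is not required: a continuous tree is in general a forest.\<close>

definition continuous_tree :: "nat \<Rightarrow> 'a topology \<Rightarrow> ('a \<times> 'a) set \<Rightarrow> bool" where
  "continuous_tree d X G \<longleftrightarrow>
     continuous_graph X G \<and> acyclic_graph G \<and> regular_graph d (topspace X) G"


section \<open>LCLs and their continuous solutions\<close>

record 'l lcl =
  labels :: "'l set"
  vertex_constraint :: "'l multiset set"
  edge_constraint :: "'l multiset set"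

definition is_lcl :: "nat \<Rightarrow> 'l lcl \<Rightarrow> bool" where
  "is_lcl d P \<longleftrightarrow>
     finite (labels P) \<and>
     (\<forall>M\<in>vertex_constraint P. size M = d \<and> set_mset M \<subseteq> labels P) \<and>
     (\<forall>M\<in>edge_constraint P. size M = 2 \<and> set_mset M \<subseteq> labels P)"

text \<open>The half-edge consisting of the vertex \<open>x\<close> and the edge \<open>{x, y}\<close> is the ordered
  pair \<open>(x, y)\<close>; thus the half-edges of \<open>G\<close> are exactly the elements of \<open>G\<close>.\<close>

definition lcl_coloring ::
    "'l lcl \<Rightarrow> 'a set \<Rightarrow> ('a \<times> 'a) set \<Rightarrow> ('a \<times> 'a \<Rightarrow> 'l) \<Rightarrow> bool" where
  "lcl_coloring P V G c \<longleftrightarrow>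
     c \<in> G \<rightarrow> labels P \<and>
     (\<forall>x\<in>V. image_mset (\<lambda>y. c (x, y)) (mset_set (G `` {x})) \<in> vertex_constraint P) \<and>
     (\<forall>(x, y)\<in>G. {#c (x, y), c (y, x)#} \<in> edge_constraint P)"

definition half_edge_topology :: "'a topology \<Rightarrow> ('a \<times> 'a) set \<Rightarrow> ('a \<times> 'a) topology" where
  "half_edge_topology X G =
     topology_generated_by {(U \<times> V) \<inter> G |U V. clopenin X U \<and> clopenin X V}"

definition continuous_solution ::
    "'l lcl \<Rightarrow> 'a topology \<Rightarrow> ('a \<times> 'a) set \<Rightarrow> ('a \<times> 'a \<Rightarrow> 'l) \<Rightarrow> bool" where
  "continuous_solution P X G c \<longleftrightarrow>
     lcl_coloring P (topspace X) G c \<and>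
     continuous_map (half_edge_topology X G) (discrete_topology (labels P)) c"


section \<open>The regular tree and its automorphisms\<close>

text \<open>The infinite \<open>d\<close>-regular tree, for \<open>d \<ge> 2\<close>, as the Cayley graph of the free product
  of \<open>d\<close> groups of order two: the vertices are the words over \<open>{..<d}\<close> without two equal
  consecutive letters, a word is joined to each of its one-letter extensions, and the root
  is the empty word.\<close>

definition tree_vertices :: "nat \<Rightarrow> nat list set" where
  "tree_vertices d = {w. set w \<subseteq> {..<d} \<and> distinct_adj w}"

definition tree_edges :: "nat \<Rightarrow> (nat list \<times> nat list) set" where
  "tree_edges d = {(u, v). u \<in> tree_vertices d \<and> v \<in> tree_vertices d \<and>
                           (\<exists>a. v = u @ [a] \<or> u = v @ [a])}"

abbreviation tree_root :: "nat list" where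
  "tree_root \<equiv> []"

text \<open>Automorphisms are extended by the identity outside the tree, so that the identity
  automorphism is \<open>id\<close> and the inverse of \<open>g\<close> is \<open>inv g\<close>.\<close>

definition tree_Aut :: "nat \<Rightarrow> (nat list \<Rightarrow> nat list) set" where
  "tree_Aut d = {g. g permutes tree_vertices d \<and>
     (\<forall>u\<in>tree_vertices d. \<forall>v\<in>tree_vertices d.
        (g u, g v) \<in> tree_edges d \<longleftrightarrow> (u, v) \<in> tree_edges d)}"

definition tree_Aut_root :: "nat \<Rightarrow> (nat list \<Rightarrow> nat list) set" where
  "tree_Aut_root d = {g \<in> tree_Aut d. g tree_root = tree_root}"


section \<open>The space of labelled trees\<close>

definition labelling_space :: "nat \<Rightarrow> (nat list \<Rightarrow> bool) topology" where
  "labelling_space d =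
     product_topology (\<lambda>_. discrete_topology (UNIV :: bool set)) (tree_vertices d)"

definition act :: "(nat list \<Rightarrow> nat list) \<Rightarrow> (nat list \<Rightarrow> bool) \<Rightarrow> nat list \<Rightarrow> bool" where
  "act g x = (\<lambda>v. x (inv g v))"

definition free_part :: "nat \<Rightarrow> (nat list \<Rightarrow> bool) set" where
  "free_part d =
     {x \<in> topspace (labelling_space d). \<forall>g\<in>tree_Aut d. g \<noteq> id \<longrightarrow> act g x \<noteq> x}"

definition root_orbit_rel :: "nat \<Rightarrow> ((nat list \<Rightarrow> bool) \<times> (nat list \<Rightarrow> bool)) set" where
  "root_orbit_rel d =
     {(x, y). x \<in> topspace (labelling_space d) \<and> y \<in> topspace (labelling_space d) \<and>
              (\<exists>g\<in>tree_Aut_root d. y = act g x)}"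

definition quotient_topology :: "'a topology \<Rightarrow> ('a \<times> 'a) set \<Rightarrow> 'a set topology" where
  "quotient_topology X r =
     topology (\<lambda>U. U \<subseteq> topspace X // r \<and> openin X {x \<in> topspace X. r `` {x} \<in> U})"

lemma openin_quotient_topology:
  "openin (quotient_topology X r) U \<longleftrightarrow>
     U \<subseteq> topspace X // r \<and> openin X {x \<in> topspace X. r `` {x} \<in> U}"
proof -
  have "istopology (\<lambda>U. U \<subseteq> topspace X // r \<and> openin X {x \<in> topspace X. r `` {x} \<in> U})"
    unfolding istopology_def
  proof (intro conjI allI impI)
    fix S T
    assume "S \<subseteq> topspace X // r \<and> openin X {x \<in> topspace X. r `` {x} \<in> S}"
      and "T \<subseteq> topspace X // r \<and> openin X {x \<in> topspace X. r `` {x} \<in> T}"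
    moreover have "{x \<in> topspace X. r `` {x} \<in> S \<inter> T} =
        {x \<in> topspace X. r `` {x} \<in> S} \<inter> {x \<in> topspace X. r `` {x} \<in> T}"
      by blast
    ultimately show "S \<inter> T \<subseteq> topspace X // r"
      and "openin X {x \<in> topspace X. r `` {x} \<in> S \<inter> T}"
      by auto
  next
    fix \<K>
    assume *: "\<forall>K\<in>\<K>. K \<subseteq> topspace X // r \<and> openin X {x \<in> topspace X. r `` {x} \<in> K}"
    then show "\<Union>\<K> \<subseteq> topspace X // r"
      by blast
    have "{x \<in> topspace X. r `` {x} \<in> \<Union>\<K>} = (\<Union>K\<in>\<K>. {x \<in> topspace X. r `` {x} \<in> K})"
      by blast
    with * show "openin X {x \<in> topspace X. r `` {x} \<in> \<Union>\<K>}"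
      by auto
  qed
  then show ?thesis
    by (simp add: quotient_topology_def)
qed

lemma quotient_map_quotient_topology:
  "quotient_map X (quotient_topology X r) (\<lambda>x. r `` {x})"
proof -
  have "{x \<in> topspace X. r `` {x} \<in> topspace X // r} = topspace X"
    by (auto simp: quotient_def)
  then have "openin (quotient_topology X r) (topspace X // r)"
    by (simp add: openin_quotient_topology)
  then have "topspace (quotient_topology X r) = topspace X // r"
    by (metis openin_quotient_topology openin_subset openin_topspace subset_antisym)
  then show ?thesis
    by (auto simp: quotient_map_def openin_quotient_topology quotient_def)
qed

text \<open>The free part is invariant under \<open>tree_Aut d\<close>, so the classes of its points are the
  same in the free part as in the whole space.\<close>

definition free_quotient_space :: "nat \<Rightarrow> (nat list \<Rightarrow> bool) set topology" where
  "free_quotient_space d =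
     quotient_topology (subtopology (labelling_space d) (free_part d)) (root_orbit_rel d)"

definition labelled_tree_graph ::
    "nat \<Rightarrow> ((nat list \<Rightarrow> bool) set \<times> (nat list \<Rightarrow> bool) set) set" where
  "labelled_tree_graph d =
     {(A, B). A \<in> topspace (labelling_space d) // root_orbit_rel d \<and>
              B \<in> topspace (labelling_space d) // root_orbit_rel d \<and>
              (\<forall>z\<in>A. \<exists>g\<in>tree_Aut d. (tree_root, g tree_root) \<in> tree_edges d \<and> act g z \<in> B)}"

definition free_labelled_tree_graph ::
    "nat \<Rightarrow> ((nat list \<Rightarrow> bool) set \<times> (nat list \<Rightarrow> bool) set) set" where
  "free_labelled_tree_graph d =
     labelled_tree_graph d \<inter>
       (free_part d // root_orbit_rel d) \<times> (free_part d // root_orbit_rel d)"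

end

theory Submission
  imports Defs
begin

text \<open>
  A continuous labelling of \<open>\<T>\<close> that yields a map into the free part need not exist: if \<open>\<T>\<close>
  comes from a group acting on its profinite completion, then every continuous labelling is
  periodic. So the local rule behind the given solution is transferred instead. Call a labelling
  rigid at scale \<open>k\<close> if distinct vertices at distance at most \<open>k\<close> have non-isomorphic labelled
  balls of radius \<open>\<rho> k\<close>. The labellings of the regular tree that are rigid at all scales form a
  compact invariant subset of the free part, and on it the given solution depends on labels
  within one fixed radius. By compactness every labelling that is rigid at the scales below some
  \<open>n\<close> looks, up to that radius, like one that is rigid at all scales. So it suffices that, with
  \<open>\<rho>\<close> independent of \<open>n\<close>, every continuous tree has a continuous labelling that is rigid at the
  scales below \<open>n\<close>.

  Such a labelling is built scale by scale. At each stage a sufficiently dense set of vertices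
  still has a free label, and this set can be recognized locally however the free labels are
  filled in. The next scale uses up some of the free labels to mark a separated set of centres
  and to write next to each centre its colour in a proper colouring of a large power of the
  tree. An isomorphism of balls around two close vertices moves some centre to another nearby
  centre of the same colour, which is impossible. A ball of radius \<open>b\<close> has about
  \<open>(\<Delta> - 1) ^ b\<close> vertices, so a bounded number of counts of ones suffices to write the colour.
\<close>

section \<open>Distances in regular forests\<close>

text \<open>A ball offers no names for its vertices, so only isomorphism invariants can carry a
  message; hence a colour is written as numbers of ones at given distances from a centre. The danger
  is a circular choice of sizes. Centres must be further apart than their codes reach, so the centre
  used against an isomorphism at scale k may move by D = k + 4 * t, which contains 12 * b however b
  is chosen. Up to (\<Delta> + 1) ^ D colours have to be told apart, whereas an annulus beyond
  radius b is only sure to hold (\<Delta> - 1) ^ b free vertices. Since \<Delta> + 1 \<le> (\<Delta>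
  - 1) ^ 2 for \<Delta> > 2, it suffices that 25 digits, worth 25 * b, match 2 * D = 24 * b + 2 * k
  + 872 * r + 8, and b is defined to make these equal. The number of digits enters D only through
  the coefficient of r, so no circularity remains. The 53 annuli are 25 with digits, one free and 27
  with zeros; the zeros keep other vertices from imitating a centre.\<close>

definition gdist :: "('a \<times> 'a) set \<Rightarrow> 'a \<Rightarrow> 'a \<Rightarrow> nat" where
  "gdist G x y = (LEAST n. (x, y) \<in> G ^^ n)"

text \<open>Reachability is a separate condition because \<open>gdist\<close> between different
  components is an unspecified number, and the graphs here are forests.\<close>

definition gball :: "('a \<times> 'a) set \<Rightarrow> 'a \<Rightarrow> nat \<Rightarrow> 'a set" where
  "gball G x R = {y. (x, y) \<in> G\<^sup>* \<and> gdist G x y \<le> R}"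

lemma gdist_le: "(x, y) \<in> G ^^ n \<Longrightarrow> gdist G x y \<le> n"
  unfolding gdist_def by (rule Least_le)

lemma relpow_gdist: "(x, y) \<in> G\<^sup>* \<Longrightarrow> (x, y) \<in> G ^^ gdist G x y"
  unfolding gdist_def by (metis LeastI_ex rtrancl_imp_relpow)

lemma gdist_refl [simp]: "gdist G x x = 0"
  using gdist_le[of x x 0 G] by simp

lemma gdist_eq_0_iff: "(x, y) \<in> G\<^sup>* \<Longrightarrow> gdist G x y = 0 \<longleftrightarrow> x = y"
  using relpow_gdist[of x y G] by auto

lemma gdist_triangle:
  assumes "(x, y) \<in> G\<^sup>*" "(y, z) \<in> G\<^sup>*"
  shows "gdist G x z \<le> gdist G x y + gdist G y z"
proof -
  have "(x, z) \<in> G ^^ (gdist G x y + gdist G y z)"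
    using relpow_gdist[OF assms(1)] relpow_gdist[OF assms(2)] by (auto simp: relpow_add)
  then show ?thesis by (rule gdist_le)
qed

lemma gdist_edge_le: "(x, y) \<in> G \<Longrightarrow> gdist G x y \<le> 1"
  using gdist_le[of x y 1 G] by simp

lemma gdist_eq_1_D: "(x, y) \<in> G\<^sup>* \<Longrightarrow> gdist G x y = 1 \<Longrightarrow> (x, y) \<in> G"
  using relpow_gdist[of x y G] by simp

lemma gball_refl [simp]: "x \<in> gball G x R"
  by (simp add: gball_def)

lemma gball_0 [simp]: "gball G x 0 = {x}"
  by (auto simp: gball_def gdist_eq_0_iff)

lemma gball_mono: "R \<le> R' \<Longrightarrow> gball G x R \<subseteq> gball G x R'"
  by (auto simp: gball_def)

lemma gball_le: "y \<in> gball G x R \<Longrightarrow> R \<le> R' \<Longrightarrow> y \<in> gball G x R'"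
  by (simp add: gball_def)

lemma gball_trans: "y \<in> gball G x R \<Longrightarrow> z \<in> gball G y R' \<Longrightarrow> z \<in> gball G x (R + R')"
  unfolding gball_def using gdist_triangle[of x y G z] by (auto intro: rtrancl_trans)

text \<open>Cutting at a repeated vertex turns a walk into a path. The bound on
  \<open>set xs\<close> records that the path stays off the vertices avoided by \<open>H\<close>,
  which is needed to close it into a cycle.\<close>

lemma ex_distinct_path:
  assumes "(p, q) \<in> H\<^sup>*"
  shows "\<exists>xs. xs \<noteq> [] \<and> hd xs = p \<and> last xs = q \<and> distinct xs \<and> successively (\<lambda>x y. (x, y) \<in> H) xs
              \<and> set xs \<subseteq> insert p (Range H)"
  using assms
proof (induction rule: rtrancl_induct)
  case base
  show ?case by (rule exI[of _ "[p]"]) auto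
next
  case (step y z)
  then obtain xs where xs: "xs \<noteq> []" "hd xs = p" "last xs = y" "distinct xs"
    "successively (\<lambda>x y. (x, y) \<in> H) xs" "set xs \<subseteq> insert p (Range H)" by blast
  show ?case
  proof (cases "z \<in> set xs")
    case True
    then obtain ys zs where "xs = ys @ z # zs" by (meson split_list)
    with xs show ?thesis
      by (intro exI[of _ "ys @ [z]"]) (auto simp: successively_append_iff hd_append split: if_splits)
  next
    case False
    with xs step.hyps(2) show ?thesis
      by (intro exI[of _ "xs @ [z]"]) (auto simp: successively_append_iff Range_iff)
  qed
qed

locale regular_forest =
  fixes d :: nat and V :: "'a set" and G :: "('a \<times> 'a) set"
  assumes d_gt_2: "2 < d"
    and simple: "simple_graph V G"
    and acyclic: "acyclic_graph G"
    and regular: "regular_graph d V G"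
begin

abbreviation \<delta> :: "'a \<Rightarrow> 'a \<Rightarrow> nat" where "\<delta> \<equiv> gdist G"
abbreviation con :: "'a \<Rightarrow> 'a \<Rightarrow> bool" where "con x y \<equiv> (x, y) \<in> G\<^sup>*"

lemma edge_sym: "(x, y) \<in> G \<Longrightarrow> (y, x) \<in> G"
  using simple by (auto simp: simple_graph_def dest: symD)

lemma edge_in_V: "(x, y) \<in> G \<Longrightarrow> x \<in> V \<and> y \<in> V"
  using simple by (auto simp: simple_graph_def)

lemma edge_irrefl: "(x, x) \<notin> G"
  using simple by (auto simp: simple_graph_def irrefl_def)

lemma con_sym: "con x y \<Longrightarrow> con y x"
  using simple by (metis simple_graph_def sym_rtrancl symD)

lemma con_in_V: "con x y \<Longrightarrow> x \<in> V \<Longrightarrow> y \<in> V"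
  by (induction rule: rtrancl_induct) (auto dest: edge_in_V)

lemma con_edge: "con x y \<Longrightarrow> (y, z) \<in> G \<Longrightarrow> con x z"
  by (rule rtrancl_into_rtrancl)

lemma gball_in_V: "x \<in> V \<Longrightarrow> y \<in> gball G x R \<Longrightarrow> y \<in> V"
  using con_in_V[of x y] by (simp add: gball_def)

lemma relpow_sym: "(x, y) \<in> G ^^ n \<Longrightarrow> (y, x) \<in> G ^^ n"
proof (induction n arbitrary: y)
  case (Suc n)
  then obtain z where "(x, z) \<in> G ^^ n" "(z, y) \<in> G" by auto
  then have "(y, z) \<in> G" "(z, x) \<in> G ^^ n" using Suc.IH edge_sym by auto
  then show ?case by (rule relpow_Suc_I2)
qed simp

lemma \<delta>_sym: "\<delta> x y = \<delta> y x"
  unfolding gdist_def by (metis relpow_sym)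

lemma gball_sym: "y \<in> gball G x R \<Longrightarrow> x \<in> gball G y R"
  by (auto simp: gball_def con_sym \<delta>_sym)

lemma \<delta>_edge: "(x, y) \<in> G \<Longrightarrow> \<delta> x y = 1"
  using gdist_edge_le[of x y G] gdist_eq_0_iff[of x y G] edge_irrefl[of x] by force

lemma \<delta>_nbr_le: "con v u \<Longrightarrow> (u, w) \<in> G \<Longrightarrow> \<delta> v w \<le> \<delta> v u + 1"
  using gdist_triangle[of v u G w] \<delta>_edge[of u w] by auto

lemma finite_nbrs: "finite (G `` {x})"
proof (cases "x \<in> V")
  case False
  then have "G `` {x} = {}" using edge_in_V by auto
  then show ?thesis by simp
qed (use regular in \<open>auto simp: regular_graph_def\<close>)

lemma card_nbrs: "x \<in> V \<Longrightarrow> card (G `` {x}) = d"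
  using regular by (auto simp: regular_graph_def)

lemma card_nbrs_le: "card (G `` {x}) \<le> d"
proof (cases "x \<in> V")
  case False
  then have "G `` {x} = {}" using edge_in_V by auto
  then show ?thesis by simp
qed (simp add: card_nbrs)

lemma ex_toward:
  assumes "con v u" "u \<noteq> v"
  shows "\<exists>p. (u, p) \<in> G \<and> con v p \<and> \<delta> v p + 1 = \<delta> v u"
proof -
  have "\<delta> v u \<noteq> 0" using assms by (simp add: gdist_eq_0_iff)
  then obtain n where n: "\<delta> v u = Suc n" using not0_implies_Suc by blast
  with relpow_gdist[OF assms(1)] obtain p where p: "(v, p) \<in> G ^^ n" "(p, u) \<in> G" by auto
  then have "con v p" by (auto intro: relpow_imp_rtrancl)
  moreover have "\<delta> v p \<le> n" using p(1) by (rule gdist_le)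
  ultimately show ?thesis using p(2) n \<delta>_nbr_le[of v p u] edge_sym by fastforce
qed

text \<open>Walking from \<open>p\<close> towards \<open>v\<close> decreases the distance to
  \<open>v\<close>, so after \<open>p\<close> every vertex is too close to \<open>v\<close> to be
  \<open>u\<close>.\<close>

lemma geodesic_avoids:
  assumes "con v p" "\<delta> v p \<le> \<delta> v u" "p \<noteq> u"
  shows "(v, p) \<in> (G \<inter> (- {u}) \<times> (- {u}))\<^sup>*"
  using assms
proof (induction "\<delta> v p" arbitrary: p)
  case 0
  then show ?case by (simp add: gdist_eq_0_iff)
next
  case (Suc n)
  then have "p \<noteq> v" by auto
  then obtain p' where p': "(p, p') \<in> G" "con v p'" "\<delta> v p' + 1 = \<delta> v p"
    using ex_toward Suc.prems by blast
  then have "p' \<noteq> u" using Suc.prems by auto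
  then have "(v, p') \<in> (G \<inter> (- {u}) \<times> (- {u}))\<^sup>*"
    using Suc p' by auto
  then show ?case
    using p' edge_sym Suc.prems \<open>p' \<noteq> u\<close> by (auto intro: rtrancl_into_rtrancl)
qed

text \<open>Two such neighbours would be joined through \<open>v\<close> by a path avoiding
  \<open>u\<close>, and \<open>u\<close> would close it into a cycle. Admitting equal distances also
  excludes edges inside a sphere, as \<open>nbr_cases\<close> requires.\<close>

lemma toward_unique:
  assumes "con v u" "(u, p) \<in> G" "(u, q) \<in> G" "\<delta> v p \<le> \<delta> v u" "\<delta> v q \<le> \<delta> v u"
  shows "p = q"
proof (rule ccontr)
  assume "p \<noteq> q"
  let ?H = "G \<inter> (- {u}) \<times> (- {u})"
  have ne: "p \<noteq> u" "q \<noteq> u" using assms edge_irrefl by auto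
  have "(v, p) \<in> ?H\<^sup>*" "(v, q) \<in> ?H\<^sup>*"
    using geodesic_avoids[of v p u] geodesic_avoids[of v q u] assms ne con_edge by blast+
  moreover have "sym ?H" using edge_sym by (auto simp: sym_def)
  ultimately have "(p, q) \<in> ?H\<^sup>*" by (meson rtrancl_trans sym_rtrancl symD)
  then obtain xs where xs: "xs \<noteq> []" "hd xs = p" "last xs = q" "distinct xs"
      "successively (\<lambda>x y. (x, y) \<in> ?H) xs" "set xs \<subseteq> insert p (Range ?H)"
    using ex_distinct_path by metis
  have "u \<notin> set xs" using xs(6) ne by auto
  moreover have "successively (\<lambda>x y. (x, y) \<in> G) xs"
    using xs(5) by (rule successively_mono) auto
  moreover have "length xs \<ge> 2"
    using xs(1,2,3) \<open>p \<noteq> q\<close> by (cases xs; cases "tl xs") auto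
  ultimately have "length (u # xs) \<ge> 3 \<and> distinct (u # xs) \<and>
      successively (\<lambda>x y. (x, y) \<in> G) (u # xs) \<and> (last (u # xs), hd (u # xs)) \<in> G"
    using xs assms edge_sym by (auto simp: successively_Cons)
  then show False using acyclic unfolding acyclic_graph_def by blast
qed

lemma nbr_cases:
  assumes "con v u" "(u, w) \<in> G"
  shows "\<delta> v w = \<delta> v u + 1 \<or> \<delta> v w + 1 = \<delta> v u"
proof (cases "\<delta> v w \<le> \<delta> v u")
  case True
  then have "u \<noteq> v" using assms \<delta>_edge by force
  then obtain p where "(u, p) \<in> G" "\<delta> v p + 1 = \<delta> v u" using ex_toward assms by blast
  then show ?thesis using toward_unique[of v u p w] assms True by auto
next
  case False
  then show ?thesis using \<delta>_nbr_le[OF assms] by auto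
qed

text \<open>Paths without backtracking are geodesics: after a step away from \<open>v\<close>, the
  only neighbour nearer to \<open>v\<close> is the vertex just left, so every further step towards
  \<open>x\<close> leads away from \<open>v\<close> too.\<close>

lemma geodesic_concat:
  assumes "con v w" "con x w" "w \<noteq> x" "(w, p) \<in> G" "\<delta> x p + 1 = \<delta> x w" "\<delta> v p = \<delta> v w + 1"
  shows "\<delta> v x = \<delta> v w + \<delta> w x"
proof -
  have "\<delta> v x = \<delta> v w + \<delta> x w"
    using assms
  proof (induction "\<delta> x w" arbitrary: w p)
    case 0
    then show ?case by simp
  next
    case (Suc n)
    show ?case
    proof (cases "p = x")
      case True
      then show ?thesis using Suc.prems by (auto)
    next
      case False
      have c: "con v p" "con x p" using Suc.prems con_edge by blast+
      obtain p' where p': "(p, p') \<in> G" "con x p'" "\<delta> x p' + 1 = \<delta> x p"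
        using ex_toward c False by metis
      have "p' \<noteq> w" using p' Suc.prems by auto
      moreover have "(p, w) \<in> G" using Suc.prems edge_sym by blast
      ultimately have "\<delta> v p' = \<delta> v p + 1"
        using nbr_cases[OF c(1) p'(1)] toward_unique[OF c(1) p'(1), of w] Suc.prems(6) by fastforce
      then have "\<delta> v x = \<delta> v p + \<delta> x p"
        using Suc.hyps(1)[of p p'] Suc.hyps(2) Suc.prems c p' False by auto
      then show ?thesis using Suc.prems by auto
    qed
  qed
  then show ?thesis by (simp add: \<delta>_sym)
qed

section \<open>Branches behind a vertex\<close>

lemma branch_step:
  assumes "con v w" "con w u" "\<delta> v u = \<delta> v w + \<delta> w u" "u \<noteq> w" "(u, u') \<in> G"
  shows "\<delta> v u' = \<delta> v w + \<delta> w u'"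
proof -
  have c: "con v u" using assms rtrancl_trans by metis
  obtain p where p: "(u, p) \<in> G" "con w p" "\<delta> w p + 1 = \<delta> w u"
    using ex_toward assms by metis
  have "\<delta> v p \<le> \<delta> v w + \<delta> w p" using gdist_triangle assms(1) p(2) .
  then have vp: "\<delta> v p \<le> \<delta> v u" using p assms by auto
  show ?thesis
  proof (cases "u' = p")
    case True
    then show ?thesis using nbr_cases[OF c p(1)] p assms vp by auto
  next
    case False
    then have "\<delta> v u' = \<delta> v u + 1" "\<delta> w u' = \<delta> w u + 1"
      using nbr_cases[OF c assms(5)] nbr_cases[OF assms(2) assms(5)]
        toward_unique[OF c assms(5) p(1)] toward_unique[OF assms(2) assms(5) p(1)] p vp by fastforce+
    then show ?thesis using assms by auto
  qed
qed

text \<open>The only exit from the branch behind \<open>w\<close> is \<open>w\<close> itself, which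
  is too far from \<open>w'\<close> to be passed. This keeps later searches in a prescribed
  direction.\<close>

lemma branch_ball:
  assumes "con v w" "con w w'" "\<delta> v w' = \<delta> v w + \<delta> w w'" "con w' u" "\<delta> w' u < \<delta> w w'"
  shows "\<delta> v u = \<delta> v w + \<delta> w u"
  using assms(4,5)
proof (induction "\<delta> w' u" arbitrary: u)
  case 0
  then show ?case using assms by (auto simp: gdist_eq_0_iff)
next
  case (Suc n)
  then have "u \<noteq> w'" by auto
  then obtain p where p: "(u, p) \<in> G" "con w' p" "\<delta> w' p + 1 = \<delta> w' u"
    using ex_toward Suc.prems by metis
  have cp: "con w p" using assms p rtrancl_trans by metis
  have "p \<noteq> w" using p Suc.prems \<delta>_sym[of w w'] by auto
  moreover have "\<delta> v p = \<delta> v w + \<delta> w p"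
    using Suc.hyps(1)[of p] Suc.hyps(2) Suc.prems p by auto
  ultimately show ?case using branch_step[OF assms(1) cp, of u] edge_sym p by auto
qed

text \<open>Going back from \<open>u\<close>, both geodesics have to use the unique neighbour nearer
  to \<open>v\<close>. Hence vertices chosen behind different vertices of one sphere are
  different.\<close>

lemma ancestor_unique:
  assumes "con v w" "con v w'" "con v u" "\<delta> v u = \<delta> v w + \<delta> w u" "\<delta> v u = \<delta> v w' + \<delta> w' u"
    "\<delta> v w = \<delta> v w'"
  shows "w = w'"
  using assms
proof (induction "\<delta> w u" arbitrary: u)
  case 0
  have "con w u" "con w' u" using "0.prems" con_sym rtrancl_trans by metis+
  then show ?case using 0 by (metis add_cancel_left_right gdist_eq_0_iff)
next
  case (Suc n)
  have c: "con w u" "con w' u" using Suc.prems con_sym rtrancl_trans by metis+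
  have "u \<noteq> w" "u \<noteq> w'" using Suc by auto
  then obtain p p' where p: "(u, p) \<in> G" "con w p" "\<delta> w p + 1 = \<delta> w u"
      and p': "(u, p') \<in> G" "con w' p'" "\<delta> w' p' + 1 = \<delta> w' u"
    using ex_toward c by metis
  have vp: "con v p" using Suc.prems(3) p(1) con_edge by blast
  have b: "\<delta> v p = \<delta> v w + \<delta> w p" "\<delta> v p' = \<delta> v w' + \<delta> w' p'"
    using branch_step[OF Suc.prems(1) c(1) Suc.prems(4) \<open>u \<noteq> w\<close> p(1)]
      branch_step[OF Suc.prems(2) c(2) Suc.prems(5) \<open>u \<noteq> w'\<close> p'(1)] by auto
  then have "p = p'" using toward_unique[OF Suc.prems(3) p(1) p'(1)] p p' Suc.prems by auto
  have "n = \<delta> w p" using p(3) Suc.hyps(2) by simp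
  then show ?case
    using Suc.hyps(1)[of p] Suc.prems(1,2,6) vp b \<open>p = p'\<close> by blast
qed

section \<open>Growth of spheres and balls\<close>

lemma card_nbrs_away:
  assumes "con v u" "v \<in> V"
  shows "d - 1 \<le> card {w. (u, w) \<in> G \<and> \<delta> v w = \<delta> v u + 1}"
proof -
  let ?T = "{w. (u, w) \<in> G \<and> \<delta> v w + 1 = \<delta> v u}"
  let ?A = "{w. (u, w) \<in> G \<and> \<delta> v w = \<delta> v u + 1}"
  have "p = q" if "p \<in> ?T" "q \<in> ?T" for p q
    using toward_unique[OF assms(1), of p q] that by auto
  then have "card ?T \<le> 1"
    by (metis (no_types, lifting) card_le_Suc0_iff_eq One_nat_def card.infinite zero_le)
  moreover have "G `` {u} = ?T \<union> ?A" using nbr_cases[OF assms(1)] by auto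
  moreover have "card (?T \<union> ?A) \<le> card ?T + card ?A" by (rule card_Un_le)
  ultimately show ?thesis using card_nbrs[OF con_in_V[OF assms]] by simp
qed

lemma ex_beyond:
  assumes "con v w" "w \<in> V"
  shows "\<exists>w'. con w w' \<and> \<delta> w w' = t \<and> \<delta> v w' = \<delta> v w + t"
proof (induction t)
  case 0
  then show ?case by (auto intro: exI[of _ w])
next
  case (Suc t)
  then obtain w' where w': "con w w'" "\<delta> w w' = t" "\<delta> v w' = \<delta> v w + t" by blast
  have c: "con v w'" "v \<in> V" using assms w' rtrancl_trans con_sym con_in_V by metis+
  have "card {u. (w', u) \<in> G \<and> \<delta> v u = \<delta> v w' + 1} \<noteq> 0"
    using card_nbrs_away[OF c] d_gt_2 by linarith
  then obtain u where u: "(w', u) \<in> G" "\<delta> v u = \<delta> v w' + 1"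
    by (metis (mono_tags, lifting) Collect_empty_eq card.empty)
  have "con w u" using w' u con_edge by metis
  moreover have "\<delta> w u \<le> t + 1" using \<delta>_nbr_le[OF w'(1) u(1)] w' by simp
  moreover have "\<delta> v u \<le> \<delta> v w + \<delta> w u"
    using gdist_triangle assms \<open>con w u\<close> by metis
  ultimately show ?case using u w' by (intro exI[of _ u]) auto
qed

lemma gball_Suc: "gball G x (Suc R) = gball G x R \<union> G `` gball G x R"
proof (intro subset_antisym subsetI)
  fix y assume y: "y \<in> gball G x (Suc R)"
  show "y \<in> gball G x R \<union> G `` gball G x R"
  proof (cases "y = x")
    case False
    with y obtain p where "(y, p) \<in> G" "con x p" "\<delta> x p + 1 = \<delta> x y"
      using ex_toward[of x y] by (auto simp: gball_def)
    then have "p \<in> gball G x R" "(p, y) \<in> G" using y edge_sym by (auto simp: gball_def)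
    then show ?thesis by blast
  qed simp
next
  fix y assume "y \<in> gball G x R \<union> G `` gball G x R"
  then show "y \<in> gball G x (Suc R)"
    using \<delta>_nbr_le[of x _ y] con_edge by (fastforce simp: gball_def)
qed

lemma finite_gball: "finite (gball G x R)"
proof (induction R)
  case (Suc R)
  have "G `` gball G x R = (\<Union>y\<in>gball G x R. G `` {y})" by blast
  then show ?case using Suc finite_nbrs by (simp add: gball_Suc)
qed simp

text \<open>The crude base \<open>d + 1\<close> is good enough: it is at most the square of
  \<open>d - 1\<close>, the base of the lower bound in \<open>card_sphere_ge\<close>.\<close>

lemma card_gball_le: "card (gball G x R) \<le> (d + 1) ^ R"
proof (induction R)
  case (Suc R)
  have "card (G `` gball G x R) = card (\<Union>y\<in>gball G x R. G `` {y})"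
    by (rule arg_cong[of _ _ card]) blast
  also have "\<dots> \<le> (\<Sum>y\<in>gball G x R. card (G `` {y}))"
    by (rule card_UN_le[OF finite_gball])
  also have "\<dots> \<le> (\<Sum>y\<in>gball G x R. d)" by (intro sum_mono card_nbrs_le)
  finally have "card (G `` gball G x R) \<le> card (gball G x R) * d" by simp
  then have "card (gball G x (Suc R)) \<le> card (gball G x R) * (d + 1)"
    using card_Un_le[of "gball G x R" "G `` gball G x R"] by (simp add: gball_Suc)
  also have "\<dots> \<le> (d + 1) ^ R * (d + 1)" using Suc by (rule mult_right_mono) simp
  finally show ?case by (simp add: mult.commute)
qed simp

lemma finite_sphere: "finite {u. con v u \<and> \<delta> v u = j}"
  by (rule finite_subset[OF _ finite_gball[of v j]]) (auto simp: gball_def)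

lemma card_sphere_ge:
  assumes "v \<in> V"
  shows "(d - 1) ^ j \<le> card {u. con v u \<and> \<delta> v u = j}"
proof (induction j)
  case 0
  have "{u. con v u \<and> \<delta> v u = 0} = {v}" by (auto simp: gdist_eq_0_iff)
  then show ?case by simp
next
  case (Suc j)
  let ?S = "{u. con v u \<and> \<delta> v u = j}"
  let ?C = "\<lambda>u. {w. (u, w) \<in> G \<and> \<delta> v w = \<delta> v u + 1}"
  have fin: "finite (?C u)" for u
    by (rule finite_subset[OF _ finite_nbrs[of u]]) auto
  have disj: "?C u \<inter> ?C u' = {}" if "u \<in> ?S" "u' \<in> ?S" "u \<noteq> u'" for u u'
  proof (rule ccontr)
    assume "?C u \<inter> ?C u' \<noteq> {}"
    then obtain w where w: "(u, w) \<in> G" "\<delta> v w = \<delta> v u + 1" "(u', w) \<in> G" "\<delta> v w = \<delta> v u' + 1"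
      by blast
    then have "con v w" using that con_edge by blast
    then show False using toward_unique[of v w u u'] w edge_sym that by auto
  qed
  have "(d - 1) ^ Suc j \<le> card ?S * (d - 1)"
    using mult_right_mono[OF Suc, of "d - 1"] by (simp add: mult.commute)
  also have "\<dots> = (\<Sum>u\<in>?S. d - 1)" by simp
  also have "\<dots> \<le> (\<Sum>u\<in>?S. card (?C u))"
    using card_nbrs_away assms by (intro sum_mono) auto
  also have "\<dots> = card (\<Union>u\<in>?S. ?C u)"
    using finite_sphere fin disj by (subst card_UN_disjoint) auto
  also have "\<dots> \<le> card {u. con v u \<and> \<delta> v u = Suc j}"
    using con_edge by (intro card_mono[OF finite_sphere]) auto
  finally show ?case .
qed

text \<open>Vertices on the outermost sphere of a ball around \<open>x\<close> are its leaves: a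
  geodesic from \<open>v\<close> that met \<open>w\<close> before \<open>p\<close> would continue to
  \<open>x\<close> and make \<open>v\<close> further from \<open>x\<close> than
  \<open>w\<close>.\<close>

lemma \<delta>_via_parent:
  assumes "con x w" "w \<noteq> x" "(w, p) \<in> G" "\<delta> x p + 1 = \<delta> x w" "con x v" "\<delta> x v \<le> \<delta> x w" "v \<noteq> w"
  shows "\<delta> v w = \<delta> v p + 1"
proof -
  have c: "con v w" using assms con_sym rtrancl_trans by metis
  have "\<delta> v w \<noteq> 0" using c assms by (simp add: gdist_eq_0_iff)
  moreover have "\<delta> v x = \<delta> v w + \<delta> w x" if "\<delta> v p = \<delta> v w + 1"
    using geodesic_concat[OF c assms(1-4) that] .
  ultimately show ?thesis
    using nbr_cases[OF c assms(3)] assms(6) \<delta>_sym[of v x] \<delta>_sym[of w x] by linarith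
qed

end

section \<open>Label-preserving isometries of balls\<close>

text \<open>The two graphs may have different vertex types, so one notion covers isomorphisms inside
  \<T>, automorphisms of the regular tree, and charts from the tree to \<T>.\<close>

definition giso :: "('a \<times> 'a) set \<Rightarrow> ('b \<times> 'b) set \<Rightarrow> ('a \<Rightarrow> 'c) \<Rightarrow> ('b \<Rightarrow> 'c) \<Rightarrow>
    nat \<Rightarrow> 'a \<Rightarrow> 'b \<Rightarrow> ('a \<Rightarrow> 'b) \<Rightarrow> bool" where
  "giso G H f g R x y \<theta> \<longleftrightarrow>
     \<theta> x = y \<and> bij_betw \<theta> (gball G x R) (gball H y R) \<and>
     (\<forall>u\<in>gball G x R. \<forall>w\<in>gball G x R. gdist H (\<theta> u) (\<theta> w) = gdist G u w) \<and>
     (\<forall>u\<in>gball G x R. g (\<theta> u) = f u)"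

lemma gisoD:
  assumes "giso G H f g R x y \<theta>"
  shows "\<theta> x = y" "bij_betw \<theta> (gball G x R) (gball H y R)"
    "u \<in> gball G x R \<Longrightarrow> w \<in> gball G x R \<Longrightarrow> gdist H (\<theta> u) (\<theta> w) = gdist G u w"
    "u \<in> gball G x R \<Longrightarrow> g (\<theta> u) = f u"
    "u \<in> gball G x R \<Longrightarrow> \<theta> u \<in> gball H y R"
    "u \<in> gball G x R \<Longrightarrow> gdist H y (\<theta> u) = gdist G x u"
  using assms unfolding giso_def by (auto dest: bij_betwE)

lemma giso_surj: "giso G H f g R x y \<theta> \<Longrightarrow> u' \<in> gball H y R \<Longrightarrow> \<exists>u\<in>gball G x R. u' = \<theta> u"
  unfolding giso_def bij_betw_def by blast

lemma giso_inj: "giso G H f g R x y \<theta> \<Longrightarrow> u \<in> gball G x R \<Longrightarrow> w \<in> gball G x R \<Longrightarrow> \<theta> u = \<theta> w \<longleftrightarrow> u = w"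
  unfolding giso_def bij_betw_def inj_on_def by blast

lemma giso_cong:
  assumes "giso G H f g R x y \<theta>"
    and "\<And>u. u \<in> gball G x R \<Longrightarrow> \<theta>' u = \<theta> u"
    and "\<And>u. u \<in> gball G x R \<Longrightarrow> f' u = f u \<Longrightarrow> g (\<theta> u) = f u \<Longrightarrow> g' (\<theta> u) = f' u"
    and "\<And>u. u \<in> gball G x R \<Longrightarrow> f' u = f u"
  shows "giso G H f' g' R x y \<theta>'"
  using assms bij_betw_cong[of "gball G x R" \<theta>' \<theta> "gball H y R"] by (simp add: giso_def)

lemma giso_relabel:
  assumes "giso G H f g R x y \<theta>"
    and "\<And>u. u \<in> gball G x R \<Longrightarrow> g (\<theta> u) = f u \<Longrightarrow> g' (\<theta> u) = f' u"
  shows "giso G H f' g' R x y \<theta>"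
  using assms unfolding giso_def by simp

lemma giso_comp:
  assumes "giso G H f g R x y \<theta>" "giso H K g h R y z \<eta>"
  shows "giso G K f h R x z (\<lambda>u. \<eta> (\<theta> u))"
  using assms bij_betw_trans[of \<theta> "gball G x R" "gball H y R" \<eta> "gball K z R"]
  unfolding giso_def comp_def by (auto dest!: bij_betwE)

lemma giso_inv:
  assumes "giso G H f g R x y \<theta>"
  shows "giso H G g f R y x (inv_into (gball G x R) \<theta>)"
proof -
  let ?i = "inv_into (gball G x R) \<theta>"
  have b: "bij_betw \<theta> (gball G x R) (gball H y R)" using assms by (rule gisoD)
  then have b': "bij_betw ?i (gball H y R) (gball G x R)" by (rule bij_betw_inv_into)
  have i: "?i (\<theta> u) = u" if "u \<in> gball G x R" for u
    using b that by (simp add: bij_betw_def)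
  have r: "\<theta> (?i u) = u" if "u \<in> gball H y R" for u
    using b that by (simp add: bij_betw_def f_inv_into_f)
  have m: "?i u \<in> gball G x R" if "u \<in> gball H y R" for u using b' that by (auto dest: bij_betwE)
  show ?thesis
    unfolding giso_def
  proof (intro conjI ballI b')
    show "?i y = x" using i[of x] gisoD(1)[OF assms] by simp
    show "gdist G (?i u) (?i w) = gdist H u w" if "u \<in> gball H y R" "w \<in> gball H y R" for u w
      using gisoD(3)[OF assms m m] that r by metis
    show "f (?i u) = g u" if "u \<in> gball H y R" for u
      using gisoD(4)[OF assms m[OF that]] r that by metis
  qed
qed

lemma image_mset_eq_bij:
  assumes "finite A" "finite B" "image_mset f (mset_set A) = image_mset g (mset_set B)"
  shows "\<exists>h. bij_betw h A B \<and> (\<forall>a\<in>A. g (h a) = f a)"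
  using assms
proof (induction A arbitrary: B rule: finite_induct)
  case empty
  then have "B = {}" by (simp add: mset_set_empty_iff)
  then show ?case by (auto simp: bij_betw_def)
next
  case (insert a A)
  then have "f a \<in># image_mset g (mset_set B)"
    by (metis finite_insert image_mset_add_mset mset_set.insert union_single_eq_member)
  then obtain b where b: "b \<in> B" "g b = f a" using insert.prems by auto
  then have "image_mset g (mset_set B) = add_mset (f a) (image_mset g (mset_set (B - {b})))"
    using insert.prems(1) by (metis image_mset_add_mset mset_set.remove)
  then have "image_mset f (mset_set A) = image_mset g (mset_set (B - {b}))"
    using insert by simp
  then obtain h where h: "bij_betw h A (B - {b})" "\<forall>a\<in>A. g (h a) = f a"
    using insert.IH insert.prems by blast
  let ?h = "h(a := b)"
  have "bij_betw ?h A (B - {b})"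
    using h(1) insert.hyps by (subst bij_betw_cong[where g = h]) auto
  then have "bij_betw ?h (insert a A) B"
    using b insert.hyps(2) bij_betw_combine[of ?h A "B - {b}" "{a}" "{b}"]
    by (simp add: insert_absorb)
  moreover have "\<forall>x\<in>insert a A. g (?h x) = f x" using h(2) b by simp
  ultimately show ?case by blast
qed

locale regular_forest_pair = dom: regular_forest d V G + cod: regular_forest d W H
  for d :: nat and V :: "'a set" and G and W :: "'b set" and H
begin

lemma giso_subball:
  assumes "giso G H f g R x y \<theta>" "u \<in> gball G x R'" "R' + a \<le> R"
  shows "giso G H f g a u (\<theta> u) \<theta>"
proof -
  have sub: "w \<in> gball G x R" if "w \<in> gball G u a" for w
    using gball_le[OF gball_trans[OF assms(2) that] assms(3)] .
  have u: "u \<in> gball G x R" using sub by simp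
  have con: "(\<theta> u, \<theta> w) \<in> H\<^sup>*" if "w \<in> gball G u a" for w
    using gisoD(5)[OF assms(1) u] gisoD(5)[OF assms(1) sub[OF that]]
    by (metis (mono_tags, lifting) cod.con_sym gball_def mem_Collect_eq rtrancl_trans)
  have "\<theta> ` gball G u a = gball H (\<theta> u) a"
  proof (intro subset_antisym subsetI)
    fix z assume "z \<in> \<theta> ` gball G u a"
    then obtain w where w: "w \<in> gball G u a" "z = \<theta> w" by blast
    then show "z \<in> gball H (\<theta> u) a"
      using con gisoD(3)[OF assms(1) u sub[OF w(1)]] by (simp add: gball_def)
  next
    fix z assume z: "z \<in> gball H (\<theta> u) a"
    have "\<theta> u \<in> gball H y R'"
      using gisoD(5,6)[OF assms(1) u] assms(2) by (auto simp: gball_def)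
    then have "z \<in> gball H y R"
      using gball_le[OF gball_trans[OF _ z] assms(3)] by blast
    then obtain w where w: "w \<in> gball G x R" "z = \<theta> w" using giso_surj[OF assms(1)] by blast
    have "(u, w) \<in> G\<^sup>*"
      using u w(1) dom.con_sym rtrancl_trans unfolding gball_def mem_Collect_eq by metis
    moreover have "gdist G u w \<le> a"
      using gisoD(3)[OF assms(1) u w(1)] z w(2) by (simp add: gball_def)
    ultimately show "z \<in> \<theta> ` gball G u a" using w(2) by (auto simp: gball_def)
  qed
  moreover have "inj_on \<theta> (gball G u a)"
    using gisoD(2)[OF assms(1)] sub by (auto simp: bij_betw_def inj_on_def)
  ultimately show ?thesis
    using sub gisoD(3,4)[OF assms(1)] by (auto simp: giso_def bij_betw_def)
qed

lemma giso_mono: "giso G H f g R x y \<theta> \<Longrightarrow> R' \<le> R \<Longrightarrow> giso G H f g R' x y \<theta>"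
  using giso_subball[of f g R x y \<theta> x 0 R'] gisoD(1)[of G H f g R x y \<theta>] by simp

lemma giso_edge_iff:
  assumes "giso G H f g R x y \<theta>" "u \<in> gball G x R" "w \<in> gball G x R"
  shows "(\<theta> u, \<theta> w) \<in> H \<longleftrightarrow> (u, w) \<in> G"
proof -
  have "(u, w) \<in> G\<^sup>*" "(\<theta> u, \<theta> w) \<in> H\<^sup>*"
    using assms(2,3) gisoD(5)[OF assms(1) assms(2)] gisoD(5)[OF assms(1) assms(3)]
    by (metis (mono_tags, lifting) dom.con_sym cod.con_sym gball_def mem_Collect_eq rtrancl_trans)+
  then show ?thesis
    using gisoD(3)[OF assms] dom.\<delta>_edge cod.\<delta>_edge gdist_eq_1_D by metis
qed

text \<open>Neighbours of \<open>u\<close> inside the ball already match with their labels, so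
  cancelling them from the two multisets matches the neighbours outside. New vertices are leaves of
  the larger ball, hence their distances are those of their parents plus one, and any
  label-preserving matching is isometric.\<close>

lemma giso_extend_step:
  assumes \<theta>: "giso G H f g R x y \<theta>"
    and ms: "\<And>u. u \<in> gball G x R \<Longrightarrow>
      image_mset f (mset_set (G `` {u})) = image_mset g (mset_set (H `` {\<theta> u}))"
  shows "\<exists>\<theta>'. giso G H f g (Suc R) x y \<theta>' \<and> (\<forall>u\<in>gball G x R. \<theta>' u = \<theta> u)"
proof -
  let ?B = "gball G x R" and ?C = "gball H y R"
  define ch where "ch u = {w \<in> G `` {u}. w \<notin> ?B}" for u
  define ch' where "ch' u = {w \<in> H `` {u}. w \<notin> ?C}" for u
  have "\<exists>h. bij_betw h (ch u) (ch' (\<theta> u)) \<and> (\<forall>a\<in>ch u. g (h a) = f a)" if u: "u \<in> ?B" for u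
  proof -
    let ?P = "G `` {u} \<inter> ?B" and ?P' = "H `` {\<theta> u} \<inter> ?C"
    have "\<theta> ` ?P = ?P'"
    proof (intro subset_antisym subsetI)
      fix z assume "z \<in> \<theta> ` ?P"
      then show "z \<in> ?P'" using giso_edge_iff[OF \<theta> u] gisoD(5)[OF \<theta>] by auto
    next
      fix z assume z: "z \<in> ?P'"
      then obtain w where "w \<in> ?B" "z = \<theta> w" using giso_surj[OF \<theta>] by blast
      then show "z \<in> \<theta> ` ?P" using giso_edge_iff[OF \<theta> u] z by auto
    qed
    moreover have inj: "inj_on \<theta> ?P"
      using gisoD(2)[OF \<theta>] by (auto simp: bij_betw_def inj_on_def)
    ultimately have "image_mset \<theta> (mset_set ?P) = mset_set ?P'"
      by (simp add: image_mset_mset_set)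
    moreover have "image_mset g (image_mset \<theta> (mset_set ?P)) = image_mset f (mset_set ?P)"
      using gisoD(4)[OF \<theta>] dom.finite_nbrs
        by (auto simp: multiset.map_comp intro!: image_mset_cong)
    ultimately have P: "image_mset g (mset_set ?P') = image_mset f (mset_set ?P)" by simp
    have fin: "finite (ch u)" "finite (ch' (\<theta> u))"
      unfolding ch_def ch'_def
      by (rule finite_subset[OF _ dom.finite_nbrs[of u]], blast)
        (rule finite_subset[OF _ cod.finite_nbrs[of "\<theta> u"]], blast)
    have "mset_set (G `` {u}) = mset_set ?P + mset_set (ch u)"
      using dom.finite_nbrs fin
        by (subst mset_set_Union[symmetric]) (auto simp: ch_def intro!: arg_cong[of _ _ mset_set])
    moreover have "mset_set (H `` {\<theta> u}) = mset_set ?P' + mset_set (ch' (\<theta> u))"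
      using cod.finite_nbrs fin
        by (subst mset_set_Union[symmetric]) (auto simp: ch'_def intro!: arg_cong[of _ _ mset_set])
    ultimately have "image_mset f (mset_set (ch u)) = image_mset g (mset_set (ch' (\<theta> u)))"
      using ms[OF u] P by simp
    with fin show ?thesis by (intro image_mset_eq_bij)
  qed
  then obtain \<beta> where \<beta>: "\<And>u. u \<in> ?B \<Longrightarrow> bij_betw (\<beta> u) (ch u) (ch' (\<theta> u))"
      "\<And>u a. u \<in> ?B \<Longrightarrow> a \<in> ch u \<Longrightarrow> g (\<beta> u a) = f a"
        by metis
  let ?B' = "gball G x (Suc R)" and ?C' = "gball H y (Suc R)"
  have "\<exists>p. (w, p) \<in> G \<and> (x, p) \<in> G\<^sup>* \<and> gdist G x p + 1 = gdist G x w" if "w \<in> ?B'" "w \<notin> ?B" for w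
    using dom.ex_toward[of x w] that by (cases "w = x") (auto simp: gball_def)
  then obtain par where par: "\<And>w. w \<in> ?B' \<Longrightarrow> w \<notin> ?B \<Longrightarrow>
      (w, par w) \<in> G \<and> (x, par w) \<in> G\<^sup>* \<and> gdist G x (par w) + 1 = gdist G x w" by metis
  have par_R: "par w \<in> ?B" "w \<in> ch (par w)" "gdist G x w = Suc R" "(x, w) \<in> G\<^sup>*" "w \<noteq> x" if "w \<in> ?B'" "w \<notin> ?B" for w
    using par[OF that] that dom.edge_sym by (auto simp: gball_def ch_def)
  define \<theta>' where "\<theta>' w = (if w \<in> ?B then \<theta> w else \<beta> (par w) w)" for w
  have old: "\<theta>' w = \<theta> w" if "w \<in> ?B" for w using that by (simp add: \<theta>'_def)
  have new: "\<theta>' w \<in> ch' (\<theta> (par w))" "g (\<theta>' w) = f w" if "w \<in> ?B'" "w \<notin> ?B" for w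
    using par_R[OF that] that \<beta>(1)[of "par w"] \<beta>(2)[of "par w" w]
      by (auto simp: \<theta>'_def dest: bij_betwE)
  have ch'D: "w \<in> ?C'" "(y, w) \<in> H\<^sup>*" "gdist H y w = Suc R" "(w, \<theta> u) \<in> H" "w \<noteq> y" "gdist H y (\<theta> u) = R"
    if "u \<in> ?B" "w \<in> ch' (\<theta> u)" for u w
  proof -
    have e: "(\<theta> u, w) \<in> H" "w \<notin> ?C" using that by (auto simp: ch'_def)
    have y: "(y, \<theta> u) \<in> H\<^sup>*" "gdist H y (\<theta> u) \<le> R"
      using gisoD(5)[OF \<theta> that(1)] by (auto simp: gball_def)
    then show c: "(y, w) \<in> H\<^sup>*" using e cod.con_edge by blast
    then show d: "gdist H y w = Suc R"  "gdist H y (\<theta> u) = R"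
      using e y cod.\<delta>_nbr_le[OF y(1) e(1)] by (auto simp: gball_def)
    then show "w \<in> ?C'" using c by (auto simp: gball_def)
    show "(w, \<theta> u) \<in> H" "w \<noteq> y" using e cod.edge_sym by (auto)
  qed
  have leaf: "gdist G v w = gdist G v (par w) + 1"
    if "w \<in> ?B'" "w \<notin> ?B" "v \<in> ?B'" "v \<noteq> w" for v w
    using dom.\<delta>_via_parent[of x w "par w" v] par_R[OF that(1,2)] par[OF that(1,2)] that
      by (simp add: gball_def)
  have leaf': "gdist H v (\<theta>' w) = gdist H v (\<theta> (par w)) + 1"
    if "w \<in> ?B'" "w \<notin> ?B" "v \<in> ?C'" "v \<noteq> \<theta>' w" for v w
    using cod.\<delta>_via_parent[of y "\<theta>' w" "\<theta> (par w)" v] ch'D[OF par_R(1)[OF that(1,2)] new(1)[OF that(1,2)]] that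
    by (simp add: gball_def)
  have iso1: "gdist H (\<theta>' v) (\<theta>' w) = gdist G v w"
    if w: "w \<in> ?B'" "w \<notin> ?B" and v: "v \<in> ?B" for v w
  proof -
    have vC: "\<theta> v \<in> ?C" using gisoD(5)[OF \<theta> v] .
    then have "\<theta> v \<in> ?C'" by (rule gball_le) simp
    moreover have "\<theta> v \<noteq> \<theta>' w" using new(1)[OF w] vC by (auto simp: ch'_def)
    ultimately have "gdist H (\<theta> v) (\<theta>' w) = gdist H (\<theta> v) (\<theta> (par w)) + 1"
      by (rule leaf'[OF w])
    moreover have "gdist G v w = gdist G v (par w) + 1"
      using leaf[OF w gball_le[OF v]] v w by fastforce
    ultimately show ?thesis using gisoD(3)[OF \<theta> v par_R(1)[OF w]] old[OF v] by simp
  qed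
  have iso2: "gdist H (\<theta>' v) (\<theta>' w) = gdist G v w"
    if w: "w \<in> ?B'" "w \<notin> ?B" and v: "v \<in> ?B'" "v \<notin> ?B" for v w
  proof (cases "v = w")
    case False
    have ne: "\<theta>' v \<noteq> \<theta>' w"
    proof
      assume eq: "\<theta>' v = \<theta>' w"
      have "(\<theta>' v, \<theta> (par v)) \<in> H" "(\<theta>' v, \<theta> (par w)) \<in> H" "gdist H y (\<theta> (par v)) \<le> gdist H y (\<theta>' v)"
         "gdist H y (\<theta> (par w)) \<le> gdist H y (\<theta>' v)" "(y, \<theta>' v) \<in> H\<^sup>*"
        using ch'D[OF par_R(1)[OF v] new(1)[OF v]] ch'D[OF par_R(1)[OF w] new(1)[OF w]] eq by auto
      then have "\<theta> (par v) = \<theta> (par w)" using cod.toward_unique by blast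
      then have pe: "par v = par w" using giso_inj[OF \<theta> par_R(1)[OF v] par_R(1)[OF w]] by simp
      then have "\<beta> (par v) v = \<beta> (par v) w" using eq v w by (simp add: \<theta>'_def)
      then show False using \<beta>(1)[OF par_R(1)[OF v]] par_R(2)[OF v] par_R(2)[OF w] pe False
        by (auto simp: bij_betw_def inj_on_def)
    qed
    have "gdist H (\<theta>' v) (\<theta>' w) = gdist H (\<theta>' v) (\<theta> (par w)) + 1"
      using leaf'[OF w _ ne] ch'D(1)[OF par_R(1)[OF v] new(1)[OF v]] by blast
    moreover have "gdist H (\<theta> (par w)) (\<theta>' v) = gdist G (par w) v"
      using iso1[OF v par_R(1)[OF w]] old[OF par_R(1)[OF w]] by simp
    moreover have "gdist G v w = gdist G v (par w) + 1" using leaf[OF w v(1) False] .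
    ultimately show ?thesis using dom.\<delta>_sym cod.\<delta>_sym by metis
  qed simp
  have iso: "gdist H (\<theta>' v) (\<theta>' w) = gdist G v w" if "v \<in> ?B'" "w \<in> ?B'" for v w
  proof -
    consider "v \<in> ?B" "w \<in> ?B" | "v \<in> ?B" "w \<notin> ?B" | "v \<notin> ?B" "w \<in> ?B" | "v \<notin> ?B" "w \<notin> ?B"
      by blast
    then show ?thesis
    proof cases
      case 1
      then show ?thesis using gisoD(3)[OF \<theta>] old by simp
    next
      case 2
      then show ?thesis using iso1 that by blast
    next
      case 3
      then show ?thesis using iso1[OF that(1) 3] dom.\<delta>_sym cod.\<delta>_sym by metis
    next
      case 4
      then show ?thesis using iso2 that by blast
    qed
  qed
  have im: "\<theta>' w \<in> ?C'" if "w \<in> ?B'" for w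
  proof (cases "w \<in> ?B")
    case True
    then show ?thesis using gball_le[OF gisoD(5)[OF \<theta> True], of "Suc R"] old[OF True] by simp
  next
    case False
    then show ?thesis using ch'D(1) new(1) par_R(1) that by blast
  qed
  have "inj_on \<theta>' ?B'"
  proof (rule inj_onI)
    fix v w assume vw: "v \<in> ?B'" "w \<in> ?B'" "\<theta>' v = \<theta>' w"
    then have "gdist G v w = 0" using iso[OF vw(1,2)] by simp
    moreover have "(v, w) \<in> G\<^sup>*"
      using vw dom.con_sym rtrancl_trans unfolding gball_def mem_Collect_eq by metis
    ultimately show "v = w" by (simp add: gdist_eq_0_iff)
  qed
  moreover have "?C' \<subseteq> \<theta>' ` ?B'"
  proof
    fix z assume z: "z \<in> ?C'"
    show "z \<in> \<theta>' ` ?B'"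
    proof (cases "z \<in> ?C")
      case True
      then obtain w where "w \<in> ?B" "z = \<theta> w" using giso_surj[OF \<theta>] by blast
      then show ?thesis using old[of w] gball_le[of w G x R "Suc R"] by force
    next
      case False
      then obtain p where "p \<in> ?C" "(p, z) \<in> H" using z by (auto simp: cod.gball_Suc)
      then obtain u where u: "u \<in> ?B" "p = \<theta> u" "(\<theta> u, z) \<in> H"
        using giso_surj[OF \<theta>] by blast
      then have "z \<in> ch' (\<theta> u)" using False by (simp add: ch'_def)
      then obtain w where w: "w \<in> ch u" "z = \<beta> u w"
        using \<beta>(1)[OF u(1)] by (auto simp: bij_betw_def)
      then have wB: "w \<notin> ?B" "(u, w) \<in> G" by (auto simp: ch_def)
      then have wB': "w \<in> ?B'" using u(1) by (auto simp: dom.gball_Suc)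
      have "par w = u"
        using dom.toward_unique[of x w "par w" u] par[OF wB' wB(1)] par_R[OF wB' wB(1)] wB(2) dom.edge_sym u(1)
        by (auto simp: gball_def)
      then show ?thesis using w wB wB' by (auto simp: \<theta>'_def)
    qed
  qed
  ultimately have "bij_betw \<theta>' ?B' ?C'" using im by (auto simp: bij_betw_def)
  moreover have "\<theta>' x = y" using old[of x] gisoD(1)[OF \<theta>] by simp
  moreover have "g (\<theta>' w) = f w" if "w \<in> ?B'" for w
    using new(2)[OF that] old[of w] gisoD(4)[OF \<theta>, of w] by (cases "w \<in> ?B") auto
  ultimately have "giso G H f g (Suc R) x y \<theta>'" using iso by (simp add: giso_def)
  then show ?thesis using old by blast
qed

text \<open>Without labels, regularity makes the condition of \<open>giso_extend_step\<close>
  automatic, so extension never stops. This yields automorphisms of the tree and isometries of the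
  tree onto a component of a forest.\<close>

lemma giso_extend:
  assumes "giso G H f g R x y \<theta>" "x \<in> V" "y \<in> W"
  shows "\<exists>\<theta>'. (\<forall>R'. giso G H (\<lambda>_. ()) (\<lambda>_. ()) R' x y \<theta>') \<and> (\<forall>u\<in>gball G x R. \<theta>' u = \<theta> u)"
proof -
  let ?I = "giso G H (\<lambda>_. ()) (\<lambda>_. ())"
  have step: "\<exists>\<theta>'. ?I (Suc n) x y \<theta>' \<and> (\<forall>u\<in>gball G x n. \<theta>' u = \<theta> u)" if "?I n x y \<theta>" for n \<theta>
  proof (rule giso_extend_step[OF that])
    fix u assume u: "u \<in> gball G x n"
    then have "u \<in> V" "\<theta> u \<in> W"
      using dom.con_in_V cod.con_in_V assms gisoD(5)[OF that u] by (auto simp: gball_def)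
    then show "image_mset (\<lambda>_. ()) (mset_set (G `` {u})) = image_mset (\<lambda>_. ()) (mset_set (H `` {\<theta> u}))"
      by (simp add: image_mset_const_eq dom.card_nbrs cod.card_nbrs)
  qed
  have "\<exists>\<Theta>. \<forall>n. (?I (R + n) x y (\<Theta> n) \<and> (n = 0 \<longrightarrow> \<Theta> n = \<theta>)) \<and> (\<forall>u\<in>gball G x (R + n). \<Theta> (Suc n) u = \<Theta> n u)"
  proof (rule dependent_nat_choice)
    show "\<exists>\<theta>'. ?I (R + 0) x y \<theta>' \<and> (0 = 0 \<longrightarrow> \<theta>' = \<theta>)"
      using assms(1) by (auto intro: giso_relabel)
    show "\<exists>\<eta>. (?I (R + Suc n) x y \<eta> \<and> (Suc n = 0 \<longrightarrow> \<eta> = \<theta>)) \<and> (\<forall>u\<in>gball G x (R + n). \<eta> u = \<zeta> u)"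
      if "?I (R + n) x y \<zeta> \<and> (n = 0 \<longrightarrow> \<zeta> = \<theta>)" for n \<zeta>
      using step[of "R + n" \<zeta>] that by simp
  qed
  then obtain \<Theta> where \<Theta>: "\<And>n. ?I (R + n) x y (\<Theta> n)" "\<Theta> 0 = \<theta>"
      "\<And>n u. u \<in> gball G x (R + n) \<Longrightarrow> \<Theta> (Suc n) u = \<Theta> n u" by metis
  have agree: "\<Theta> (n + k) u = \<Theta> n u" if "u \<in> gball G x (R + n)" for n k u
  proof (induction k)
    case (Suc k)
    have "u \<in> gball G x (R + (n + k))" using gball_le[OF that] by auto
    then show ?case using \<Theta>(3) Suc by simp
  qed simp
  \<comment> \<open>By \<open>agree\<close> the value at \<open>u\<close> is final from this index
    on.\<close>
  define \<eta> where "\<eta> u = \<Theta> (gdist G x u) u" for u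
  have \<eta>: "\<eta> u = \<Theta> n u" if "u \<in> gball G x (R + n)" for u n
  proof -
    have "u \<in> gball G x (R + gdist G x u)" using that by (simp add: gball_def)
    then have "\<Theta> (gdist G x u + n) u = \<Theta> (gdist G x u) u" by (rule agree)
    moreover have "\<Theta> (n + gdist G x u) u = \<Theta> n u" by (rule agree[OF that])
    ultimately show ?thesis by (simp add: \<eta>_def add.commute)
  qed
  have "?I R' x y \<eta>" for R'
  proof -
    have "?I (R + R') x y \<eta>" using \<Theta>(1)[of R'] by (rule giso_cong) (auto simp: \<eta>)
    then show ?thesis by (rule giso_mono) simp
  qed
  moreover have "\<eta> u = \<theta> u" if "u \<in> gball G x R" for u
    using \<eta>[of u 0] that \<Theta>(2) by simp
  ultimately show ?thesis by blast
qed

end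

section \<open>Locally constant functions on continuous trees\<close>

lemma separable_metrizable_imp_second_countable:
  assumes "metrizable_space X" "separable_space X"
  shows "second_countable X"
proof -
  obtain M m where Mm: "Metric_space M m" and X: "X = Metric_space.mtopology M m"
    using assms(1) by (auto simp: metrizable_space_def)
  interpret Metric_space M m by (rule Mm)
  obtain C where C: "countable C" "C \<subseteq> topspace X" "X closure_of C = topspace X"
    using assms(2) by (auto simp: separable_space_def)
  let ?b = "\<lambda>(c, n). mball c (1 / real (Suc n))"
  let ?B = "?b ` (C \<times> (UNIV :: nat set))"
  have "\<exists>W\<in>?B. x \<in> W \<and> W \<subseteq> U" if U: "openin X U" "x \<in> U" for U x
  proof -
    obtain r where r: "r > 0" "mball x r \<subseteq> U" using U by (auto simp: X openin_mtopology)
    have xM: "x \<in> M" using U openin_subset by (fastforce simp: X)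
    obtain n where n: "1 / real (Suc n) < r / 2"
      using reals_Archimedean[of "r / 2"] r by (auto simp: inverse_eq_divide)
    let ?e = "1 / real (Suc n)"
    have "x \<in> X closure_of C" using C(3) xM X by simp
    moreover have "openin X (mball x ?e)" by (simp add: X)
    moreover have "x \<in> mball x ?e" using xM by simp
    ultimately obtain c where c: "c \<in> C" "c \<in> mball x ?e" unfolding in_closure_of by blast
    have "mball c ?e \<subseteq> mball x r"
    proof
      fix y assume y: "y \<in> mball c ?e"
      have "m x y \<le> m x c + m c y" using y c xM by (intro triangle) auto
      moreover have "m x c < ?e" "m c y < ?e" using y c commute[of x c] unfolding in_mball by auto
      ultimately have "m x y < r" using n by linarith
      then show "y \<in> mball x r" using xM y unfolding in_mball by blast
    qed
    moreover have "x \<in> mball c ?e" using c(2) commute[of x c] unfolding in_mball by auto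
    ultimately show ?thesis using c(1) r(2) by blast
  qed
  then have base: "\<forall>U x. openin X U \<and> x \<in> U \<longrightarrow> (\<exists>W\<in>?B. x \<in> W \<and> W \<subseteq> U)"
    by blast
  have "countable ?B" using C(1) by (intro countable_image countable_SIGMA) auto
  moreover have "\<forall>W\<in>?B. openin X W" by (auto simp: X)
  ultimately show ?thesis unfolding second_countable_def using base by (intro exI[of _ ?B] conjI)
qed

text \<open>Continuity into a discrete space, without fixing a codomain, so that tuples and
  multisets can serve as labels.\<close>

definition locally_constant :: "'a topology \<Rightarrow> ('a \<Rightarrow> 'b) \<Rightarrow> bool" where
  "locally_constant X f \<longleftrightarrow> (\<forall>x\<in>topspace X. \<exists>U. openin X U \<and> x \<in> U \<and> (\<forall>y\<in>U. f y = f x))"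

lemma locally_constantD:
  assumes "locally_constant X f" "x \<in> topspace X"
  obtains U where "openin X U" "x \<in> U" "\<And>y. y \<in> U \<Longrightarrow> f y = f x"
proof -
  have "\<exists>U. openin X U \<and> x \<in> U \<and> (\<forall>y\<in>U. f y = f x)"
    using assms unfolding locally_constant_def by (rule bspec)
  then obtain U where U: "openin X U" "x \<in> U" "\<forall>y\<in>U. f y = f x" by (elim exE conjE)
  show thesis by (rule that[OF U(1,2) bspec[OF U(3)]])
qed

lemma locally_constant_openin:
  assumes "locally_constant X f"
  shows "openin X {x \<in> topspace X. P (f x)}"
proof (subst openin_subopen, intro ballI)
  fix x assume x: "x \<in> {x \<in> topspace X. P (f x)}"
  then obtain U where U: "openin X U" "x \<in> U" "\<And>y. y \<in> U \<Longrightarrow> f y = f x"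
    using locally_constantD[OF assms] by blast
  have "y \<in> topspace X \<and> P (f y)" if "y \<in> U" for y
    using x openin_subset[OF U(1)] U(3)[OF that] that by auto
  with U(1,2) show "\<exists>T. openin X T \<and> x \<in> T \<and> T \<subseteq> {x \<in> topspace X. P (f x)}"
    by (intro exI[of _ U]) blast
qed

lemma locally_constant_clopenin: "clopenin X S \<Longrightarrow> locally_constant X (\<lambda>x. x \<in> S)"
  unfolding locally_constant_def
proof
  fix x assume S: "clopenin X S" and x: "x \<in> topspace X"
  then have o: "openin X S" "openin X (topspace X - S)" by (auto simp: clopenin_def)
  show "\<exists>U. openin X U \<and> x \<in> U \<and> (\<forall>y\<in>U. (y \<in> S) = (x \<in> S))"
    using o x by (cases "x \<in> S"; intro exI[of _ "if x \<in> S then S else topspace X - S"]) auto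
qed

lemma locally_constant_const: "locally_constant X (\<lambda>_. c)"
  unfolding locally_constant_def by (intro ballI exI[of _ "topspace X"]) simp

lemma locally_constant_comp:
  assumes "locally_constant X f"
  shows "locally_constant X (\<lambda>x. h (f x))"
  unfolding locally_constant_def
proof
  fix x assume x: "x \<in> topspace X"
  obtain U where U: "openin X U" "x \<in> U" "\<And>y. y \<in> U \<Longrightarrow> f y = f x"
    using locally_constantD[OF assms x] by blast
  have "\<forall>y\<in>U. h (f y) = h (f x)" using arg_cong[OF U(3), of _ h] by blast
  with U(1,2) show "\<exists>U. openin X U \<and> x \<in> U \<and> (\<forall>y\<in>U. h (f y) = h (f x))"
    by blast
qed

lemma locally_constant_Pair:
  assumes "locally_constant X f" "locally_constant X g"
  shows "locally_constant X (\<lambda>x. (f x, g x))"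
  unfolding locally_constant_def
proof
  fix x assume x: "x \<in> topspace X"
  obtain U where U: "openin X U" "x \<in> U" "\<And>y. y \<in> U \<Longrightarrow> f y = f x"
    using locally_constantD[OF assms(1) x] by blast
  obtain W where W: "openin X W" "x \<in> W" "\<And>y. y \<in> W \<Longrightarrow> g y = g x"
    using locally_constantD[OF assms(2) x] by blast
  have "(f y, g y) = (f x, g x)" if "y \<in> U \<inter> W" for y using U(3)[of y] W(3)[of y] that by auto
  moreover have "openin X (U \<inter> W)" "x \<in> U \<inter> W" using U(1,2) W(1,2) by auto
  ultimately show "\<exists>U. openin X U \<and> x \<in> U \<and> (\<forall>y\<in>U. (f y, g y) = (f x, g x))"
    by blast
qed

locale continuous_forest = regular_forest d "topspace X" G
  for d :: nat and X :: "'a topology" and G :: "('a \<times> 'a) set" +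
  assumes continuous: "continuous_graph X G"
begin

lemma polish: "metrizable_space X" "separable_space X" "X dim_le 0"
  using continuous completely_metrizable_imp_metrizable_space[of X]
  unfolding continuous_graph_def zero_dim_polish_space_def by simp_all

lemma Hausdorff: "Hausdorff_space X"
  by (rule metrizable_imp_Hausdorff_space[OF polish(1)])

lemma Lindelof: "Lindelof_space X"
  by (rule second_countable_imp_Lindelof_space[OF separable_metrizable_imp_second_countable[OF polish(1,2)]])

lemma clopen_base:
  assumes "openin X U" "x \<in> U"
  shows "\<exists>W. clopenin X W \<and> x \<in> W \<and> W \<subseteq> U"
proof -
  have "neighbourhood_base_of (\<lambda>U. closedin X U \<and> openin X U) X"
    using polish(3) by (simp add: dimension_le_0_neighbourhood_base_of_clopen)
  then show ?thesis
    using assms unfolding clopenin_def by (metis (no_types, lifting) open_neighbourhood_base_of)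
qed

lemma clopenin_nbrs: "clopenin X U \<Longrightarrow> clopenin X (G `` U)"
  using continuous by (simp add: continuous_graph_def)

lemma closedin_finite: "finite F \<Longrightarrow> F \<subseteq> topspace X \<Longrightarrow> closedin X F"
  using Hausdorff_imp_t1_space[OF Hausdorff] unfolding t1_space_closedin_finite by simp

text \<open>Continuity of the graph enters here. Disjoint clopen sets around the neighbours of
  \<open>x\<close> have clopen images under \<open>G\<close>, and a vertex in all these images has a
  neighbour in each set; by regularity these are all its neighbours.\<close>

lemma locally_constant_nbr_labels:
  assumes f: "locally_constant X f"
  shows "locally_constant X (\<lambda>x. image_mset f (mset_set (G `` {x})))"
  unfolding locally_constant_def
proof
  fix x assume x: "x \<in> topspace X"
  let ?N = "G `` {x}"
  have N: "finite ?N" "?N \<subseteq> topspace X" using finite_nbrs edge_in_V by auto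
  have "\<exists>W. clopenin X W \<and> y \<in> W \<and> W \<inter> ?N = {y} \<and> (\<forall>z\<in>W. f z = f y)" if y: "y \<in> ?N" for y
  proof -
    have "openin X ({z \<in> topspace X. f z = f y} \<inter> (topspace X - (?N - {y})))"
      using N closedin_finite[of "?N - {y}"] locally_constant_openin[OF f, of "\<lambda>c. c = f y"]
        by auto
    then obtain W where "clopenin X W" "y \<in> W" "W \<subseteq> {z \<in> topspace X. f z = f y} \<inter> (topspace X - (?N - {y}))"
      using clopen_base[of _ y] y N by blast
    then show ?thesis using y by blast
  qed
  then obtain W where W: "\<And>y. y \<in> ?N \<Longrightarrow> clopenin X (W y) \<and> y \<in> W y \<and> W y \<inter> ?N = {y} \<and> (\<forall>z\<in>W y. f z = f y)"
    by metis
  define W' where "W' y = W y - \<Union> (W ` (?N - {y}))" for y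
  have W': "clopenin X (W' y)" "y \<in> W' y" if "y \<in> ?N" for y
  proof -
    have "openin X (\<Union> (W ` (?N - {y})))" "closedin X (\<Union> (W ` (?N - {y})))"
      using W N(1) by (auto simp: clopenin_def intro!: closedin_Union)
    then show "clopenin X (W' y)" using W[OF that] by (auto simp: W'_def clopenin_def)
    have "y \<notin> W z" if "z \<in> ?N - {y}" for z
    proof
      assume "y \<in> W z"
      then have "y \<in> W z \<inter> ?N" using \<open>y \<in> ?N\<close> by blast
      then show False using W[of z] that by auto
    qed
    then show "y \<in> W' y" using W[OF that] by (auto simp: W'_def)
  qed
  have disj: "y = z" if "y \<in> ?N" "z \<in> ?N" "u \<in> W' y" "u \<in> W' z" for y z u
    using that unfolding W'_def by blast
  define U where "U = topspace X \<inter> \<Inter> ((\<lambda>y. G `` W' y) ` ?N)"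
  have "openin X U"
    unfolding U_def using W'(1) clopenin_nbrs N(1)
    by (cases "?N = {}") (auto simp: clopenin_def intro!: openin_Inter openin_Int)
  moreover have "x \<in> U" using x W'(2) edge_sym by (auto simp: U_def)
  moreover have "image_mset f (mset_set (G `` {u})) = image_mset f (mset_set ?N)" if u: "u \<in> U" for u
  proof -
    have uX: "u \<in> topspace X" using u by (simp add: U_def)
    have "\<exists>z. (u, z) \<in> G \<and> z \<in> W' y" if "y \<in> ?N" for y
    proof -
      have "u \<in> G `` W' y" using u that unfolding U_def by blast
      then show ?thesis using edge_sym by blast
    qed
    then obtain h where h: "\<And>y. y \<in> ?N \<Longrightarrow> (u, h y) \<in> G \<and> h y \<in> W' y"
      by metis
    have inj: "inj_on h ?N" using h disj by (auto simp: inj_on_def) metis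
    have "h ` ?N = G `` {u}"
      using h finite_nbrs card_image[OF inj] card_nbrs[OF x] card_nbrs[OF uX]
      by (intro card_subset_eq) auto
    then have "mset_set (G `` {u}) = image_mset h (mset_set ?N)"
      using image_mset_mset_set[OF inj] by simp
    moreover have "f (h y) = f y" if "y \<in> ?N" for y
      using h[OF that] W[OF that] unfolding W'_def by blast
    ultimately show ?thesis using N(1) by (auto simp: multiset.map_comp intro!: image_mset_cong)
  qed
  ultimately show "\<exists>U. openin X U \<and> x \<in> U \<and> (\<forall>u\<in>U. image_mset f (mset_set (G `` {u})) = image_mset f (mset_set ?N))"
    by blast
qed

text \<open>Once each label also stores the labels of all neighbours, the ball of radius
  \<open>R\<close> determines the one of radius \<open>Suc R\<close>:
  \<open>giso_extend_step\<close> rebuilds the outer sphere.\<close>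

lemma locally_isometric_nat:
  fixes f :: "'a \<Rightarrow> nat"
  assumes "locally_constant X f" "x \<in> topspace X"
  shows "\<exists>U. openin X U \<and> x \<in> U \<and> (\<forall>y\<in>U. \<exists>\<sigma>. giso G G f f R x y \<sigma>)"
  using assms
proof (induction R arbitrary: f)
  case 0
  then obtain U where U: "openin X U" "x \<in> U" "\<And>y. y \<in> U \<Longrightarrow> f y = f x"
    using locally_constantD[OF "0.prems"] by blast
  have "giso G G f f 0 x y (\<lambda>_. y)" if "y \<in> U" for y
    using U(3)[OF that] by (auto simp: giso_def bij_betw_def)
  then show ?case using U by blast
next
  case (Suc R)
  define f' where "f' x = to_nat (f x, sorted_list_of_multiset (image_mset f (mset_set (G `` {x}))))" for x
  have "locally_constant X f'"
    unfolding f'_def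
    using locally_constant_comp[OF locally_constant_Pair[OF Suc.prems(1) locally_constant_nbr_labels[OF Suc.prems(1)]],
        of "\<lambda>(c, N). to_nat (c, sorted_list_of_multiset N)"] by simp
  then obtain U where U: "openin X U" "x \<in> U" "\<And>y. y \<in> U \<Longrightarrow> \<exists>\<sigma>. giso G G f' f' R x y \<sigma>"
    using Suc.IH[of f'] Suc.prems(2) by blast
  have "\<exists>\<sigma>. giso G G f f (Suc R) x y \<sigma>" if y: "y \<in> U" for y
  proof -
    obtain \<sigma> where \<sigma>: "giso G G f' f' R x y \<sigma>" using U y by blast
    then have "giso G G f f R x y \<sigma>" by (rule giso_relabel) (simp add: f'_def)
    moreover have "image_mset f (mset_set (G `` {u})) = image_mset f (mset_set (G `` {\<sigma> u}))"
      if "u \<in> gball G x R" for u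
      using gisoD(4)[OF \<sigma> that] mset_sorted_list_of_multiset unfolding f'_def
      by (metis (no_types, lifting) inj_to_nat injD prod.inject)
    ultimately show ?thesis
      using regular_forest_pair.giso_extend_step[OF regular_forest_pair.intro[OF regular_forest_axioms regular_forest_axioms]]
      by blast
  qed
  then show ?case using U(1,2) by blast
qed

text \<open>The induction above changes the labels and therefore stays within one countable type. For
  arbitrary labels it is enough that only finitely many of them occur on a single ball.\<close>

lemma locally_isometric:
  assumes f: "locally_constant X f" and x: "x \<in> topspace X"
  shows "\<exists>U. openin X U \<and> x \<in> U \<and> (\<forall>y\<in>U. \<exists>\<sigma>. giso G G f f R x y \<sigma>)"
proof -
  let ?S = "f ` gball G x R"
  obtain e :: "'b \<Rightarrow> nat" where e: "inj_on e ?S"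
    using finite_imp_inj_to_nat_seg[OF finite_imageI[OF finite_gball[of x R]]] by metis
  define g where "g u = (if f u \<in> ?S then Suc (e (f u)) else 0)" for u
  have "locally_constant X g"
    unfolding g_def
      using locally_constant_comp[OF f, of "\<lambda>c. if c \<in> ?S then Suc (e c) else 0"] .
  then obtain U where U: "openin X U" "x \<in> U" "\<forall>y\<in>U. \<exists>\<sigma>. giso G G g g R x y \<sigma>"
    using locally_isometric_nat[of g x R] x by blast
  have *: "giso G G f f R x y \<sigma>" if "giso G G g g R x y \<sigma>" for y \<sigma>
    using that
  proof (rule giso_relabel)
    fix u assume "u \<in> gball G x R" "g (\<sigma> u) = g u"
    moreover from this have "f u \<in> ?S" by blast
    ultimately have "f (\<sigma> u) \<in> ?S" "e (f (\<sigma> u)) = e (f u)"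
      unfolding g_def by (metis nat.distinct(1), metis nat.distinct(1) nat.inject)
    then show "f (\<sigma> u) = f u" using inj_onD[OF e] \<open>f u \<in> ?S\<close> by blast
  qed
  have "\<exists>\<sigma>. giso G G f f R x y \<sigma>" if "y \<in> U" for y
    using bspec[OF U(3) that] by (elim exE) (rule exI, erule *)
  with U(1,2) show ?thesis by blast
qed

text \<open>A rule that only sees a labelled ball up to isomorphism gives a locally constant result.
  The colourings and the partial labellings below are shown to be locally constant in this
  way.\<close>

lemma locally_constant_local_rule:
  assumes "locally_constant X f"
    and "\<And>x y \<sigma>. x \<in> topspace X \<Longrightarrow> y \<in> topspace X \<Longrightarrow> giso G G f f R x y \<sigma> \<Longrightarrow> F y = F x"
  shows "locally_constant X F"
  unfolding locally_constant_def
proof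
  fix x assume x: "x \<in> topspace X"
  obtain U where U: "openin X U" "x \<in> U" "\<forall>y\<in>U. \<exists>\<sigma>. giso G G f f R x y \<sigma>"
    using locally_isometric[OF assms(1) x, of R] by blast
  then have "F y = F x" if "y \<in> U" for y
    using assms(2)[OF x, of y] that openin_subset by blast
  then show "\<exists>U. openin X U \<and> x \<in> U \<and> (\<forall>y\<in>U. F y = F x)"
    using U by blast
qed

text \<open>Take a clopen set meeting the \<open>D\<close>-ball of \<open>x\<close> in
  \<open>x\<close> alone and use membership in it as a label. Points near \<open>x\<close> have
  isomorphic labelled balls, so those in the set see no second point of it either.\<close>

lemma ex_separating_nbhd:
  assumes x: "x \<in> topspace X"
  shows "\<exists>W. clopenin X W \<and> x \<in> W \<and> (\<forall>w\<in>W. \<forall>u\<in>W. u \<in> gball G w D \<longrightarrow> u = w)"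
proof -
  let ?N = "gball G x D - {x}"
  have "?N \<subseteq> topspace X" using gball_in_V[OF x] by blast
  then have cl: "closedin X ?N" using finite_gball[of x D] by (intro closedin_finite) simp_all
  then obtain W0 where W0: "clopenin X W0" "x \<in> W0" "W0 \<inter> ?N = {}"
    using clopen_base[OF openin_diff[OF openin_topspace cl], of x] x by blast
  let ?f = "\<lambda>x. x \<in> W0"
  obtain U where U: "openin X U" "x \<in> U" "\<forall>y\<in>U. \<exists>\<sigma>. giso G G ?f ?f D x y \<sigma>"
    using locally_isometric[OF locally_constant_clopenin[OF W0(1)] x, of D] by blast
  have sep: "u = w" if wu: "w \<in> U \<inter> W0" "u \<in> U \<inter> W0" "u \<in> gball G w D" for w u
  proof -
    obtain \<sigma> where \<sigma>: "giso G G ?f ?f D x w \<sigma>" using U wu by blast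
    then obtain v where v: "v \<in> gball G x D" "u = \<sigma> v" using giso_surj wu(3) by metis
    then have "v \<in> W0" using gisoD(4)[OF \<sigma> v(1)] wu by simp
    then have "v = x" using W0(3) v(1) by blast
    then show ?thesis using v gisoD(1)[OF \<sigma>] by simp
  qed
  have "openin X (U \<inter> W0)" using U W0 by (auto simp: clopenin_def)
  then obtain W where "clopenin X W" "x \<in> W" "W \<subseteq> U \<inter> W0"
    using clopen_base U W0 by blast
  then show ?thesis using sep by blast
qed

text \<open>By the Lindelof property countably many separating clopen sets cover the space; the
  colour is the least index of a set containing the point.\<close>

lemma ex_proper_countable_coloring:
  "\<exists>g :: 'a \<Rightarrow> nat. locally_constant X g \<and>
     (\<forall>x\<in>topspace X. \<forall>y\<in>gball G x D. g y = g x \<longrightarrow> y = x)"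
proof (cases "topspace X = {}")
  case True
  show ?thesis
  proof (intro exI conjI)
    show "locally_constant X (\<lambda>_. 0 :: nat)" by (rule locally_constant_const)
  qed (use True in blast)
next
  case False
  define P where "P x W \<longleftrightarrow> clopenin X W \<and> x \<in> W \<and> (\<forall>w\<in>W. \<forall>u\<in>W. u \<in> gball G w D \<longrightarrow> u = w)" for x W
  have "\<forall>x\<in>topspace X. \<exists>W. P x W"
  proof
    fix x assume "x \<in> topspace X"
    then show "\<exists>W. P x W" unfolding P_def by (rule ex_separating_nbhd)
  qed
  then obtain W where "\<forall>x\<in>topspace X. P x (W x)" by (rule bchoice[THEN exE])
  then have W: "\<And>x. x \<in> topspace X \<Longrightarrow> clopenin X (W x) \<and> x \<in> W x \<and>
      (\<forall>w\<in>W x. \<forall>u\<in>W x. u \<in> gball G w D \<longrightarrow> u = w)"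
    by (simp add: P_def)
  have "\<Union> (W ` topspace X) = topspace X" using W openin_subset by (fastforce simp: clopenin_def)
  moreover have "\<And>U. U \<in> W ` topspace X \<Longrightarrow> openin X U"
    using W by (auto simp: clopenin_def)
  ultimately obtain \<V> where V: "countable \<V>" "\<V> \<subseteq> W ` topspace X" "\<Union> \<V> = topspace X"
    using Lindelof_spaceD[OF Lindelof, of "W ` topspace X"] by auto

  have ne: "\<V> \<noteq> {}" using V(3) False by (metis Union_empty)
  let ?V = "from_nat_into \<V>"
  have Vn: "clopenin X (?V n)" "w \<in> ?V n \<Longrightarrow> u \<in> ?V n \<Longrightarrow> u \<in> gball G w D \<Longrightarrow> u = w" for n w u
  proof -
    obtain x where x: "x \<in> topspace X" "?V n = W x" using V(2) from_nat_into[OF ne, of n] by blast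
    show "clopenin X (?V n)" using W[OF x(1)] x(2) by simp
    show "w \<in> ?V n \<Longrightarrow> u \<in> ?V n \<Longrightarrow> u \<in> gball G w D \<Longrightarrow> u = w"
      using W[OF x(1)] x(2) by blast
  qed
  have cov: "\<exists>n. x \<in> ?V n" if "x \<in> topspace X" for x
    using that V(1,3) ne by (metis UnionE from_nat_into_surj)
  define g where "g x = (LEAST n. x \<in> ?V n)" for x
  have gV: "x \<in> ?V (g x)" if "x \<in> topspace X" for x
    unfolding g_def using cov[OF that] by (rule LeastI_ex)
  have "locally_constant X g"
    unfolding locally_constant_def
  proof
    fix x assume x: "x \<in> topspace X"
    let ?U = "?V (g x) - \<Union> (?V ` {..<g x})"
    have "closedin X (\<Union> (?V ` {..<g x}))"
      using Vn(1) by (auto simp: clopenin_def intro!: closedin_Union)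
    then have "openin X ?U" using Vn(1)[of "g x"] by (auto simp: clopenin_def)
    moreover have "x \<notin> ?V m" if "m < g x" for m using that not_less_Least by (auto simp: g_def)
    then have "x \<in> ?U" using gV[OF x] by auto
    moreover have "g y = g x" if "y \<in> ?U" for y
      using that by (subst g_def, intro Least_equality) (auto simp: not_le[symmetric])
    ultimately show "\<exists>U. openin X U \<and> x \<in> U \<and> (\<forall>y\<in>U. g y = g x)"
      by blast
  qed
  moreover have "y = x" if "x \<in> topspace X" "y \<in> gball G x D" "g y = g x" for x y
  proof -
    have "y \<in> topspace X" using gball_in_V[OF that(1,2)] .
    then show ?thesis using Vn(2)[of x "g x" y] gV[of x] gV[of y] that by auto
  qed
  ultimately show ?thesis by blast
qed

text \<open>Points of one \<open>g\<close>-colour are more than \<open>D\<close> apart and do not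
  influence each other, so the colours of \<open>g\<close> can be processed in order. The last
  clause says that colour 0 within \<open>M\<close> is a maximal separated set.\<close>

lemma ex_greedy_coloring:
  assumes M: "locally_constant X (\<lambda>x. x \<in> M)"
  shows "\<exists>\<gamma> :: 'a \<Rightarrow> nat. locally_constant X \<gamma> \<and>
     (\<forall>x\<in>topspace X \<inter> M. \<forall>y\<in>gball G x D \<inter> M. \<gamma> y = \<gamma> x \<longrightarrow> y = x) \<and>
     (\<forall>x\<in>topspace X. \<gamma> x < card (gball G x D)) \<and>
     (\<forall>x\<in>topspace X. \<gamma> x \<noteq> 0 \<longrightarrow> (\<exists>y\<in>gball G x D \<inter> M. \<gamma> y = 0))"
proof -
  obtain g :: "'a \<Rightarrow> nat" where g: "locally_constant X g"
      "\<And>x y. x \<in> topspace X \<Longrightarrow> y \<in> gball G x D \<Longrightarrow> g y = g x \<Longrightarrow> y = x"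
    using ex_proper_countable_coloring[of D] by blast
  define S where "S x = {y \<in> gball G x D \<inter> M. g y < g x}" for x
  define step where "step h x = (LEAST c::nat. c \<notin> h ` S x)" for h x
  \<comment> \<open>Round \<open>Suc (g x)\<close> is correct at \<open>x\<close>, because it reads
    only vertices with smaller \<open>g\<close>, and these are final after \<open>g x\<close>
    rounds.\<close>
  define \<gamma> where "\<gamma> x = (step ^^ Suc (g x)) (\<lambda>_. 0) x" for x
  have stable: "(step ^^ n) (\<lambda>_. 0) x = \<gamma> x" if "g x < n" for n x
    using that
  proof (induction n arbitrary: x rule: less_induct)
    case (less n)
    then obtain m where m: "n = Suc m" by (cases n) auto
    have "(step ^^ m) (\<lambda>_. 0) y = (step ^^ g x) (\<lambda>_. 0) y" if "y \<in> S x" for y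
      using less.IH[of m y] less.IH[of "g x" y] that less.prems m by (cases "g x = m") (auto simp: S_def)
    then have "(step ^^ m) (\<lambda>_. 0) ` S x = (step ^^ g x) (\<lambda>_. 0) ` S x"
      by (rule image_cong[OF refl])
    then show ?case by (simp add: m \<gamma>_def step_def[of _ x])
  qed
  have \<gamma>: "\<gamma> x = (LEAST c. c \<notin> \<gamma> ` S x)" for x
  proof -
    have "(step ^^ g x) (\<lambda>_. 0) ` S x = \<gamma> ` S x"
      using stable by (intro image_cong) (auto simp: S_def)
    then show ?thesis by (simp add: \<gamma>_def step_def[of _ x])
  qed
  have fin: "finite (S x)" for x using finite_gball by (auto simp: S_def)
  have ex: "\<exists>c. c \<notin> \<gamma> ` S x" for x
    using fin[of x] by (metis finite_imageI infinite_UNIV_nat ex_new_if_finite)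
  have below: "c \<in> \<gamma> ` S x" if "c < \<gamma> x" for c x
  proof -
    have "c < (LEAST c. c \<notin> \<gamma> ` S x)" using that by (simp only: \<gamma>[of x, symmetric])
    then show ?thesis using not_less_Least by blast
  qed
  have new: "\<gamma> x \<notin> \<gamma> ` S x" for x
    unfolding \<gamma>[of x] by (rule LeastI_ex[OF ex])
  have lcn: "locally_constant X ((step ^^ n) (\<lambda>_. 0))" for n
  proof (induction n)
    case 0
    then show ?case by (simp add: locally_constant_const)
  next
    case (Suc n)
    let ?h = "(step ^^ n) (\<lambda>_. 0)"
    let ?f = "\<lambda>x. ((x \<in> M, g x), ?h x)"
    have lcf: "locally_constant X ?f" using M g(1) Suc by (intro locally_constant_Pair)
    have inv: "step ?h y = step ?h x" if \<sigma>: "giso G G ?f ?f D x y \<sigma>" for x y \<sigma>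
    proof -
      have l: "(\<sigma> u \<in> M) = (u \<in> M)" "g (\<sigma> u) = g u" "?h (\<sigma> u) = ?h u" if "u \<in> gball G x D" for u
        using gisoD(4)[OF \<sigma> that] by auto
      have y: "y = \<sigma> x" "g y = g x" using l(2)[of x] gisoD(1)[OF \<sigma>] by auto
      have "S y = \<sigma> ` S x"
      proof (intro subset_antisym subsetI)
        fix z assume z: "z \<in> S y"
        then obtain u where u: "u \<in> gball G x D" "z = \<sigma> u"
          using giso_surj[OF \<sigma>, of z] by (auto simp: S_def)
        then show "z \<in> \<sigma> ` S x" using z l[OF u(1)] y(2) by (auto simp: S_def)
      next
        fix z assume "z \<in> \<sigma> ` S x"
        then obtain u where u: "u \<in> S x" "z = \<sigma> u" by blast
        then have "u \<in> gball G x D" by (simp add: S_def)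
        then show "z \<in> S y" using u l[of u] y(2) gisoD(5)[OF \<sigma>, of u] by (auto simp: S_def)
      qed
      then have "?h ` S y = (\<lambda>u. ?h (\<sigma> u)) ` S x" by (simp add: image_image)
      also have "\<dots> = ?h ` S x" using l(3) by (intro image_cong) (auto simp: S_def)
      finally have "?h ` S y = ?h ` S x" .

      then show ?thesis by (simp add: step_def)
    qed
    have "locally_constant X (step ?h)" by (rule locally_constant_local_rule[OF lcf]) (rule inv)
    then show ?case by simp
  qed
  have "locally_constant X \<gamma>"
    unfolding locally_constant_def
  proof
    fix x assume x: "x \<in> topspace X"
    obtain U where U: "openin X U" "x \<in> U" "\<And>y. y \<in> U \<Longrightarrow> g y = g x"
      using locally_constantD[OF g(1) x] by blast
    obtain W where W: "openin X W" "x \<in> W" "\<And>y. y \<in> W \<Longrightarrow> (step ^^ Suc (g x)) (\<lambda>_. 0) y = (step ^^ Suc (g x)) (\<lambda>_. 0) x"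
      using locally_constantD[OF lcn x] by blast
    have "\<gamma> y = \<gamma> x" if "y \<in> U \<inter> W" for y
      using U(3)[of y] W(3)[of y] that unfolding \<gamma>_def by auto
    moreover have "openin X (U \<inter> W)" "x \<in> U \<inter> W" using U(1,2) W(1,2) by auto
    ultimately show "\<exists>U. openin X U \<and> x \<in> U \<and> (\<forall>y\<in>U. \<gamma> y = \<gamma> x)"
      by blast
  qed
  moreover have "y = x" if "x \<in> topspace X \<inter> M" "y \<in> gball G x D \<inter> M" "\<gamma> y = \<gamma> x" for x y
  proof (rule ccontr)
    assume "y \<noteq> x"
    then have "g y \<noteq> g x" using g(2) that by blast
    then have "y \<in> S x \<or> x \<in> S y" using that gball_sym by (auto simp: S_def)
    then show False using new[of x] new[of y] that(3) by (metis imageI)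
  qed
  moreover have "\<gamma> x < card (gball G x D)" if "x \<in> topspace X" for x
  proof -
    have "S x \<subseteq> gball G x D - {x}" by (auto simp: S_def)
    then have "card (S x) < card (gball G x D)"
      using finite_gball[of x D] by (intro psubset_card_mono) auto
    moreover have "card (\<gamma> ` S x) \<le> card (S x)" using fin by (rule card_image_le)
    moreover have "\<gamma> x \<le> card (\<gamma> ` S x)"
    proof -
      have "{..<\<gamma> x} \<subseteq> \<gamma> ` S x" using below by blast
      then have "card {..<\<gamma> x} \<le> card (\<gamma> ` S x)" using fin by (intro card_mono) auto
      then show ?thesis by simp
    qed
    ultimately show ?thesis by simp
  qed
  moreover have "\<exists>y\<in>gball G x D \<inter> M. \<gamma> y = 0" if "\<gamma> x \<noteq> 0" for x
  proof -
    have "0 \<in> \<gamma> ` S x" using below[of 0 x] that by simp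
    then show ?thesis by (force simp: S_def)
  qed
  ultimately show ?thesis by blast
qed

end

section \<open>Rigid labellings and free bits\<close>

text \<open>This serves to place a prescribed number of ones in a canonical way, with a locally
  injective colour as the order.\<close>

lemma card_rank_less:
  fixes \<kappa> :: "'a \<Rightarrow> nat"
  assumes A: "finite A" and inj: "inj_on \<kappa> A" and n: "n \<le> card A"
  shows "card {u \<in> A. card {u' \<in> A. \<kappa> u' < \<kappa> u} < n} = n"
proof -
  define rank where "rank u = card {u' \<in> A. \<kappa> u' < \<kappa> u}" for u
  have less: "rank u < rank w" if "u \<in> A" "\<kappa> u < \<kappa> w" for u w
    unfolding rank_def using A that by (intro psubset_card_mono) auto
  have "inj_on rank A"
  proof (rule inj_onI)
    fix u w assume uw: "u \<in> A" "w \<in> A" "rank u = rank w"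
    then have "\<kappa> u = \<kappa> w"
      using less[of u w] less[of w u] by (metis less_irrefl linorder_neqE_nat)
    then show "u = w" using inj uw by (simp add: inj_on_def)
  qed
  moreover have "rank u < card A" if "u \<in> A" for u
    unfolding rank_def using A that by (intro psubset_card_mono) auto
  ultimately have img: "rank ` A = {..<card A}"
    using A by (intro card_subset_eq) (auto simp: card_image)
  have "rank ` {u \<in> A. rank u < n} = {..<n}"
  proof (intro subset_antisym subsetI)
    fix c assume "c \<in> {..<n}"
    then have "c \<in> rank ` A" "c < n" using img n by auto
    then show "c \<in> rank ` {u \<in> A. rank u < n}" by blast
  qed auto
  moreover have "inj_on rank {u \<in> A. rank u < n}"
    using \<open>inj_on rank A\<close> by (rule inj_on_subset) auto
  ultimately have "card {u \<in> A. rank u < n} = n" using card_image by force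
  then show ?thesis by (simp add: rank_def)
qed

text \<open>In a partial labelling \<open>(M, q)\<close> the labels on \<open>M\<close> are still free and \<open>q\<close> gives all others.\<close>

definition completes :: "'a set \<Rightarrow> ('a \<Rightarrow> bool) \<Rightarrow> ('a \<Rightarrow> bool) \<Rightarrow> bool" where
  "completes M q f \<longleftrightarrow> (\<forall>u. u \<notin> M \<longrightarrow> f u = q u)"

definition rigid :: "'a set \<Rightarrow> ('a \<times> 'a) set \<Rightarrow> ('a \<Rightarrow> 'c) \<Rightarrow> nat \<Rightarrow> nat \<Rightarrow> bool" where
  "rigid V G f k \<rho> \<longleftrightarrow> (\<forall>x\<in>V. \<forall>y\<in>gball G x k. \<forall>\<theta>. giso G G f f \<rho> x y \<theta> \<longrightarrow> y = x)"

context regular_forest begin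

text \<open>Density in every direction: the vertex of \<open>M\<close> has to lie strictly behind
  \<open>w\<close> as seen from \<open>v\<close>. Strictness puts the vertices found behind a sphere
  into a half-open annulus; plain density is the case \<open>v = w\<close>.\<close>

definition outward_dense :: "nat \<Rightarrow> 'a set \<Rightarrow> bool" where
  "outward_dense r M \<longleftrightarrow> (\<forall>v\<in>V. \<forall>w. con v w \<longrightarrow>
     (\<exists>u\<in>M. con w u \<and> 1 \<le> \<delta> w u \<and> \<delta> w u \<le> r \<and> \<delta> v u = \<delta> v w + \<delta> w u))"

definition recognizable :: "nat \<Rightarrow> 'a set \<Rightarrow> ('a \<Rightarrow> bool) \<Rightarrow> bool" where
  "recognizable a M q \<longleftrightarrow> (\<forall>f. completes M q f \<longrightarrow>
     (\<forall>x\<in>V. \<forall>y\<in>V. \<forall>\<theta>. giso G G f f a x y \<theta> \<longrightarrow> (x \<in> M \<longleftrightarrow> y \<in> M)))"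

text \<open>Behind every vertex of the sphere of radius \<open>j\<close> lies a vertex of
  \<open>M\<close>, and \<open>ancestor_unique\<close> keeps these apart.\<close>

lemma card_annulus_ge:
  assumes dense: "outward_dense r M" and v: "v \<in> V"
  shows "(d - 1) ^ j \<le> card {u \<in> M. con v u \<and> j < \<delta> v u \<and> \<delta> v u \<le> j + r}" (is "_ \<le> card ?A")
proof -
  let ?S = "{u. con v u \<and> \<delta> v u = j}"
  have "\<exists>u. u \<in> ?A \<and> \<delta> v u = \<delta> v w + \<delta> w u" if w: "w \<in> ?S" for w
  proof -
    obtain u where "u \<in> M" "con w u" "1 \<le> \<delta> w u" "\<delta> w u \<le> r" "\<delta> v u = \<delta> v w + \<delta> w u"
      using dense v w unfolding outward_dense_def by blast
    moreover have "con v u"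
      using w \<open>con w u\<close> by (metis (mono_tags) mem_Collect_eq rtrancl_trans)
    ultimately show ?thesis using w by (intro exI[of _ u]) auto
  qed
  then have "\<forall>w\<in>?S. \<exists>u. u \<in> ?A \<and> \<delta> v u = \<delta> v w + \<delta> w u"
    by (rule ballI)
  then obtain h where "\<forall>w\<in>?S. h w \<in> ?A \<and> \<delta> v (h w) = \<delta> v w + \<delta> w (h w)"
    by (rule bchoice[THEN exE])
  note h = bspec[OF this]
  have "inj_on h ?S"
  proof (rule inj_onI)
    fix w w' assume w: "w \<in> ?S" "w' \<in> ?S" "h w = h w'"
    then show "w = w'"
      using ancestor_unique[of v w w' "h w"] h[OF w(1)] h[OF w(2)] by auto
  qed
  moreover have "finite ?A"
    by (rule finite_subset[OF _ finite_gball[of v "j + r"]]) (auto simp: gball_def)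
  ultimately have "card ?S \<le> card ?A" using h by (intro card_inj_on_le) auto
  then show ?thesis using card_sphere_ge[OF v, of j] by linarith
qed

end

context continuous_forest begin

definition stage :: "nat \<Rightarrow> nat \<Rightarrow> 'a set \<Rightarrow> ('a \<Rightarrow> bool) \<Rightarrow> bool" where
  "stage r a M q \<longleftrightarrow> locally_constant X (\<lambda>x. x \<in> M) \<and> locally_constant X q \<and>
     outward_dense r M \<and> recognizable a M q"

lemma ex_maximal_separated:
  assumes "locally_constant X (\<lambda>x. x \<in> M)"
  shows "\<exists>N \<subseteq> M. locally_constant X (\<lambda>x. x \<in> N) \<and>
    (\<forall>x\<in>topspace X \<inter> N. \<forall>y\<in>gball G x D \<inter> N. y = x) \<and>
    (\<forall>x\<in>topspace X \<inter> M. \<exists>y\<in>N. y \<in> gball G x D)"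
proof -
  obtain \<gamma> :: "'a \<Rightarrow> nat" where \<gamma>: "locally_constant X \<gamma>"
     "\<forall>x\<in>topspace X \<inter> M. \<forall>y\<in>gball G x D \<inter> M. \<gamma> y = \<gamma> x \<longrightarrow> y = x"
     "\<forall>x\<in>topspace X. \<gamma> x \<noteq> 0 \<longrightarrow> (\<exists>y\<in>gball G x D \<inter> M. \<gamma> y = 0)"
    using ex_greedy_coloring[OF assms, of D] by blast
  let ?N = "{x \<in> M. \<gamma> x = 0}"
  have "locally_constant X (\<lambda>x. x \<in> ?N)"
    using locally_constant_comp[OF locally_constant_Pair[OF assms \<gamma>(1)], of "\<lambda>(p, c). p \<and> c = 0"]
      by simp
  moreover have "\<exists>y\<in>?N. y \<in> gball G x D" if "x \<in> topspace X \<inter> M" for x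
    using \<gamma>(3) that by (cases "\<gamma> x = 0") auto
  moreover have "\<forall>x\<in>topspace X \<inter> ?N. \<forall>y\<in>gball G x D \<inter> ?N. y = x"
    using \<gamma>(2) by auto
  ultimately show ?thesis by (intro exI[of _ ?N] conjI) auto
qed

end

lemma ex_code:
  fixes d k r :: nat
  assumes "2 < d" and b: "b = 2 * k + 872 * r + 8" and D: "D = k + 12 * b + 436 * r + 4"
  shows "\<exists>enc :: nat \<Rightarrow> nat \<Rightarrow> nat. (\<forall>c c'. c < (d + 1) ^ D \<longrightarrow> c' < (d + 1) ^ D \<longrightarrow>
      (\<forall>i<25. enc c i = enc c' i) \<longrightarrow> c = c') \<and> (\<forall>c<(d + 1) ^ D. \<forall>i<25. enc c i \<le> (d - 1) ^ b)"
proof -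
  let ?L = "(d - 1) ^ b"
  let ?P = "PiE {..<25::nat} (\<lambda>_. {..?L})"
  define e where "e = d - 3"
  have e: "d = e + 3" using assms(1) by (simp add: e_def)
  \<comment> \<open>This would fail for \<open>d = 2\<close>, where spheres do not grow.\<close>
  have "d + 1 \<le> (d - 1) ^ 2" by (simp add: e power2_eq_square algebra_simps)
  then have "(d + 1) ^ D \<le> ((d - 1) ^ 2) ^ D" by (rule power_mono) simp
  also have "\<dots> = (d - 1) ^ (2 * D)" by (simp add: power_mult)
  also have "2 * D = b * 25" unfolding D b by simp
  also have "(d - 1) ^ (b * 25) = ?L ^ 25" by (simp add: power_mult)
  also have "\<dots> \<le> (?L + 1) ^ 25" by (rule power_mono) simp_all
  also have "\<dots> = card ?P" by (simp add: card_PiE)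
  finally have "card {..<(d + 1) ^ D} \<le> card ?P" by simp
  moreover have "finite ?P" by (intro finite_PiE) auto
  ultimately obtain enc where enc: "enc ` {..<(d + 1) ^ D} \<subseteq> ?P" "inj_on enc {..<(d + 1) ^ D}"
    using card_le_inj[of "{..<(d + 1) ^ D}" ?P] by blast
  have inj: "c = c'" if "c < (d + 1) ^ D" "c' < (d + 1) ^ D" "\<forall>i<25. enc c i = enc c' i" for c c'
  proof -
    have "enc c \<in> ?P" "enc c' \<in> ?P" using enc(1) that(1,2) by auto
    then have "enc c = enc c'" using that(3) by (intro PiE_ext) auto
    then show ?thesis using enc(2) that(1,2) by (auto simp: inj_on_def)
  qed
  have le: "enc c i \<le> ?L" if "c < (d + 1) ^ D" "i < 25" for c i
  proof -
    have "enc c \<in> ?P" using enc(1) that(1) by auto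
    then have "enc c i \<in> {..?L}"
      using PiE_mem[of "enc c" "{..<25}" "\<lambda>_. {..?L}" i] that(2) by blast
    then show ?thesis by simp
  qed
  show ?thesis
  proof (intro exI conjI)
    show "\<forall>c c'. c < (d + 1) ^ D \<longrightarrow> c' < (d + 1) ^ D \<longrightarrow> (\<forall>i<25. enc c i = enc c' i) \<longrightarrow> c = c'"
      by (intro allI impI) (rule inj)
    show "\<forall>c<(d + 1) ^ D. \<forall>i<25. enc c i \<le> (d - 1) ^ b"
      by (intro allI impI) (rule le)
  qed
qed

section \<open>Encoding one scale into free bits\<close>

text \<open>Only the vertices in \<open>M\<close> carry free labels. A centre \<open>v \<in> N\<close> gets label 0 and all other
  vertices of \<open>M\<close> within distance \<open>b\<close> get label 1, which happens around no other vertex. Beyond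
  that, the annuli of width \<open>r\<close> with even index are filled with 0, annulus 1 keeps its labels free
  for the next stage, and the number of ones in annulus \<open>2 * i + 3\<close> is the digit \<open>enc (\<kappa> v) i\<close>.
  The value of \<open>b\<close> makes 25 digits up to \<open>(d - 1) ^ b\<close> enough for \<open>(d + 1) ^ (k + 4 * t)\<close> colours.\<close>

locale beacon_code = continuous_forest d X G
  for d :: nat and X :: "'a topology" and G :: "('a \<times> 'a) set" +
  fixes k r a :: nat and M N :: "'a set" and q :: "'a \<Rightarrow> bool" and \<kappa> :: "'a \<Rightarrow> nat"
    and enc :: "nat \<Rightarrow> nat \<Rightarrow> nat" and b s t :: nat
  assumes r: "1 \<le> r"
    and stage: "stage r a M q"
    and b: "b = 2 * k + 872 * r + 8" and s: "s = b + 53 * r" and t: "t = 2 * s + b + 3 * r + 1"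
    and N_sub: "N \<subseteq> M" and N_lc: "locally_constant X (\<lambda>x. x \<in> N)"
    and N_sep: "x \<in> topspace X \<Longrightarrow> x \<in> N \<Longrightarrow> y \<in> N \<Longrightarrow> y \<in> gball G x (2 * s) \<Longrightarrow> y = x"
    and N_cover: "x \<in> topspace X \<Longrightarrow> x \<in> M \<Longrightarrow> \<exists>y\<in>N. y \<in> gball G x (2 * s)"
    and \<kappa>_lc: "locally_constant X \<kappa>"
    and \<kappa>_proper: "x \<in> topspace X \<Longrightarrow> y \<in> gball G x (k + 4 * t) \<Longrightarrow> \<kappa> y = \<kappa> x \<Longrightarrow> y = x"
    and \<kappa>_bound: "x \<in> topspace X \<Longrightarrow> \<kappa> x < (d + 1) ^ (k + 4 * t)"
    and enc_inj: "c < (d + 1) ^ (k + 4 * t) \<Longrightarrow> c' < (d + 1) ^ (k + 4 * t) \<Longrightarrow>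
        (\<And>i. i < 25 \<Longrightarrow> enc c i = enc c' i) \<Longrightarrow> c = c'"
    and enc_le: "c < (d + 1) ^ (k + 4 * t) \<Longrightarrow> i < 25 \<Longrightarrow> enc c i \<le> (d - 1) ^ b"
begin

lemma mem_gball_rev: "v \<in> gball G w R \<longleftrightarrow> con v w \<and> \<delta> v w \<le> R"
  unfolding gball_def mem_Collect_eq by (metis con_sym \<delta>_sym)

lemma M_lc: "locally_constant X (\<lambda>x. x \<in> M)" and q_lc: "locally_constant X q"
  and dense: "outward_dense r M" and recog: "recognizable a M q"
  using stage by (auto simp: stage_def)

text \<open>Half-open intervals, so that they partition the distances beyond
  \<open>b\<close>.\<close>

definition ann :: "nat \<Rightarrow> nat \<Rightarrow> bool" where
  "ann i j \<longleftrightarrow> b + i * r < j \<and> j \<le> b + (i + 1) * r"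

definition ring :: "'a \<Rightarrow> nat \<Rightarrow> 'a set" where
  "ring v i = {u \<in> M. con v u \<and> ann (2 * i + 3) (\<delta> v u)}"

text \<open>Decoding only counts the ones of a ring. Choosing the lowest ranks for
  \<open>\<kappa>\<close> makes their positions a local rule and hence locally constant.\<close>

definition one :: "'a \<Rightarrow> 'a \<Rightarrow> bool" where
  "one v u \<longleftrightarrow> (0 < \<delta> v u \<and> \<delta> v u \<le> b) \<or>
     (\<exists>i<25. ann (2 * i + 3) (\<delta> v u) \<and> card {u' \<in> ring v i. \<kappa> u' < \<kappa> u} < enc (\<kappa> v) i)"

definition M' :: "'a set" where
  "M' = {u \<in> M. \<exists>v\<in>N. v \<in> gball G u s \<and> ann 1 (\<delta> v u)}"

definition q' :: "'a \<Rightarrow> bool" where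
  "q' u = (if u \<in> M then \<exists>v\<in>N. v \<in> gball G u s \<and> one v u else q u)"

lemma ann_unique: "ann i j \<Longrightarrow> ann i' j \<Longrightarrow> i = i'"
proof (rule ccontr)
  assume *: "ann i j" "ann i' j" "i \<noteq> i'"
  have "(i + 1) * r \<le> i' * r \<or> (i' + 1) * r \<le> i * r"
    using *(3) mult_le_mono1[of "i + 1" i' r] mult_le_mono1[of "i' + 1" i r] by linarith
  then show False using *(1,2) unfolding ann_def by linarith
qed

lemma ann_gt: "ann i j \<Longrightarrow> b < j"
  unfolding ann_def by linarith

lemma ann_le:
  assumes "ann i j" "i \<le> m"
  shows "j \<le> b + (m + 1) * r"
proof -
  have "(i + 1) * r \<le> (m + 1) * r" using assms(2) by (intro mult_le_mono1) simp
  then show ?thesis using assms(1) unfolding ann_def by linarith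
qed

lemma b_bounds: "3 * r \<le> b" "b < s" "b + 53 * r = s"
  using r b s by linarith+

text \<open>Centres are more than \<open>2 * s\<close> apart, so codes of radius \<open>s\<close> do
  not overlap and the existential quantifiers in \<open>M'\<close> and \<open>q'\<close> have at
  most one witness.\<close>

lemma N_unique:
  assumes "u \<in> topspace X" "v \<in> N" "v' \<in> N" "v \<in> gball G u s" "v' \<in> gball G u s"
  shows "v' = v"
proof -
  have "v \<in> topspace X" using assms(1,4) by (rule gball_in_V)
  moreover have "v' \<in> gball G v (2 * s)"
    using gball_trans[OF gball_sym[OF assms(4)] assms(5)] by (simp add: mult_2)
  ultimately show ?thesis using N_sep assms by blast
qed

section \<open>Labels forced by the code\<close>

context
  fixes f
  assumes f: "completes M' q' f"
begin

lemma completes_old: "completes M q f"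
  using f unfolding completes_def M'_def q'_def by auto

lemma f_eq_one:
  assumes u: "u \<in> topspace X" "u \<in> M" and v: "v \<in> N" "v \<in> gball G u s" and n: "\<not> ann 1 (\<delta> v u)"
  shows "f u = one v u"
proof -
  have eq: "v' = v" if "v' \<in> N" "v' \<in> gball G u s" for v'
    using N_unique[OF u(1) v(1) that(1) v(2) that(2)] .
  have "u \<notin> M'" unfolding M'_def using n eq by blast
  moreover have "(\<exists>v\<in>N. v \<in> gball G u s \<and> one v u) = one v u" using v eq by blast
  ultimately show ?thesis using f u(2) unfolding completes_def q'_def by simp
qed

lemma f_beacon:
  assumes "v \<in> topspace X" "v \<in> N"
  shows "\<not> f v"
proof -
  have "\<not> ann i (\<delta> v v)" for i using ann_gt[of i 0] by auto
  then show ?thesis using f_eq_one[of v v] assms N_sub by (auto simp: one_def)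
qed

lemma f_near:
  assumes u: "u \<in> topspace X" "u \<in> M" and v: "v \<in> N" "v \<in> gball G u b" "u \<noteq> v"
  shows "f u"
proof -
  have d: "con v u" "\<delta> v u \<le> b" using gball_sym[OF v(2)] by (auto simp: gball_def)
  then have "0 < \<delta> v u" using v(3) gdist_eq_0_iff[of v u G] by auto
  then have "one v u" using d by (simp add: one_def)
  moreover have "\<not> ann 1 (\<delta> v u)" using ann_gt[of 1 "\<delta> v u"] d(2) by linarith
  ultimately show ?thesis using f_eq_one[OF u v(1) gball_le[OF v(2)]] b_bounds by simp
qed

lemma f_even:
  assumes u: "u \<in> topspace X" "u \<in> M" and v: "v \<in> N" "v \<in> gball G u s" and "ann i (\<delta> v u)" "even i"
  shows "\<not> f u"
proof -
  have n: "\<not> ann j (\<delta> v u)" if "odd j" for j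
    using ann_unique[OF assms(5), of j] assms(6) that by auto
  have "\<not> one v u" using ann_gt[OF assms(5)] n by (auto simp: one_def)
  then show ?thesis using f_eq_one[OF u v n[of 1]] by simp
qed

text \<open>This covers the last annulus, whose index 52 is even, and the vertices outside all
  codes; no digit reaches beyond \<open>b + 52 * r\<close>.\<close>

lemma f_far:
  assumes u: "u \<in> topspace X" "u \<in> M" and far: "\<And>v. v \<in> N \<Longrightarrow> v \<in> gball G u s \<Longrightarrow> b + 52 * r < \<delta> v u"
  shows "\<not> f u"
proof -
  have n: "\<not> ann i (\<delta> v u)" if "v \<in> N" "v \<in> gball G u s" "i \<le> 51" for v i
    using far[OF that(1,2)] ann_le[OF _ that(3), of "\<delta> v u"] by auto
  have "\<not> one v u" if v: "v \<in> N" "v \<in> gball G u s" for v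
    using far[OF v] n[OF v] by (auto simp: one_def)
  then have "\<not> q' u" using u(2) by (simp add: q'_def)
  moreover have "u \<notin> M'" using n[of _ 1] unfolding M'_def by force
  ultimately show ?thesis using f unfolding completes_def by simp
qed

text \<open>Outward density makes the ring large enough for its digit, and \<open>\<kappa>\<close>
  is injective on it because two of its vertices are at most \<open>2 * s\<close> apart.\<close>

lemma f_ring:
  assumes v: "v \<in> topspace X" "v \<in> N" and i: "i < 25"
  shows "card {u \<in> ring v i. f u} = enc (\<kappa> v) i"
proof -
  have ring: "u \<in> M" "con v u" "\<delta> v u \<le> s" "ann (2 * i + 3) (\<delta> v u)" "u \<in> topspace X" "u \<in> gball G v s" "v \<in> gball G u s"
    if "u \<in> ring v i" for u
  proof -
    show 1: "u \<in> M" "con v u" "ann (2 * i + 3) (\<delta> v u)" using that by (auto simp: ring_def)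
    then show 2: "\<delta> v u \<le> s" using ann_le[of "2 * i + 3" "\<delta> v u" 52] i b_bounds by simp
    show "u \<in> gball G v s" using 1 2 by (simp add: gball_def)
    then show "v \<in> gball G u s" "u \<in> topspace X" using gball_sym gball_in_V v(1) by auto
  qed
  have "finite (ring v i)" by (rule finite_subset[OF _ finite_gball[of v s]]) (use ring in auto)
  moreover have "inj_on \<kappa> (ring v i)"
  proof (rule inj_onI)
    fix u w assume uw: "u \<in> ring v i" "w \<in> ring v i" "\<kappa> u = \<kappa> w"
    have "u \<in> gball G w (s + s)" using gball_trans[OF ring(7)[OF uw(2)] ring(6)[OF uw(1)]] .
    then have "u \<in> gball G w (k + 4 * t)" by (rule gball_le) (use t in simp)
    then show "u = w" using \<kappa>_proper[OF ring(5)[OF uw(2)]] uw(3) by blast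
  qed
  moreover have "enc (\<kappa> v) i \<le> card (ring v i)"
  proof -
    let ?j = "b + (2 * i + 3) * r"
    have "(d - 1) ^ b \<le> (d - 1) ^ ?j" using d_gt_2 by (intro power_increasing) auto
    also have "\<dots> \<le> card {u \<in> M. con v u \<and> ?j < \<delta> v u \<and> \<delta> v u \<le> ?j + r}"
      by (rule card_annulus_ge[OF dense v(1)])
    also have "{u \<in> M. con v u \<and> ?j < \<delta> v u \<and> \<delta> v u \<le> ?j + r} = ring v i"
      by (auto simp: ring_def ann_def algebra_simps)
    finally show ?thesis using enc_le[OF \<kappa>_bound[OF v(1)] i] by linarith
  qed
  ultimately have "card {u \<in> ring v i. card {u' \<in> ring v i. \<kappa> u' < \<kappa> u} < enc (\<kappa> v) i} = enc (\<kappa> v) i"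
    by (rule card_rank_less)
  moreover have "f u \<longleftrightarrow> card {u' \<in> ring v i. \<kappa> u' < \<kappa> u} < enc (\<kappa> v) i" if u: "u \<in> ring v i" for u
  proof -
    have uniq: "j = i" if "ann (2 * j + 3) (\<delta> v u)" for j
      using ann_unique[OF that ring(4)[OF u]] by simp
    have star: "\<not> ann 1 (\<delta> v u)" using ann_unique[OF ring(4)[OF u], of 1] by auto
    have "one v u \<longleftrightarrow> (\<exists>j<25. ann (2 * j + 3) (\<delta> v u) \<and> card {u' \<in> ring v j. \<kappa> u' < \<kappa> u} < enc (\<kappa> v) j)"
      using ann_gt[OF ring(4)[OF u]] by (simp add: one_def)
    also have "\<dots> \<longleftrightarrow> card {u' \<in> ring v i. \<kappa> u' < \<kappa> u} < enc (\<kappa> v) i"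
      using uniq i ring(4)[OF u] by blast
    finally have "one v u \<longleftrightarrow> card {u' \<in> ring v i. \<kappa> u' < \<kappa> u} < enc (\<kappa> v) i" .
    then show ?thesis using f_eq_one[OF ring(5)[OF u] ring(1)[OF u] v(2) ring(7)[OF u] star] by simp
  qed
  then have "{u \<in> ring v i. f u} = {u \<in> ring v i. card {u' \<in> ring v i. \<kappa> u' < \<kappa> u} < enc (\<kappa> v) i}"
    by blast
  ultimately show ?thesis by simp
qed

text \<open>No other vertex of \<open>M\<close> can pass for a centre: close to a centre, the centre
  is a zero; in the coded zone, the next even annulus outward supplies one; further out, the next
  vertex of \<open>M\<close> is one. Radius \<open>b\<close> suffices since crossing two annuli and
  one search take at most \<open>3 * r\<close>.\<close>

lemma ex_zero_near:
  assumes w: "w \<in> topspace X" "w \<in> M" "w \<notin> N"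
  shows "\<exists>u\<in>M. u \<in> gball G w b \<and> u \<noteq> w \<and> \<not> f u"
proof -
  consider (a) v where "v \<in> N" "v \<in> gball G w b"
    | (b) v where "v \<in> N" "con v w" "b < \<delta> v w" "\<delta> v w \<le> b + 52 * r"
    | (c) "\<And>v. v \<in> N \<Longrightarrow> con v w \<Longrightarrow> b + 52 * r < \<delta> v w"
  proof (cases "\<exists>v\<in>N. con v w \<and> \<delta> v w \<le> b + 52 * r")
    case True
    then obtain v where v: "v \<in> N" "con v w" "\<delta> v w \<le> b + 52 * r" by blast
    then show thesis
    proof (cases "\<delta> v w \<le> b")
      case True
      then have "v \<in> gball G w b" using v(2) by (simp add: mem_gball_rev)
      then show thesis using that(1) v(1) by blast
    next
      case False
      then show thesis using that(2)[OF v(1,2) _ v(3)] by simp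
    qed
  next
    case False
    then show thesis using that(3) by (meson not_le)
  qed
  then show ?thesis
  proof cases
    case a
    then have "\<not> f v" using f_beacon gball_in_V w(1) by blast
    then show ?thesis using a w(3) N_sub by blast
  next
    case b
    have vX: "v \<in> topspace X" using con_in_V[OF con_sym[OF b(2)] w(1)] .
    define i where "i = (\<delta> v w - b - 1) div r"
    have i: "b + i * r < \<delta> v w" "\<delta> v w \<le> b + (i + 1) * r"
    proof -
      have "i * r \<le> \<delta> v w - b - 1" unfolding i_def by (simp add: div_times_less_eq_dividend)
      then show "b + i * r < \<delta> v w" using b(3) by linarith
      have "\<delta> v w - b - 1 < (i + 1) * r" unfolding i_def using r
        by (metis dividend_less_div_times add.commute mult.commute Suc_eq_plus1 less_eq_Suc_le mult_Suc_right One_nat_def)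
      then show "\<delta> v w \<le> b + (i + 1) * r" using b(3) by linarith
    qed
    have "i < 52"
    proof (rule ccontr)
      assume "\<not> i < 52"
      then have "52 * r \<le> i * r" by (intro mult_le_mono1) simp
      then show False using i b(4) by linarith
    qed
    \<comment> \<open>The least even index above \<open>i\<close>, hence at most two annuli further
      out; \<open>i < 52\<close> keeps it within the code.\<close>
    define i' where "i' = 2 * (i div 2) + 2"
    have i': "even i'" "i + 1 \<le> i'" "i' \<le> i + 2" "i' \<le> 52"
      using \<open>i < 52\<close> unfolding i'_def by presburger+
    have ir: "(i + 1) * r \<le> i' * r" "i' * r \<le> (i + 2) * r" "i' * r \<le> 52 * r"
      using i' by (simp_all only: mult_le_mono1)
    define T where "T = b + i' * r - \<delta> v w"
    have T: "\<delta> v w + T = b + i' * r" "T \<le> 2 * r"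
      using i ir unfolding T_def by (auto simp: algebra_simps)
    obtain w' where w': "con w w'" "\<delta> w w' = T" "\<delta> v w' = \<delta> v w + T"
      using ex_beyond[OF b(2) w(1)] by blast
    have "con v w'" using b(2) w'(1) by (rule rtrancl_trans)
    then obtain u where u: "u \<in> M" "con w' u" "1 \<le> \<delta> w' u" "\<delta> w' u \<le> r" "\<delta> v u = \<delta> v w' + \<delta> w' u"
      using dense vX unfolding outward_dense_def by blast
    have vu: "con v u" using \<open>con v w'\<close> u(2) by (rule rtrancl_trans)
    have wu: "con w u" using w'(1) u(2) by (rule rtrancl_trans)
    have "ann i' (\<delta> v u)" using u w' T by (auto simp: ann_def algebra_simps)
    moreover have "\<delta> v u \<le> s" using u(4,5) w'(3) T(1) ir(3) b_bounds(3) by linarith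
    then have "v \<in> gball G u s" using vu by (simp add: mem_gball_rev)
    moreover have "u \<in> topspace X" using con_in_V[OF vu vX] .
    ultimately have "\<not> f u" using f_even u(1) b(1) i'(1) by blast
    moreover have "\<delta> w u \<le> b"
      using gdist_triangle[OF w'(1) u(2)] w'(2) T(2) u(4) b_bounds(1) by linarith
    moreover have "u \<noteq> w" using u w' by auto
    ultimately show ?thesis using u(1) wu by (auto simp: gball_def)
  next
    case c
    \<comment> \<open>The search goes away from the centre within \<open>s\<close> of
      \<open>w\<close>, if there is one, so that its distance only grows. A centre within
      \<open>b + 52 * r\<close> of the vertex found would lie within \<open>s\<close> of
      \<open>w\<close> and thus be this one.\<close>
    obtain v where v: "v \<in> topspace X" "con v w"
        "\<And>v'. v' \<in> N \<Longrightarrow> v' \<in> gball G w s \<Longrightarrow> v' = v \<and> b + 52 * r < \<delta> v w"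
    proof (cases "\<exists>v\<in>N. v \<in> gball G w s")
      case True
      then obtain v where "v \<in> N" "v \<in> gball G w s" by blast
      moreover have "con v w"
        using gball_sym[OF \<open>v \<in> gball G w s\<close>] by (simp add: gball_def)
      ultimately show thesis using that N_unique[OF w(1)] gball_in_V[OF w(1)] c by blast
    next
      case False
      then show thesis using that[of w] w(1) by blast
    qed
    obtain u where u: "u \<in> M" "con w u" "1 \<le> \<delta> w u" "\<delta> w u \<le> r" "\<delta> v u = \<delta> v w + \<delta> w u"
      using dense v unfolding outward_dense_def by blast
    have uX: "u \<in> topspace X" using con_in_V[OF u(2) w(1)] .
    have "b + 52 * r < \<delta> v' u" if v': "v' \<in> N" "v' \<in> gball G u s" for v'
    proof (rule ccontr)
      assume far: "\<not> b + 52 * r < \<delta> v' u"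
      have c1: "con v' u" using gball_sym[OF v'(2)] by (simp add: gball_def)
      have c2: "con v' w" using c1 con_sym[OF u(2)] by (rule rtrancl_trans)
      have "\<delta> v' w \<le> \<delta> v' u + \<delta> w u"
        using gdist_triangle[OF c1 con_sym[OF u(2)]] \<delta>_sym by metis
      then have "v' \<in> gball G w s" using c2 far u(4) b_bounds by (simp add: mem_gball_rev)
      then have "v' = v" "b + 52 * r < \<delta> v w" using v(3)[OF v'(1)] by auto
      then show False using far u(5) by simp
    qed
    then have "\<not> f u" using f_far[OF uX u(1)] by blast
    moreover have "u \<noteq> w" using u(3) by auto
    ultimately show ?thesis using u b_bounds by (auto simp: gball_def)
  qed
qed

lemma N_iff:
  assumes "w \<in> topspace X"
  shows "w \<in> N \<longleftrightarrow> w \<in> M \<and> \<not> f w \<and> (\<forall>u\<in>M. u \<in> gball G w b \<longrightarrow> u \<noteq> w \<longrightarrow> f u)"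
proof
  assume w: "w \<in> N"
  have "f u" if "u \<in> M" "u \<in> gball G w b" "u \<noteq> w" for u
    using f_near[OF gball_in_V[OF assms that(2)] that(1) w gball_sym[OF that(2)] that(3)] .
  then show "w \<in> M \<and> \<not> f w \<and> (\<forall>u\<in>M. u \<in> gball G w b \<longrightarrow> u \<noteq> w \<longrightarrow> f u)"
    using w N_sub f_beacon[OF assms w] by blast
next
  assume "w \<in> M \<and> \<not> f w \<and> (\<forall>u\<in>M. u \<in> gball G w b \<longrightarrow> u \<noteq> w \<longrightarrow> f u)"
  then show "w \<in> N" using ex_zero_near[OF assms] by blast
qed

end

section \<open>Recognition of centres and free vertices\<close>

lemmas self_pair = regular_forest_pair.intro[OF regular_forest_axioms regular_forest_axioms]
lemmas self_subball = regular_forest_pair.giso_subball[OF self_pair]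

lemma recog_iff:
  assumes "completes M q f" "giso G G f f R x y \<theta>" "a \<le> R" "x \<in> topspace X" "y \<in> topspace X"
  shows "x \<in> M \<longleftrightarrow> y \<in> M"
proof -
  have "giso G G f f a x y \<theta>"
    using self_subball[OF assms(2) gball_refl, of 0 a] assms(3) gisoD(1)[OF assms(2)] by simp
  then show ?thesis using recog assms(1,4,5) unfolding recognizable_def by blast
qed

context
  fixes f
  assumes f: "completes M' q' f"
begin

text \<open>By \<open>N_iff\<close> a centre is visible within radius \<open>b\<close> once
  membership in \<open>M\<close> is known, and the latter takes a margin of
  \<open>a\<close>.\<close>

lemma N_image:
  assumes \<theta>: "giso G G f f R w y \<theta>" and R: "b + a \<le> R"
    and w: "w \<in> topspace X" "w \<in> N" and y: "y \<in> topspace X"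
  shows "y \<in> N"
proof -
  have "y \<in> M"
    using recog_iff[OF completes_old[OF f] \<theta> _ w(1) y] R N_sub w(2) by auto
  moreover have "\<not> f y"
    using gisoD(4)[OF \<theta> gball_refl] gisoD(1)[OF \<theta>] f_beacon[OF f w] by simp
  moreover have "f z" if z: "z \<in> M" "z \<in> gball G y b" "z \<noteq> y" for z
  proof -
    have "z \<in> gball G y R" using gball_le[OF z(2)] R by simp
    then obtain u where u: "u \<in> gball G w R" "z = \<theta> u" using giso_surj[OF \<theta>] by blast
    then have ub: "u \<in> gball G w b" using gisoD(6)[OF \<theta> u(1)] z(2) by (simp add: gball_def)
    have "giso G G f f a u z \<theta>" unfolding u(2) using R by (intro self_subball[OF \<theta> ub])
    then have "u \<in> M"
      using recog_iff[OF completes_old[OF f] _ order_refl gball_in_V[OF w(1) ub] gball_in_V[OF y z(2)]] z(1)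
        by blast
    moreover have "u \<noteq> w" using z(3) u(2) gisoD(1)[OF \<theta>] by auto
    ultimately have "f u" using N_iff[OF f w(1)] w(2) ub by blast
    then show ?thesis using gisoD(4)[OF \<theta> u(1)] u(2) by simp
  qed
  ultimately show ?thesis using N_iff[OF f y] by blast
qed

lemma M'_image:
  assumes \<theta>: "giso G G f f (s + b + a) x y \<theta>"
    and x: "x \<in> topspace X" "x \<in> M'" and y: "y \<in> topspace X"
  shows "y \<in> M'"
proof -
  obtain v where v: "v \<in> N" "v \<in> gball G x s" "ann 1 (\<delta> v x)" and xM: "x \<in> M"
    using x(2) unfolding M'_def by blast
  have vR: "v \<in> gball G x (s + b + a)" using gball_le[OF v(2)] by simp
  have "y \<in> M" using recog_iff[OF completes_old[OF f] \<theta> _ x(1) y] xM by simp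
  moreover have \<theta>v: "\<theta> v \<in> gball G y s"
    using gisoD(5,6)[OF \<theta> vR] v(2) by (simp add: gball_def)
  moreover have "giso G G f f (b + a) v (\<theta> v) \<theta>"
    by (rule self_subball[OF \<theta> v(2)]) simp
  then have "\<theta> v \<in> N"
    using N_image[OF _ order_refl gball_in_V[OF x(1) v(2)] v(1) gball_in_V[OF y \<theta>v]] by blast
  moreover have "\<delta> (\<theta> v) y = \<delta> v x"
    using gisoD(6)[OF \<theta> vR] \<delta>_sym by metis
  ultimately show ?thesis using v(3) unfolding M'_def by auto
qed

end

text \<open>The radius adds \<open>s\<close> to reach the centre, \<open>b\<close> to see its
  pattern, and \<open>a\<close> to recognize \<open>M\<close> there.\<close>

lemma recognizable_M': "recognizable (s + b + a) M' q'"
  unfolding recognizable_def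
proof (intro allI impI ballI iffI)
  fix f x y \<theta>
  assume f: "completes M' q' f" and xy: "x \<in> topspace X" "y \<in> topspace X"
    and \<theta>: "giso G G f f (s + b + a) x y \<theta>"
  show "y \<in> M'" if "x \<in> M'" using M'_image[OF f \<theta> xy(1) that xy(2)] .
  show "x \<in> M'" if "y \<in> M'" using M'_image[OF f giso_inv[OF \<theta>] xy(2) that xy(1)] .
qed

section \<open>Density, local constancy and rigidity after one stage\<close>

lemma N_beyond:
  assumes "v \<in> topspace X" "con v w"
  shows "\<exists>w' v0. v0 \<in> N \<and> con w w' \<and> \<delta> w w' = T \<and> \<delta> v w' = \<delta> v w + T \<and> con w' v0 \<and> \<delta> w' v0 \<le> 2 * s + r"
proof -
  have w: "w \<in> topspace X" using con_in_V[OF assms(2,1)] .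
  obtain w' where w': "con w w'" "\<delta> w w' = T" "\<delta> v w' = \<delta> v w + T"
    using ex_beyond[OF assms(2) w] by blast
  have w'X: "w' \<in> topspace X" using con_in_V[OF w'(1) w] .
  then obtain u where u: "u \<in> M" "con w' u" "\<delta> w' u \<le> r"
    using dense unfolding outward_dense_def by blast
  then obtain v0 where v0: "v0 \<in> N" "v0 \<in> gball G u (2 * s)"
    using N_cover con_in_V[OF u(2) w'X] by blast
  have c: "con u v0" "\<delta> u v0 \<le> 2 * s" using v0(2) by (auto simp: gball_def)
  have "con w' v0" using u(2) c(1) by (rule rtrancl_trans)
  moreover have "\<delta> w' v0 \<le> 2 * s + r" using gdist_triangle[OF u(2) c(1)] u(3) c(2) by linarith
  ultimately show ?thesis using v0(1) w' by blast
qed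

lemma M'_near:
  assumes "v \<in> topspace X" "v \<in> N"
  shows "\<exists>u\<in>M'. con v u \<and> \<delta> v u \<le> b + 2 * r"
proof -
  obtain w where w: "con v w" "\<delta> v w = b + r"
    using ex_beyond[of v v "b + r"] assms(1) by auto
  obtain u where u: "u \<in> M" "con w u" "1 \<le> \<delta> w u" "\<delta> w u \<le> r" "\<delta> v u = \<delta> v w + \<delta> w u"
    using dense assms(1) w(1) unfolding outward_dense_def by blast
  have "con v u" using w(1) u(2) by (rule rtrancl_trans)
  moreover have "ann 1 (\<delta> v u)" using u w(2) by (simp add: ann_def)
  moreover have "\<delta> v u \<le> s" using u w(2) b_bounds by linarith
  ultimately show ?thesis
    using u w(2) assms(2) unfolding M'_def mem_gball_rev by (intro bexI[of _ u]) auto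
qed

text \<open>From a point at distance \<open>t\<close> behind \<open>w\<close>, a centre is within
  \<open>2 * s + r\<close> and a free vertex within another \<open>b + 2 * r\<close>. The sum is
  \<open>t - 1\<close>, so \<open>branch_ball\<close> keeps this vertex behind
  \<open>w\<close>.\<close>

lemma outward_dense_M': "outward_dense (2 * t) M'"
  unfolding outward_dense_def
proof (intro ballI allI impI)
  fix v w assume vw: "v \<in> topspace X" "con v w"
  obtain w' v0 where w': "v0 \<in> N" "con w w'" "\<delta> w w' = t" "\<delta> v w' = \<delta> v w + t" "con w' v0" "\<delta> w' v0 \<le> 2 * s + r"
    using N_beyond[OF vw] by blast
  have "con v v0" using vw(2) w'(2,5) by (meson rtrancl_trans)
  then have "v0 \<in> topspace X" using con_in_V vw(1) by blast
  then obtain u where u: "u \<in> M'" "con v0 u" "\<delta> v0 u \<le> b + 2 * r"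
    using M'_near w'(1) by blast
  have c: "con w' u" "con w u" using w'(2,5) u(2) by (meson rtrancl_trans)+
  have less: "\<delta> w' u < t" using gdist_triangle[OF w'(5) u(2)] w'(6) u(3) t by linarith
  have "\<delta> v u = \<delta> v w + \<delta> w u"
    by (rule branch_ball[OF vw(2) w'(2) _ c(1)]) (use w' less in auto)
  moreover have "\<delta> w u \<le> 2 * t" using gdist_triangle[OF w'(2) c(1)] w'(3) less by linarith
  moreover have "1 \<le> \<delta> w u"
  proof -
    have "\<delta> w w' \<le> \<delta> w u + \<delta> w' u"
      using gdist_triangle[OF c(2) con_sym[OF c(1)]] \<delta>_sym by metis
    then show ?thesis using w'(3) less by linarith
  qed
  ultimately show "\<exists>u\<in>M'. con w u \<and> 1 \<le> \<delta> w u \<and> \<delta> w u \<le> 2 * t \<and> \<delta> v u = \<delta> v w + \<delta> w u"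
    using u(1) c(2) by blast
qed

text \<open>Both depend on radius \<open>2 * s\<close>: the centre is within \<open>s\<close>, and
  its rings extend by at most \<open>s\<close> from it.\<close>

lemma locally_constant_M'_q': "locally_constant X (\<lambda>x. (x \<in> M', q' x))"
proof -
  let ?f = "\<lambda>x. ((x \<in> M, x \<in> N), (\<kappa> x, q x))"
  have lc: "locally_constant X ?f"
    using M_lc N_lc \<kappa>_lc q_lc by (intro locally_constant_Pair)
  have key: "(x \<in> M' \<longrightarrow> y \<in> M') \<and> (q' x \<longrightarrow> q' y)" if \<sigma>: "giso G G ?f ?f (2 * s) x y \<sigma>" for x y \<sigma>
  proof -
    have y: "y = \<sigma> x" using gisoD(1)[OF \<sigma>] by simp
    have lab: "(\<sigma> u \<in> M) = (u \<in> M)" "(\<sigma> u \<in> N) = (u \<in> N)" "\<kappa> (\<sigma> u) = \<kappa> u" "q (\<sigma> u) = q u"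
      if "u \<in> gball G x (2 * s)" for u using gisoD(4)[OF \<sigma> that] by auto
    have v: "\<sigma> v \<in> gball G y s" "\<sigma> v \<in> N \<longleftrightarrow> v \<in> N" "\<delta> (\<sigma> v) y = \<delta> v x" "one (\<sigma> v) y = one v x"
      if v: "v \<in> gball G x s" for v
    proof -
      have v2: "v \<in> gball G x (2 * s)" using gball_le[OF v] by simp
      show "\<sigma> v \<in> gball G y s" using gisoD(5,6)[OF \<sigma> v2] v by (simp add: gball_def)
      show "\<sigma> v \<in> N \<longleftrightarrow> v \<in> N" using lab(2)[OF v2] .
      show dv: "\<delta> (\<sigma> v) y = \<delta> v x"
        using gisoD(6)[OF \<sigma> v2] \<delta>_sym by metis
      have \<sigma>v: "giso G G ?f ?f s v (\<sigma> v) \<sigma>"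
        by (rule self_subball[OF \<sigma> v]) simp
      have ring_s: "ring z i \<subseteq> gball G z s" if "i < 25" for z i
      proof
        fix u assume "u \<in> ring z i"
        then show "u \<in> gball G z s"
          using ann_le[of "2 * i + 3" "\<delta> z u" 52] that b_bounds by (simp add: ring_def gball_def)
      qed
      have "card {u' \<in> ring (\<sigma> v) i. \<kappa> u' < \<kappa> y} = card {u' \<in> ring v i. \<kappa> u' < \<kappa> x}" if i: "i < 25" for i
      proof -
        let ?A = "{u' \<in> ring v i. \<kappa> u' < \<kappa> x}" and ?B = "{u' \<in> ring (\<sigma> v) i. \<kappa> u' < \<kappa> y}"
        have \<kappa>xy: "\<kappa> y = \<kappa> x" using lab(3)[of x] y by simp
        have in2: "u \<in> gball G x (2 * s)" if "u \<in> gball G v s" for u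
          using gball_trans[OF v that] by (simp add: mult_2)
        have "\<sigma> ` ?A = ?B"
        proof (intro subset_antisym subsetI)
          fix z assume "z \<in> \<sigma> ` ?A"
          then obtain u where u: "u \<in> ring v i" "\<kappa> u < \<kappa> x" "z = \<sigma> u" by blast
          have us: "u \<in> gball G v s" using ring_s[OF i] u(1) by blast
          show "z \<in> ?B"
            using u \<kappa>xy lab[OF in2[OF us]] gisoD(5,6)[OF \<sigma>v us]
              by (simp add: ring_def gball_def)
        next
          fix z assume z: "z \<in> ?B"
          then have "z \<in> gball G (\<sigma> v) s" using ring_s[OF i] by blast
          then obtain u where u: "u \<in> gball G v s" "z = \<sigma> u"
            using giso_surj[OF \<sigma>v] by blast
          then have "u \<in> ?A"
            using z \<kappa>xy lab[OF in2[OF u(1)]] gisoD(6)[OF \<sigma>v u(1)]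
              by (simp add: ring_def gball_def)
          then show "z \<in> \<sigma> ` ?A" using u(2) by blast
        qed
        moreover have "inj_on \<sigma> ?A"
          using gisoD(2)[OF \<sigma>v] ring_s[OF i] by (auto simp: bij_betw_def intro: inj_on_subset)
        ultimately show ?thesis using card_image by force
      qed
      moreover have "\<kappa> (\<sigma> v) = \<kappa> v" using lab(3)[OF v2] .
      ultimately show "one (\<sigma> v) y = one v x" unfolding one_def dv by auto
    qed
    have xM: "(y \<in> M) = (x \<in> M)" "q y = q x" using lab[of x] y by auto
    show ?thesis unfolding M'_def q'_def using xM v by (auto, metis+)
  qed
  show ?thesis
  proof (rule locally_constant_local_rule[OF lc])
    fix x y \<sigma> assume \<sigma>: "giso G G ?f ?f (2 * s) x y \<sigma>"
    show "(y \<in> M', q' y) = (x \<in> M', q' x)"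
      using key[OF \<sigma>] key[OF giso_inv[OF \<sigma>]] by auto
  qed
qed

lemma stage_M': "stage (2 * t) (s + b + a) M' q'"
  using locally_constant_comp[OF locally_constant_M'_q', of fst]
    locally_constant_comp[OF locally_constant_M'_q', of snd] outward_dense_M' recognizable_M'
  by (simp add: stage_def)

text \<open>The isomorphism has to cover the code, of radius \<open>s\<close>, of a centre up to
  \<open>2 * t\<close> away, with a margin of \<open>b + a\<close> for recognizing that the image is
  again a centre.\<close>

lemma rigid_completion:
  assumes f: "completes M' q' f"
  shows "rigid (topspace X) G f k (2 * t + s + b + a)"
  unfolding rigid_def
proof (intro ballI allI impI)
  fix x y \<theta>
  assume x: "x \<in> topspace X" and y: "y \<in> gball G x k" and \<theta>: "giso G G f f (2 * t + s + b + a) x y \<theta>"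
  have yX: "y \<in> topspace X" using gball_in_V[OF x y] .
  have yx: "con y x" "con x y" "\<delta> y x \<le> k"
    using y mem_gball_rev[of y x k] by (auto simp: gball_def)
  show "y = x"
  proof (rule ccontr)
    assume ne: "y \<noteq> x"
    \<comment> \<open>A centre on the far side of \<open>x\<close> from \<open>y\<close> cannot be fixed
      by \<open>\<theta>\<close>.\<close>
    obtain w' v where w': "v \<in> N" "con x w'" "\<delta> x w' = t" "\<delta> y w' = \<delta> y x + t" "con w' v" "\<delta> w' v \<le> 2 * s + r"
      using N_beyond[OF yX yx(1)] by blast
    have less: "\<delta> w' v < t" using w'(6) t by linarith
    have yv: "\<delta> y v = \<delta> y x + \<delta> x v"
      by (rule branch_ball[OF yx(1) w'(2) _ w'(5)]) (use w' less in auto)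
    have xv: "con x v" using w'(2,5) by (rule rtrancl_trans)
    have "\<delta> x v \<le> 2 * t" using gdist_triangle[OF w'(2,5)] w'(3) less by linarith
    then have vx: "v \<in> gball G x (2 * t)" using xv by (simp add: gball_def)
    then have vR: "v \<in> gball G x (2 * t + s + b + a)" by (rule gball_le) simp
    have vX: "v \<in> topspace X" using gball_in_V[OF x vx] .
    have \<theta>vR: "\<delta> y (\<theta> v) = \<delta> x v" "con y (\<theta> v)"
      using gisoD(5,6)[OF \<theta> vR] by (auto simp: gball_def)
    have \<theta>vX: "\<theta> v \<in> topspace X" using con_in_V[OF \<theta>vR(2) yX] .
    have \<theta>v: "giso G G f f (s + b + a) v (\<theta> v) \<theta>"
      by (rule self_subball[OF \<theta> vx]) simp
    have \<theta>vN: "\<theta> v \<in> N" by (rule N_image[OF f \<theta>v _ vX w'(1) \<theta>vX]) simp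
    have "\<delta> y x \<noteq> 0" using ne yx(1) by (simp add: gdist_eq_0_iff)
    then have v_ne: "\<theta> v \<noteq> v" using \<theta>vR(1) yv by auto
    have "\<theta> v \<in> gball G y (2 * t)" using \<theta>vR vx by (simp add: gball_def)
    \<comment> \<open>From \<open>v\<close> to \<open>x\<close>, to \<open>y\<close>, to
      \<open>\<theta> v\<close>: this sum dictates the distance up to which \<open>\<kappa>\<close>
      has to be proper.\<close>
    then have "\<theta> v \<in> gball G v (2 * t + (k + 2 * t))"
      using gball_trans[OF gball_sym[OF vx] gball_trans[OF y]] by blast
    then have far: "\<theta> v \<in> gball G v (k + 4 * t)" by (rule gball_le) simp
    have "enc (\<kappa> v) i = enc (\<kappa> (\<theta> v)) i" if i: "i < 25" for i
    proof -
      let ?A = "{u \<in> ring v i. f u}" and ?B = "{u \<in> ring (\<theta> v) i. f u}"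
      have ring_s: "u \<in> gball G z s" if "u \<in> ring z i" for z u
        using that ann_le[of "2 * i + 3" "\<delta> z u" 52] i b_bounds by (simp add: ring_def gball_def)
      have M_iff: "u \<in> M \<longleftrightarrow> \<theta> u \<in> M" if u: "u \<in> gball G v s" for u
      proof -
        have "u \<in> gball G v (s + b + a)" using gball_le[OF u] by simp
        then have "\<theta> u \<in> topspace X"
          using gisoD(5)[OF \<theta>v] gball_in_V[OF \<theta>vX] by blast
        moreover have "giso G G f f (b + a) u (\<theta> u) \<theta>"
          by (rule self_subball[OF \<theta>v u]) simp
        ultimately show ?thesis
          using recog_iff[OF completes_old[OF f] _ _ gball_in_V[OF vX u]] by simp
      qed
      have "\<theta> ` ?A = ?B"
      proof (intro subset_antisym subsetI)
        fix z assume "z \<in> \<theta> ` ?A"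
        then obtain u where u: "u \<in> ring v i" "f u" "z = \<theta> u" by blast
        have us: "u \<in> gball G v s" "u \<in> gball G v (s + b + a)"
          using ring_s[OF u(1)] gball_le[OF ring_s[OF u(1)]] by simp_all
        show "z \<in> ?B"
          using u M_iff[OF us(1)] gisoD(4,5,6)[OF \<theta>v us(2)] by (simp add: ring_def gball_def)
      next
        fix z assume z: "z \<in> ?B"
        then have zs: "z \<in> gball G (\<theta> v) s" using ring_s by blast
        then have "z \<in> gball G (\<theta> v) (s + b + a)" by (rule gball_le) simp
        then obtain u where u: "u \<in> gball G v (s + b + a)" "z = \<theta> u"
          using giso_surj[OF \<theta>v] by blast
        then have "u \<in> gball G v s" using zs gisoD(6)[OF \<theta>v u(1)] by (simp add: gball_def)
        then have "u \<in> ?A"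
          using z u(2) M_iff gisoD(4,6)[OF \<theta>v u(1)] by (simp add: ring_def gball_def)
        then show "z \<in> \<theta> ` ?A" using u(2) by blast
      qed
      moreover have "inj_on \<theta> ?A"
      proof (rule inj_on_subset)
        show "inj_on \<theta> (gball G v (s + b + a))"
          using gisoD(2)[OF \<theta>v] by (simp add: bij_betw_def)
        show "?A \<subseteq> gball G v (s + b + a)" using ring_s gball_le by fastforce
      qed
      ultimately have "card ?B = card ?A" using card_image by force
      then show ?thesis using f_ring[OF f vX w'(1) i] f_ring[OF f \<theta>vX \<theta>vN i] by simp
    qed
    then have "\<kappa> v = \<kappa> (\<theta> v)"
      using enc_inj \<kappa>_bound[OF vX] \<kappa>_bound[OF \<theta>vX] by blast
    then show False using \<kappa>_proper[OF vX far] v_ne by simp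
  qed
qed

end

section \<open>Labellings rigid at finitely many scales\<close>

context continuous_forest begin

lemma stage_step:
  assumes r: "1 \<le> r" and st: "stage r a M q"
    and b: "b = 2 * k + 872 * r + 8" and s: "s = b + 53 * r" and t: "t = 2 * s + b + 3 * r + 1"
  shows "\<exists>M' q'. stage (2 * t) (s + b + a) M' q' \<and>
    (\<forall>f. completes M' q' f \<longrightarrow> completes M q f \<and> rigid (topspace X) G f k (2 * t + s + b + a))"
proof -
  have "locally_constant X (\<lambda>x. x \<in> M)" using st by (simp add: stage_def)
  then obtain N where N: "N \<subseteq> M" "locally_constant X (\<lambda>x. x \<in> N)"
      "\<forall>x\<in>topspace X \<inter> N. \<forall>y\<in>gball G x (2 * s) \<inter> N. y = x"
      "\<forall>x\<in>topspace X \<inter> M. \<exists>y\<in>N. y \<in> gball G x (2 * s)"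
    using ex_maximal_separated[of M "2 * s"] by blast
  have "locally_constant X (\<lambda>x. x \<in> UNIV)" by (simp add: locally_constant_const)
  then obtain \<kappa> :: "'a \<Rightarrow> nat" where \<kappa>: "locally_constant X \<kappa>"
     "\<forall>x\<in>topspace X \<inter> UNIV. \<forall>y\<in>gball G x (k + 4 * t) \<inter> UNIV. \<kappa> y = \<kappa> x \<longrightarrow> y = x"
     "\<forall>x\<in>topspace X. \<kappa> x < card (gball G x (k + 4 * t))"
    using ex_greedy_coloring[of UNIV "k + 4 * t"] by blast
  have D: "k + 4 * t = k + 12 * b + 436 * r + 4" using s t by simp
  obtain enc :: "nat \<Rightarrow> nat \<Rightarrow> nat" where enc:
     "\<forall>c c'. c < (d + 1) ^ (k + 4 * t) \<longrightarrow> c' < (d + 1) ^ (k + 4 * t) \<longrightarrow> (\<forall>i<25. enc c i = enc c' i) \<longrightarrow> c = c'"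
     "\<forall>c<(d + 1) ^ (k + 4 * t). \<forall>i<25. enc c i \<le> (d - 1) ^ b"
    using ex_code[OF d_gt_2 b D] by (elim exE conjE)
  interpret beacon_code d X G k r a M N q \<kappa> enc b s t
  proof unfold_locales
    show "\<kappa> x < (d + 1) ^ (k + 4 * t)" if "x \<in> topspace X" for x
      using \<kappa>(3) that card_gball_le[of x "k + 4 * t"] by (meson less_le_trans)
    show "y = x" if "x \<in> topspace X" "x \<in> N" "y \<in> N" "y \<in> gball G x (2 * s)" for x y
      using N(3) that by blast
    show "\<exists>y\<in>N. y \<in> gball G x (2 * s)" if "x \<in> topspace X" "x \<in> M" for x
      using N(4) that by blast
    show "y = x" if "x \<in> topspace X" "y \<in> gball G x (k + 4 * t)" "\<kappa> y = \<kappa> x" for x y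
      using \<kappa>(2) that by blast
    show "c = c'" if "c < (d + 1) ^ (k + 4 * t)" "c' < (d + 1) ^ (k + 4 * t)"
      "\<And>i. i < 25 \<Longrightarrow> enc c i = enc c' i" for c c'
      using enc(1) that by blast
    show "enc c i \<le> (d - 1) ^ b" if "c < (d + 1) ^ (k + 4 * t)" "i < 25" for c i
      using enc(2) that by blast
  qed (fact r st b s t N(1,2) \<kappa>(1))+
  show ?thesis using stage_M' completes_old rigid_completion by blast
qed

end

section \<open>Sizes at each scale\<close>

definition beacon_radius :: "nat \<Rightarrow> nat \<Rightarrow> nat" where "beacon_radius k r = 2 * k + 872 * r + 8"
definition beacon_separation :: "nat \<Rightarrow> nat \<Rightarrow> nat" where "beacon_separation k r = beacon_radius k r + 53 * r"
definition beacon_reach :: "nat \<Rightarrow> nat \<Rightarrow> nat" where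
  "beacon_reach k r = 2 * beacon_separation k r + beacon_radius k r + 3 * r + 1"

primrec stage_density :: "nat \<Rightarrow> nat" where
  "stage_density 0 = 1"
| "stage_density (Suc k) = 2 * beacon_reach k (stage_density k)"

primrec stage_recog :: "nat \<Rightarrow> nat" where
  "stage_recog 0 = 0"
| "stage_recog (Suc k) = beacon_separation k (stage_density k) + beacon_radius k (stage_density k) + stage_recog k"

text \<open>A function of the scale alone, hence the same for \<T> and for the regular tree.
  Otherwise a labelling of \<T> could not be compared with \<open>rigid_labellings\<close>.\<close>

definition rigidity_radius :: "nat \<Rightarrow> nat" where
  "rigidity_radius k = 2 * beacon_reach k (stage_density k) + beacon_separation k (stage_density k)
     + beacon_radius k (stage_density k) + stage_recog k"

lemma stage_density_ge_1: "1 \<le> stage_density n"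
  by (cases n) (auto simp: beacon_reach_def)

context continuous_forest begin

lemma ex_stage:
  "\<exists>M q. stage (stage_density n) (stage_recog n) M q \<and>
     (\<forall>f. completes M q f \<longrightarrow> (\<forall>k<n. rigid (topspace X) G f k (rigidity_radius k)))"
proof (induction n)
  case 0
  have "outward_dense 1 UNIV"
    unfolding outward_dense_def
  proof (intro ballI allI impI)
    fix v w assume vw: "v \<in> topspace X" "con v w"
    obtain u where "con w u" "\<delta> w u = 1" "\<delta> v u = \<delta> v w + 1"
      using ex_beyond[OF vw(2) con_in_V[OF vw(2,1)], of 1] by blast
    then show "\<exists>u\<in>UNIV. con w u \<and> 1 \<le> \<delta> w u \<and> \<delta> w u \<le> 1 \<and> \<delta> v u = \<delta> v w + \<delta> w u"
      by auto
  qed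
  then have "stage 1 0 UNIV (\<lambda>_. False)"
    by (auto simp: stage_def recognizable_def locally_constant_const)
  then show ?case by (intro exI[of _ UNIV] exI[of _ "\<lambda>_. False"]) simp
next
  case (Suc n)
  then obtain M q where st: "stage (stage_density n) (stage_recog n) M q"
    and old: "\<And>f k. completes M q f \<Longrightarrow> k < n \<Longrightarrow> rigid (topspace X) G f k (rigidity_radius k)"
      by blast
  obtain M' q' where new: "stage (stage_density (Suc n)) (stage_recog (Suc n)) M' q'"
     "\<And>f. completes M' q' f \<Longrightarrow> completes M q f \<and> rigid (topspace X) G f n (rigidity_radius n)"
    using stage_step[OF stage_density_ge_1 st beacon_radius_def beacon_separation_def beacon_reach_def]
    unfolding rigidity_radius_def stage_density.simps stage_recog.simps by blast
  have "rigid (topspace X) G f k (rigidity_radius k)" if "completes M' q' f" "k < Suc n" for f k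
    using new(2)[OF that(1)] old[of f k] that(2) by (cases "k = n") auto
  then show ?case using new(1) by blast
qed

lemma ex_rigid_labelling:
  "\<exists>f :: 'a \<Rightarrow> bool. locally_constant X f \<and> (\<forall>k<n. rigid (topspace X) G f k (rigidity_radius k))"
proof -
  obtain M q where st: "stage (stage_density n) (stage_recog n) M q"
    and R: "\<And>f. completes M q f \<Longrightarrow> \<forall>k<n. rigid (topspace X) G f k (rigidity_radius k)"
    using ex_stage[of n] by blast
  \<comment> \<open>The remaining free labels become \<open>False\<close>; any locally constant
    choice would do.\<close>
  let ?f = "\<lambda>u. u \<notin> M \<and> q u"
  have "locally_constant X ?f"
    using st locally_constant_comp[OF locally_constant_Pair, of X "\<lambda>u. u \<in> M" q "\<lambda>(m, c). \<not> m \<and> c"]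
    by (simp add: stage_def)
  moreover have "completes M q ?f" by (simp add: completes_def)
  ultimately show ?thesis using R by blast
qed

end

section \<open>The regular tree as a regular forest\<close>

lemma Nil_in_tree_vertices [simp]: "[] \<in> tree_vertices d"
  by (simp add: tree_vertices_def)

lemma snoc_in_tree_vertices:
  "w @ [a] \<in> tree_vertices d \<longleftrightarrow> w \<in> tree_vertices d \<and> a < d \<and> (w \<noteq> [] \<longrightarrow> last w \<noteq> a)"
  by (auto simp: tree_vertices_def distinct_adj_append_iff)

lemma tree_edges_shorter:
  assumes "(w, u) \<in> tree_edges d" "length u \<le> length w"
  shows "w \<noteq> [] \<and> u = butlast w"
  using assms by (auto simp: tree_edges_def)

lemma tree_nbrs:
  assumes "w \<in> tree_vertices d"
  shows "tree_edges d `` {w} =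
    (\<lambda>a. w @ [a]) ` {a. a < d \<and> (w \<noteq> [] \<longrightarrow> last w \<noteq> a)} \<union> (if w = [] then {} else {butlast w})"
    (is "?L = ?R")
proof (intro subset_antisym subsetI)
  fix u assume "u \<in> ?L"
  then have u: "u \<in> tree_vertices d" "(\<exists>a. u = w @ [a]) \<or> (\<exists>a. w = u @ [a])"
    by (auto simp: tree_edges_def)
  from u(2) show "u \<in> ?R"
  proof (elim disjE exE)
    fix a assume "u = w @ [a]"
    then show ?thesis using u(1) snoc_in_tree_vertices[of w a d] by auto
  qed auto
next
  fix u assume u: "u \<in> ?R"
  show "u \<in> ?L"
  proof (cases "w \<noteq> [] \<and> u = butlast w")
    case True
    then have "w = u @ [last w]" by simp
    then show ?thesis using assms snoc_in_tree_vertices[of u "last w" d] by (auto simp: tree_edges_def)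
  next
    case False
    then obtain a where "u = w @ [a]" "a < d" "w \<noteq> [] \<longrightarrow> last w \<noteq> a"
      using u by (auto split: if_splits)
    then show ?thesis using assms snoc_in_tree_vertices[of w a d] by (auto simp: tree_edges_def)
  qed
qed

lemma regular_tree: "regular_graph d (tree_vertices d) (tree_edges d)"
  unfolding regular_graph_def
proof
  fix w assume w: "w \<in> tree_vertices d"
  let ?A = "{a. a < d \<and> (w \<noteq> [] \<longrightarrow> last w \<noteq> a)}"
  have inj: "inj_on (\<lambda>a. w @ [a]) ?A" by (auto simp: inj_on_def)
  have fin: "finite ((\<lambda>a. w @ [a]) ` ?A)" by simp
  have c: "card ((\<lambda>a. w @ [a]) ` ?A) = card ?A" by (rule card_image[OF inj])
  show "finite (tree_edges d `` {w}) \<and> card (tree_edges d `` {w}) = d"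
  proof (cases "w = []")
    case True
    then have "?A = {..<d}" by auto
    then show ?thesis using c fin tree_nbrs[OF w] True by simp
  next
    case False
    have l: "last w < d"
      using w snoc_in_tree_vertices[of "butlast w" "last w" d] False by simp
    have "?A = {..<d} - {last w}" using False by auto
    then have "card ?A = d - 1" using l by simp
    moreover have "butlast w \<notin> (\<lambda>a. w @ [a]) ` ?A"
    proof
      assume "butlast w \<in> (\<lambda>a. w @ [a]) ` ?A"
      then obtain a where "butlast w = w @ [a]" by blast
      then have "length (butlast w) = length (w @ [a])" by simp
      then show False by simp
    qed
    ultimately show ?thesis using c fin tree_nbrs[OF w] False l by simp
  qed
qed

lemma simple_tree: "simple_graph (tree_vertices d) (tree_edges d)"
  by (auto simp: simple_graph_def tree_edges_def sym_def irrefl_def)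

text \<open>A longest word on a cycle would have two different neighbours on it, both obtained by
  deleting its last letter.\<close>

lemma acyclic_tree: "acyclic_graph (tree_edges d)"
  unfolding acyclic_graph_def
proof (rule notI, elim exE conjE)
  fix xs assume n: "3 \<le> length xs" and dist: "distinct xs"
    and succ: "successively (\<lambda>x y. (x, y) \<in> tree_edges d) xs" and cl: "(last xs, hd xs) \<in> tree_edges d"
  let ?n = "length xs"
  have sym: "(v, u) \<in> tree_edges d" if "(u, v) \<in> tree_edges d" for u v
    using that by (auto simp: tree_edges_def)
  have step: "(xs ! i, xs ! ((i + 1) mod ?n)) \<in> tree_edges d" if "i < ?n" for i
  proof (cases "i + 1 < ?n")
    case True
    then show ?thesis using succ by (simp add: successively_conv_nth)
  next
    case False
    then have "i = ?n - 1" using that by simp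
    moreover have "xs \<noteq> []" using n by auto
    ultimately show ?thesis using cl n by (simp add: last_conv_nth hd_conv_nth)
  qed
  define m where "m = Max (length ` set xs)"
  have "m \<in> length ` set xs" unfolding m_def using n by (intro Max_in) auto
  then obtain i where i: "i < ?n" "length (xs ! i) = m" by (auto simp: in_set_conv_nth)
  have le: "length (xs ! j) \<le> length (xs ! i)" if "j < ?n" for j
    using i(2) that unfolding m_def by simp
  let ?j = "(i + 1) mod ?n" and ?h = "if i = 0 then ?n - 1 else i - 1"
  have jh: "?j < ?n" "?h < ?n" "?j \<noteq> ?h" "(?h + 1) mod ?n = i"
  proof -
    show "?j < ?n" using n by (intro mod_less_divisor) linarith
    show "?h < ?n" using i(1) by auto
    show "?j \<noteq> ?h"
    proof (cases "i + 1 < ?n")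
      case True
      then show ?thesis using n by (cases "i = 0") auto
    next
      case False
      then have "i + 1 = ?n" using i(1) by simp
      then show ?thesis using n by simp
    qed
    show "(?h + 1) mod ?n = i" using i(1) by (cases "i = 0") auto
  qed
  have "xs ! ?j = butlast (xs ! i)"
    using tree_edges_shorter[OF step[OF i(1)] le[OF jh(1)]] by simp
  moreover have "(xs ! ?h, xs ! i) \<in> tree_edges d" using step[OF jh(2)] jh(4) by simp
  then have "xs ! ?h = butlast (xs ! i)"
    using tree_edges_shorter[OF sym le[OF jh(2)]] by blast
  ultimately have "xs ! ?j = xs ! ?h" by (simp only:)
  then show False using nth_eq_iff_index_eq[OF dist jh(1,2)] jh(3) by blast
qed

lemma regular_forest_tree: "2 < d \<Longrightarrow> regular_forest d (tree_vertices d) (tree_edges d)"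
  by (intro regular_forest.intro simple_tree acyclic_tree regular_tree)

lemma tree_connected: "w \<in> tree_vertices d \<Longrightarrow> ([], w) \<in> (tree_edges d)\<^sup>*"
proof (induction w rule: rev_induct)
  case (snoc a w)
  then have "w \<in> tree_vertices d" by (simp add: snoc_in_tree_vertices)
  then have "([], w) \<in> (tree_edges d)\<^sup>*" "(w, w @ [a]) \<in> tree_edges d"
    using snoc by (auto simp: tree_edges_def)
  then show ?case by (rule rtrancl_into_rtrancl)
qed simp

section \<open>Labellings of the regular tree\<close>

lemma half_edge_topology_base:
  assumes "openin (half_edge_topology X G) S" "(x, y) \<in> S"
  shows "\<exists>U W. clopenin X U \<and> clopenin X W \<and> x \<in> U \<and> y \<in> W \<and> (U \<times> W) \<inter> G \<subseteq> S"
proof -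
  have "generate_topology_on {(U \<times> V) \<inter> G |U V. clopenin X U \<and> clopenin X V} S"
    using assms(1) unfolding half_edge_topology_def by (simp add: openin_topology_generated_by_iff)
  then show ?thesis
    using assms(2)
  proof (induction rule: generate_topology_on.induct)
    case (Int a b)
    then obtain U W U' W' where
      "clopenin X U" "clopenin X W" "x \<in> U" "y \<in> W" "(U \<times> W) \<inter> G \<subseteq> a"
      "clopenin X U'" "clopenin X W'" "x \<in> U'" "y \<in> W'" "(U' \<times> W') \<inter> G \<subseteq> b"
        by blast
    then show ?case
      by (intro exI[of _ "U \<inter> U'"] exI[of _ "W \<inter> W'"]) (auto simp: clopenin_def)
  next
    case (UN K)
    then obtain k where "k \<in> K" "(x, y) \<in> k" by blast
    then show ?case using UN.IH[of k] by blast
  next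
    case (Basis s)
    then show ?case by blast
  qed simp
qed

lemma openin_half_edge:
  assumes "S \<subseteq> G" and "\<And>x y. (x, y) \<in> S \<Longrightarrow>
      \<exists>U W. clopenin X U \<and> clopenin X W \<and> x \<in> U \<and> y \<in> W \<and> (U \<times> W) \<inter> G \<subseteq> S"
  shows "openin (half_edge_topology X G) S"
proof (subst openin_subopen, intro ballI)
  fix e assume "e \<in> S"
  then obtain U W where U: "clopenin X U" "clopenin X W" "fst e \<in> U" "snd e \<in> W" "(U \<times> W) \<inter> G \<subseteq> S"
    using assms(2)[of "fst e" "snd e"] by auto
  then have "openin (half_edge_topology X G) ((U \<times> W) \<inter> G)"
    unfolding half_edge_topology_def by (intro topology_generated_by_Basis) blast
  moreover have "e \<in> (U \<times> W) \<inter> G"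
    using U \<open>e \<in> S\<close> assms(1) by (cases e) auto
  ultimately show "\<exists>B. openin (half_edge_topology X G) B \<and> e \<in> B \<and> B \<subseteq> S"
    using U(5) by blast
qed

lemma topspace_half_edge:
  assumes "G \<subseteq> topspace X \<times> topspace X"
  shows "topspace (half_edge_topology X G) = G"
proof
  show "topspace (half_edge_topology X G) \<subseteq> G"
    unfolding half_edge_topology_def by (auto simp: topology_generated_by_topspace)
  have "clopenin X (topspace X)" by (simp add: clopenin_def)
  then have "(topspace X \<times> topspace X) \<inter> G \<subseteq> topspace (half_edge_topology X G)"
    unfolding half_edge_topology_def topology_generated_by_topspace by blast
  then show "G \<subseteq> topspace (half_edge_topology X G)" using assms by blast
qed

lemma topspace_quotient_topology: "topspace (quotient_topology X r) = topspace X // r"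
  using quotient_imp_surjective_map[OF quotient_map_quotient_topology[of X r]]
    by (auto simp: quotient_def)

text \<open>Conjugation by \<open>\<pi>\<close>, an isometry on every ball, turns an isomorphism in
  \<open>G\<close> into one in \<open>H\<close>. This serves for tree automorphisms and for copying
  a labelling of \<T> to the regular tree.\<close>

lemma rigid_pullback:
  assumes pair: "regular_forest_pair d V G W H"
    and \<pi>: "\<And>R. giso G H f h R x0 y0 \<pi>" and V: "\<And>x. x \<in> V \<Longrightarrow> (x0, x) \<in> G\<^sup>*"
    and y0: "y0 \<in> W" and rig: "rigid W H h k \<rho>"
  shows "rigid V G f k \<rho>"
  unfolding rigid_def
proof (intro ballI allI impI)
  interpret regular_forest_pair d V G W H by (rule pair)
  interpret rev: regular_forest_pair d W H V G by unfold_locales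
  fix x y \<theta>
  assume x: "x \<in> V" and y: "y \<in> gball G x k" and \<theta>: "giso G G f f \<rho> x y \<theta>"
  have sub: "giso G H f h R u (\<pi> u) \<pi>" if "u \<in> V" for u R
    by (rule giso_subball[OF \<pi>[of "gdist G x0 u + R"] _ order_refl]) (use V[OF that] in \<open>simp add: gball_def\<close>)
  have yV: "y \<in> V" using dom.gball_in_V[OF x y] .
  have \<pi>x: "\<pi> x \<in> W"
    using gisoD(5)[OF \<pi>, of x "gdist G x0 x"] V[OF x] cod.gball_in_V[OF y0] by (auto simp: gball_def)
  have \<pi>y: "\<pi> y \<in> gball H (\<pi> x) k" using gisoD(5)[OF sub[OF x] y] .
  have "giso H H h h \<rho> (\<pi> x) (\<pi> y) (\<lambda>u. \<pi> (\<theta> (inv_into (gball G x \<rho>) \<pi> u)))"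
    using giso_comp[OF giso_comp[OF giso_inv[OF sub[OF x]] \<theta>] sub[OF yV]] .
  then have "\<pi> y = \<pi> x" using rig \<pi>x \<pi>y unfolding rigid_def by blast
  then show "y = x" using giso_inj[OF sub[OF x] y gball_refl] by simp
qed

locale labelled_tree =
  fixes d :: nat
  assumes d_gt: "2 < d"
begin

abbreviation "TV \<equiv> tree_vertices d"
abbreviation "T \<equiv> tree_edges d"

lemmas forest = regular_forest_tree[OF d_gt]

sublocale tree: regular_forest d TV T by (rule forest)

lemma tree_pair: "regular_forest_pair d TV T TV T"
  by (intro regular_forest_pair.intro forest)

lemma tree_con: "u \<in> TV \<Longrightarrow> v \<in> TV \<Longrightarrow> (u, v) \<in> T\<^sup>*"
  using tree_connected[of u d] tree_connected[of v d] tree.con_sym rtrancl_trans by metis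

lemma mem_gball_tree: "u \<in> TV \<Longrightarrow> v \<in> gball T u R \<longleftrightarrow> v \<in> TV \<and> gdist T u v \<le> R"
  using tree_con[of u v] tree.con_in_V[of u v] by (auto simp: gball_def)

section \<open>Automorphisms and free labellings\<close>

lemma AutD:
  assumes "g \<in> tree_Aut d"
  shows "g permutes TV" "bij g" "u \<in> TV \<Longrightarrow> g u \<in> TV" "inv g (g u) = u" "g (inv g u) = u"
    "(u, v) \<in> T \<Longrightarrow> (g u, g v) \<in> T"
proof -
  show p: "g permutes TV" using assms by (simp add: tree_Aut_def)
  show "bij g" using permutes_bij[OF p] .
  show "u \<in> TV \<Longrightarrow> g u \<in> TV" using permutes_in_image[OF p] by simp
  show "inv g (g u) = u" "g (inv g u) = u" using permutes_inverses[OF p] by simp_all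
  show "(g u, g v) \<in> T" if "(u, v) \<in> T"
    using assms that tree.edge_in_V[OF that] by (simp add: tree_Aut_def)
qed

lemma Aut_id: "id \<in> tree_Aut d"
  by (simp add: tree_Aut_def permutes_id)

lemma Aut_inv:
  assumes g: "g \<in> tree_Aut d"
  shows "inv g \<in> tree_Aut d"
proof -
  have p: "inv g permutes TV" using AutD(1)[OF g] by (rule permutes_inv)
  have "(inv g u, inv g v) \<in> T \<longleftrightarrow> (u, v) \<in> T" if "u \<in> TV" "v \<in> TV" for u v
  proof -
    have "inv g u \<in> TV" "inv g v \<in> TV" using that permutes_in_image[OF p] by simp_all
    then show ?thesis using g AutD(5)[OF g] unfolding tree_Aut_def by force
  qed
  then show ?thesis using p by (simp add: tree_Aut_def)
qed

lemma Aut_comp: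
  assumes g: "g \<in> tree_Aut d" and h: "h \<in> tree_Aut d"
  shows "g \<circ> h \<in> tree_Aut d"
proof -
  have "((g \<circ> h) u, (g \<circ> h) v) \<in> T \<longleftrightarrow> (u, v) \<in> T" if "u \<in> TV" "v \<in> TV" for u v
    using g h AutD(3)[OF h that(1)] AutD(3)[OF h that(2)] that unfolding tree_Aut_def by simp
  moreover have "g \<circ> h permutes TV" using permutes_compose[OF AutD(1)[OF h] AutD(1)[OF g]] .
  ultimately show ?thesis by (simp add: tree_Aut_def)
qed

lemma act_act: "g \<in> tree_Aut d \<Longrightarrow> h \<in> tree_Aut d \<Longrightarrow> act g (act h z) = act (g \<circ> h) z"
  using AutD(2) by (simp add: act_def o_inv_distrib fun_eq_iff)

lemma act_id: "act id z = z"
  by (simp add: act_def)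

lemma act_apply: "g \<in> tree_Aut d \<Longrightarrow> act g z (g u) = z u"
  using AutD(4) by (simp add: act_def)

lemma act_inv_act: "g \<in> tree_Aut d \<Longrightarrow> act (inv g) (act g z) = z"
  using AutD(4) AutD(2) by (simp add: act_def inv_inv_eq)

lemma labelling_iff: "z \<in> topspace (labelling_space d) \<longleftrightarrow> (\<forall>v. v \<notin> TV \<longrightarrow> z v = undefined)"
  by (auto simp: labelling_space_def PiE_def extensional_def)

lemma act_labelling:
  assumes g: "g \<in> tree_Aut d" and z: "z \<in> topspace (labelling_space d)"
  shows "act g z \<in> topspace (labelling_space d)"
proof -
  have "inv g v \<notin> TV" if "v \<notin> TV" for v
    using that permutes_in_image[OF AutD(1)[OF Aut_inv[OF g]]] by simp
  then show ?thesis using z by (simp add: labelling_iff act_def)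
qed

lemma free_labelling: "z \<in> free_part d \<Longrightarrow> z \<in> topspace (labelling_space d)"
  by (simp add: free_part_def)

lemma free_act_inj:
  assumes z: "z \<in> free_part d" and g: "g \<in> tree_Aut d" and h: "h \<in> tree_Aut d"
    and eq: "act g z = act h z"
  shows "g = h"
proof -
  have "act (inv h \<circ> g) z = act (inv h) (act h z)"
    by (simp only: act_act[OF Aut_inv[OF h] g, symmetric] eq)
  then have "act (inv h \<circ> g) z = z" using act_inv_act[OF h] by simp
  then have "inv h \<circ> g = id" using z Aut_comp[OF Aut_inv[OF h] g] unfolding free_part_def by blast
  then have "inv h (g u) = u" for u by (metis comp_apply id_apply)
  then have "g u = h u" for u using AutD(5)[OF h] by metis
  then show ?thesis by blast
qed

lemma free_act:
  assumes z: "z \<in> free_part d" and g: "g \<in> tree_Aut d"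
  shows "act g z \<in> free_part d"
proof -
  have "h = id" if h: "h \<in> tree_Aut d" and eq: "act h (act g z) = act g z" for h
  proof -
    have "act (h \<circ> g) z = act g z" by (simp only: act_act[OF h g, symmetric] eq)
    then have *: "h \<circ> g = g" using free_act_inj[OF z Aut_comp[OF h g] g] by blast
    have "h u = u" for u using fun_cong[OF *, of "inv g u"] AutD(5)[OF g] by simp
    then show ?thesis by auto
  qed
  then show ?thesis using act_labelling[OF g free_labelling[OF z]] unfolding free_part_def by blast
qed

lemma Aut_relpow: "g \<in> tree_Aut d \<Longrightarrow> (u, v) \<in> T ^^ n \<Longrightarrow> (g u, g v) \<in> T ^^ n"
proof (induction n arbitrary: v)
  case (Suc n)
  then obtain w where "(u, w) \<in> T ^^ n" "(w, v) \<in> T" by auto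
  then have "(g u, g w) \<in> T ^^ n" "(g w, g v) \<in> T" using Suc AutD(6) by auto
  then show ?case by auto
qed simp

lemma Aut_gdist:
  assumes g: "g \<in> tree_Aut d" and "u \<in> TV" "v \<in> TV"
  shows "gdist T (g u) (g v) = gdist T u v"
proof -
  have le: "gdist T (h u) (h v) \<le> gdist T u v" if "h \<in> tree_Aut d" "u \<in> TV" "v \<in> TV" for h u v
    using Aut_relpow[OF that(1) relpow_gdist[OF tree_con[OF that(2,3)]]] by (rule gdist_le)
  show ?thesis
    using le[OF assms] le[OF Aut_inv[OF g] AutD(3)[OF g assms(2)] AutD(3)[OF g assms(3)]] AutD(4)[OF g]
    by simp
qed

lemma giso_Aut:
  assumes g: "g \<in> tree_Aut d" and u: "u \<in> TV"
  shows "giso T T z (act g z) R u (g u) g"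
proof -
  have "g ` gball T u R = gball T (g u) R"
  proof (intro subset_antisym subsetI)
    fix v assume "v \<in> g ` gball T u R"
    then show "v \<in> gball T (g u) R"
      using Aut_gdist[OF g u] AutD(3)[OF g] by (auto simp: mem_gball_tree u)
  next
    fix v assume v: "v \<in> gball T (g u) R"
    then have vT: "v \<in> TV" using AutD(3)[OF g u] by (simp add: mem_gball_tree)
    then have iv: "inv g v \<in> TV" using AutD(3)[OF Aut_inv[OF g]] by blast
    have "gdist T u (inv g v) \<le> R"
      using Aut_gdist[OF g u iv] AutD(5)[OF g] v AutD(3)[OF g u] by (simp add: mem_gball_tree)
    then have "inv g v \<in> gball T u R" using iv u by (simp add: mem_gball_tree)
    then show "v \<in> g ` gball T u R" using AutD(5)[OF g, of v] by (metis imageI)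
  qed
  moreover have "inj_on g (gball T u R)"
    using AutD(2)[OF g] by (meson bij_is_inj inj_on_subset subset_UNIV)
  ultimately show ?thesis
    unfolding giso_def bij_betw_def using Aut_gdist[OF g] act_apply[OF g] u
    by (simp add: mem_gball_tree)
qed

lemma Aut_of_giso:
  assumes \<theta>: "\<And>R. giso T T (\<lambda>_. ()) (\<lambda>_. ()) R u v \<theta>" and u: "u \<in> TV" and v: "v \<in> TV"
  shows "\<exists>g\<in>tree_Aut d. \<forall>w\<in>TV. g w = \<theta> w"
proof -
  define g where "g w = (if w \<in> TV then \<theta> w else w)" for w
  have inR: "w \<in> gball T u (gdist T u w + R)" if "w \<in> TV" for w R
    using that u by (simp add: mem_gball_tree)
  have im: "\<theta> w \<in> TV" if "w \<in> TV" for w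
    using gisoD(5)[OF \<theta> inR[OF that]] v by (simp add: mem_gball_tree)
  have com: "w \<in> gball T u (gdist T u w + gdist T u w')" "w' \<in> gball T u (gdist T u w + gdist T u w')"
    if "w \<in> TV" "w' \<in> TV" for w w' using that u by (simp_all add: mem_gball_tree)
  have "inj_on \<theta> TV"
  proof (rule inj_onI)
    fix w w' assume w: "w \<in> TV" "w' \<in> TV" "\<theta> w = \<theta> w'"
    then show "w = w'" using giso_inj[OF \<theta> com[OF w(1,2)]] by simp
  qed
  moreover have "TV \<subseteq> \<theta> ` TV"
  proof
    fix y assume "y \<in> TV"
    then have "y \<in> gball T v (gdist T v y)" using v by (simp add: mem_gball_tree)
    then obtain w where "w \<in> gball T u (gdist T v y)" "y = \<theta> w"
      using giso_surj[OF \<theta>] by blast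
    then show "y \<in> \<theta> ` TV" using u by (auto simp: mem_gball_tree)
  qed
  ultimately have "bij_betw \<theta> TV TV" using im by (auto simp: bij_betw_def)
  then have "bij_betw g TV TV" by (subst bij_betw_cong[where g = \<theta>]) (simp_all add: g_def)
  then have "g permutes TV" by (rule bij_imp_permutes) (simp add: g_def)
  moreover have "(g w, g w') \<in> T \<longleftrightarrow> (w, w') \<in> T" if "w \<in> TV" "w' \<in> TV" for w w'
    using regular_forest_pair.giso_edge_iff[OF tree_pair \<theta> com[OF that]] that by (simp add: g_def)
  ultimately have "g \<in> tree_Aut d" by (simp add: tree_Aut_def)
  then show ?thesis by (intro bexI[of _ g]) (simp_all add: g_def)
qed

text \<open>Homogeneity of the regular tree. The labels are respected only on the given ball;
  outside it the automorphism is an arbitrary extension.\<close>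

lemma Aut_extends_giso:
  assumes "giso T T f h R u v \<theta>" "u \<in> TV" "v \<in> TV"
  shows "\<exists>g\<in>tree_Aut d. \<forall>w\<in>gball T u R. g w = \<theta> w"
proof -
  obtain \<eta> where \<eta>: "\<And>R'. giso T T (\<lambda>_. ()) (\<lambda>_. ()) R' u v \<eta>" "\<forall>w\<in>gball T u R. \<eta> w = \<theta> w"
    using regular_forest_pair.giso_extend[OF tree_pair assms] by blast
  obtain g where "g \<in> tree_Aut d" "\<forall>w\<in>TV. g w = \<eta> w"
    using Aut_of_giso[OF \<eta>(1) assms(2,3)] by blast
  then show ?thesis using \<eta>(2) assms(2) by (intro bexI[of _ g]) (simp_all add: mem_gball_tree)
qed

lemma Aut_transitive: "u \<in> TV \<Longrightarrow> \<exists>g\<in>tree_Aut d. g u = []"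
  using Aut_extends_giso[of "\<lambda>_. ()" "\<lambda>_. ()" 0 u "[]" "\<lambda>_. []"]
    by (force simp: giso_def bij_betw_def)

text \<open>The vertex of the quotient graph obtained by moving the root of the labelled tree
  \<open>z\<close> to \<open>u\<close>. For free \<open>z\<close> this identifies the regular tree
  with the component of the class of \<open>z\<close>.\<close>

definition rooted_class :: "(nat list \<Rightarrow> bool) \<Rightarrow> nat list \<Rightarrow> (nat list \<Rightarrow> bool) set" where
  "rooted_class z u = {act g z |g. g \<in> tree_Aut d \<and> g u = []}"

lemma rooted_class_act:
  assumes g: "g \<in> tree_Aut d"
  shows "rooted_class (act g z) (g u) = rooted_class z u"
proof (intro subset_antisym subsetI)
  fix y assume "y \<in> rooted_class (act g z) (g u)"
  then obtain h where "h \<in> tree_Aut d" "h (g u) = []" "y = act h (act g z)"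
    by (auto simp: rooted_class_def)
  then show "y \<in> rooted_class z u"
    unfolding rooted_class_def
      using Aut_comp[OF _ g, of h] act_act[OF _ g, of h] by (auto intro!: exI[of _ "h \<circ> g"])
next
  fix y assume "y \<in> rooted_class z u"
  then obtain h where h: "h \<in> tree_Aut d" "h u = []" "y = act h z" by (auto simp: rooted_class_def)
  have "act (h \<circ> inv g) (act g z) = act h (act (inv g) (act g z))"
    by (rule act_act[OF h(1) Aut_inv[OF g], symmetric])
  then have "y = act (h \<circ> inv g) (act g z)" using h(3) act_inv_act[OF g] by simp
  moreover have "(h \<circ> inv g) (g u) = []" using AutD(4)[OF g] h(2) by simp
  ultimately show "y \<in> rooted_class (act g z) (g u)"
    unfolding rooted_class_def using Aut_comp[OF h(1) Aut_inv[OF g]] by blast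
qed

lemma rooted_class_root: "z \<in> topspace (labelling_space d) \<Longrightarrow> rooted_class z [] = root_orbit_rel d `` {z}"
  unfolding rooted_class_def root_orbit_rel_def tree_Aut_root_def using act_labelling by auto

lemma rooted_class_eq_orbit:
  assumes "z \<in> topspace (labelling_space d)" "g \<in> tree_Aut d" "g u = []"
  shows "rooted_class z u = root_orbit_rel d `` {act g z}"
  using rooted_class_act[OF assms(2), of z u] rooted_class_root[OF act_labelling[OF assms(2,1)]] assms(3)
    by simp

lemma rooted_class_self: "z \<in> rooted_class z []"
  unfolding rooted_class_def using Aut_id by (auto simp: act_id intro!: exI[of _ id])

text \<open>Freeness enters here: an automorphism preserving the labels could identify neighbours of
  the root, and a class would have fewer than \<open>d\<close> neighbours.\<close>

lemma rooted_class_inj: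
  assumes z: "z \<in> free_part d" and u: "u \<in> TV" and eq: "rooted_class z u = rooted_class z v"
  shows "u = v"
proof -
  obtain g where g: "g \<in> tree_Aut d" "g u = []" using Aut_transitive[OF u] by blast
  then have "act g z \<in> rooted_class z v" using eq by (auto simp: rooted_class_def)
  then obtain h where h: "h \<in> tree_Aut d" "h v = []" "act g z = act h z"
    by (auto simp: rooted_class_def)
  then have "g = h" using free_act_inj[OF z g(1)] by blast
  then show ?thesis using g h AutD(4) by metis
qed

lemma rooted_class_free_quotient:
  assumes z: "z \<in> free_part d" and u: "u \<in> TV"
  shows "rooted_class z u \<in> free_part d // root_orbit_rel d"
proof -
  obtain g where g: "g \<in> tree_Aut d" "g u = []" using Aut_transitive[OF u] by blast
  show ?thesis
    using rooted_class_eq_orbit[OF free_labelling[OF z] g] free_act[OF z g(1)] by (simp add: quotientI)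
qed

lemma free_quotient_rooted_class:
  assumes "B \<in> free_part d // root_orbit_rel d" "y \<in> B"
  shows "B = rooted_class y []"
proof -
  obtain z where z: "z \<in> free_part d" "B = root_orbit_rel d `` {z}"
    using assms(1) by (auto simp: quotient_def)
  then have B: "B = rooted_class z []" using rooted_class_root[OF free_labelling] by simp
  then obtain g where g: "g \<in> tree_Aut d" "g [] = []" "y = act g z"
    using assms(2) by (auto simp: rooted_class_def)
  then show ?thesis using B rooted_class_act[OF g(1), of z "[]"] by simp
qed

lemma quotient_free_subset:
  "free_part d // root_orbit_rel d \<subseteq> topspace (labelling_space d) // root_orbit_rel d"
  using free_labelling by (auto simp: quotient_def)

text \<open>Acting by \<open>g\<close> amounts to rerooting at \<open>inv g []\<close>, which is a
  neighbour of the root whenever \<open>g []\<close> is. This turns adjacency by group elements into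
  adjacency in the tree.\<close>

lemma nbrs_rooted_class:
  assumes z: "z \<in> free_part d"
  shows "free_labelled_tree_graph d `` {rooted_class z []} = rooted_class z ` (T `` {[]})"
proof (intro subset_antisym subsetI)
  fix B assume "B \<in> free_labelled_tree_graph d `` {rooted_class z []}"
  then have B: "B \<in> free_part d // root_orbit_rel d"
      "\<forall>z'\<in>rooted_class z []. \<exists>g\<in>tree_Aut d. ([], g []) \<in> T \<and> act g z' \<in> B"
    by (auto simp: free_labelled_tree_graph_def labelled_tree_graph_def)
  then obtain g where g: "g \<in> tree_Aut d" "([], g []) \<in> T" "act g z \<in> B"
    using rooted_class_self by blast
  have "B = rooted_class (act g z) (g (inv g []))"
    using free_quotient_rooted_class[OF B(1) g(3)] AutD(5)[OF g(1)] by simp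
  also have "\<dots> = rooted_class z (inv g [])" by (rule rooted_class_act[OF g(1)])
  finally have "B = rooted_class z (inv g [])" .
  moreover have "([], inv g []) \<in> T"
    using tree.edge_sym[OF AutD(6)[OF Aut_inv[OF g(1)] g(2)]] AutD(4)[OF g(1)] by simp
  ultimately show "B \<in> rooted_class z ` (T `` {[]})" by blast
next
  fix B assume "B \<in> rooted_class z ` (T `` {[]})"
  then obtain u where u: "([], u) \<in> T" "B = rooted_class z u" by blast
  have uV: "u \<in> TV" using tree.edge_in_V[OF u(1)] by simp
  obtain g where g: "g \<in> tree_Aut d" "g u = []" using Aut_transitive[OF uV] by blast
  have "\<exists>g'\<in>tree_Aut d. ([], g' []) \<in> T \<and> act g' z' \<in> B" if "z' \<in> rooted_class z []" for z'
  proof -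
    from that obtain h where h: "h \<in> tree_Aut d" "h [] = []" "z' = act h z"
      by (auto simp: rooted_class_def)
    let ?g = "g \<circ> inv h"
    have "inv h [] = []" using AutD(4)[OF h(1), of "[]"] h(2) by simp
    then have "([], ?g []) \<in> T" using AutD(6)[OF g(1) tree.edge_sym[OF u(1)]] g(2) by simp
    moreover have "act ?g z' = act g z"
      using act_act[OF g(1) Aut_inv[OF h(1)], of z'] act_inv_act[OF h(1)] h(3) by simp
    then have "act ?g z' \<in> B" using g u(2) by (auto simp: rooted_class_def)
    ultimately show ?thesis using Aut_comp[OF g(1) Aut_inv[OF h(1)]] by blast
  qed
  then show "B \<in> free_labelled_tree_graph d `` {rooted_class z []}"
    using rooted_class_free_quotient[OF z Nil_in_tree_vertices] rooted_class_free_quotient[OF z uV] u(2) quotient_free_subset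
    unfolding free_labelled_tree_graph_def labelled_tree_graph_def by blast
qed

section \<open>Neighbourhoods of labellings\<close>

abbreviation "LS \<equiv> labelling_space d"

definition agree :: "nat \<Rightarrow> (nat list \<Rightarrow> bool) \<Rightarrow> (nat list \<Rightarrow> bool) \<Rightarrow> bool" where
  "agree R z z' \<longleftrightarrow> (\<forall>v\<in>gball T [] R. z' v = z v)"

lemma agree_refl: "agree R z z"
  by (simp add: agree_def)

lemma agree_trans: "agree R z z' \<Longrightarrow> agree R z' z'' \<Longrightarrow> agree R z z''"
  by (simp add: agree_def)

lemma agree_mono: "agree R z z' \<Longrightarrow> R' \<le> R \<Longrightarrow> agree R' z z'"
  using gball_mono[of R' R T "[]"] unfolding agree_def by blast

lemma openin_agree: "openin LS {z' \<in> topspace LS. agree R z z'}"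
proof -
  let ?B = "gball T [] R"
  have fin: "finite ?B" by (rule tree.finite_gball)
  have sub: "v \<in> TV" if "v \<in> ?B" for v using that by (simp add: mem_gball_tree)
  have "openin LS {z' \<in> topspace LS. z' v = z v}" if "v \<in> TV" for v
  proof -
    have "continuous_map LS (discrete_topology UNIV) (\<lambda>z'. z' v)"
      unfolding labelling_space_def
      using continuous_map_product_projection[OF that, of "\<lambda>_. discrete_topology UNIV"] .
    then have "openin LS {z' \<in> topspace LS. z' v \<in> {z v}}"
      by (rule openin_continuous_map_preimage) simp
    then show ?thesis by simp
  qed
  then have "openin LS (topspace LS \<inter> (\<Inter>v\<in>?B. {z' \<in> topspace LS. z' v = z v}))"
    using fin sub by (cases "?B = {}") (auto intro!: openin_Int openin_INT2)
  moreover have "{z' \<in> topspace LS. agree R z z'} = topspace LS \<inter> (\<Inter>v\<in>?B. {z' \<in> topspace LS. z' v = z v})"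
    unfolding agree_def by (auto simp del: gball_0)
  ultimately show ?thesis by simp
qed

lemma openin_LS_D:
  assumes "openin LS S" "z \<in> S"
  shows "\<exists>R. \<forall>z'\<in>topspace LS. agree R z z' \<longrightarrow> z' \<in> S"
proof -
  obtain U where U: "finite {i \<in> TV. U i \<noteq> topspace (discrete_topology (UNIV :: bool set))}"
     "z \<in> Pi\<^sub>E TV U" "Pi\<^sub>E TV U \<subseteq> S"
    using bspec[OF assms(1)[unfolded labelling_space_def openin_product_topology_alt] assms(2)]
    by (elim exE conjE)
  let ?F = "{i \<in> TV. U i \<noteq> UNIV}"
  have F: "finite ?F" using U(1) by simp
  define R where "R = Max (insert 0 (gdist T [] ` ?F))"
  have FR: "i \<in> gball T [] R" if "i \<in> ?F" for i
    using that F unfolding R_def by (auto simp: mem_gball_tree intro!: Max_ge)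
  have "z' \<in> S" if z': "z' \<in> topspace LS" "agree R z z'" for z'
  proof -
    have "z' i \<in> U i" if "i \<in> TV" for i
    proof (cases "U i = UNIV")
      case False
      then have "z' i = z i" using FR that z'(2) by (simp add: agree_def)
      then show ?thesis using U(2) that by (auto simp: PiE_iff)
    qed simp
    then have "z' \<in> Pi\<^sub>E TV U"
      using z'(1) by (auto simp: labelling_iff PiE_iff extensional_def)
    then show ?thesis using U(3) by blast
  qed
  then show ?thesis by blast
qed

lemma agree_act:
  assumes g: "g \<in> tree_Aut d" "g u = []" and u: "u \<in> TV" and z: "agree (R + gdist T [] u) z z'"
  shows "agree R (act g z) (act g z')"
  unfolding agree_def
proof
  fix v assume v: "v \<in> gball T [] R"
  have iu: "inv g [] = u" using AutD(4)[OF g(1), of u] g(2) by simp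
  have vT: "v \<in> TV" using v by (simp add: mem_gball_tree)
  then have "gdist T u (inv g v) = gdist T [] v"
    using Aut_gdist[OF Aut_inv[OF g(1)], of "[]" v] iu by simp
  moreover have "inv g v \<in> TV" using AutD(3)[OF Aut_inv[OF g(1)] vT] .
  ultimately have "inv g v \<in> gball T u R" using v u by (simp add: mem_gball_tree)
  moreover have "u \<in> gball T [] (gdist T [] u)" using u by (simp add: mem_gball_tree)
  ultimately have "inv g v \<in> gball T [] (R + gdist T [] u)"
    using gball_trans[of u T "[]" "gdist T [] u" "inv g v" R] by (simp add: add.commute)
  then show "act g z' v = act g z v" using z by (simp add: agree_def act_def)
qed

lemma topspace_free_quotient: "topspace (free_quotient_space d) = free_part d // root_orbit_rel d"
proof -
  have "topspace (subtopology LS (free_part d)) = free_part d" using free_labelling by auto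
  then show ?thesis by (simp only: free_quotient_space_def topspace_quotient_topology)
qed

text \<open>Rerooting followed by the quotient map is continuous: to know the rerooted labelling
  near its root, \<open>z\<close> has to be known further out by the distance of
  \<open>u\<close>.\<close>

lemma rooted_class_open_nbhd:
  assumes U: "openin (free_quotient_space d) U" and z: "z \<in> free_part d" and u: "u \<in> TV" and zu: "rooted_class z u \<in> U"
  shows "\<exists>R. \<forall>z'\<in>free_part d. agree R z z' \<longrightarrow> rooted_class z' u \<in> U"
proof -
  have top: "topspace (subtopology LS (free_part d)) = free_part d" using free_labelling by auto
  obtain g where g: "g \<in> tree_Aut d" "g u = []" using Aut_transitive[OF u] by blast
  have rooted_class: "rooted_class z' u = root_orbit_rel d `` {act g z'}" if "z' \<in> free_part d" for z'
    using rooted_class_eq_orbit[OF free_labelling[OF that] g] .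
  have "openin (subtopology LS (free_part d)) {x \<in> free_part d. root_orbit_rel d `` {x} \<in> U}"
    using U unfolding free_quotient_space_def openin_quotient_topology top by blast
  then obtain S where S: "openin LS S" "{x \<in> free_part d. root_orbit_rel d `` {x} \<in> U} = S \<inter> free_part d"
    unfolding openin_subtopology by blast
  have memS: "x \<in> S \<longleftrightarrow> root_orbit_rel d `` {x} \<in> U" if "x \<in> free_part d" for x
  proof -
    have "x \<in> S \<inter> free_part d \<longleftrightarrow> x \<in> {x \<in> free_part d. root_orbit_rel d `` {x} \<in> U}"
      by (simp only: S(2))
    then show ?thesis using that by simp
  qed
  have "act g z \<in> S" unfolding memS[OF free_act[OF z g(1)]] rooted_class[OF z, symmetric]
    by (rule zu)
  then obtain R where R: "\<forall>z'\<in>topspace LS. agree R (act g z) z' \<longrightarrow> z' \<in> S"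
    using openin_LS_D[OF S(1)] by blast
  have "rooted_class z' u \<in> U" if z': "z' \<in> free_part d" "agree (R + gdist T [] u) z z'" for z'
  proof -
    have "act g z' \<in> S"
      using R agree_act[OF g u z'(2)] act_labelling[OF g(1) free_labelling[OF z'(1)]] by blast
    then show ?thesis unfolding memS[OF free_act[OF z'(1) g(1)]] rooted_class[OF z'(1), symmetric] .
  qed
  then show ?thesis by blast
qed

lemma free_edges_subset:
  "free_labelled_tree_graph d \<subseteq> topspace (free_quotient_space d) \<times> topspace (free_quotient_space d)"
  unfolding topspace_free_quotient free_labelled_tree_graph_def by blast

lemma solution_locally_constant:
  assumes c: "continuous_solution P (free_quotient_space d) (free_labelled_tree_graph d) c"
    and z: "z \<in> free_part d"
  shows "\<exists>R. \<forall>z'\<in>free_part d. agree R z z' \<longrightarrow> (\<forall>u\<in>T `` {[]}. c (rooted_class z' [], rooted_class z' u) = c (rooted_class z [], rooted_class z u))"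
proof -
  let ?E = "free_labelled_tree_graph d" and ?Q = "free_quotient_space d"
  have edge: "(rooted_class z [], rooted_class z u) \<in> ?E" if "z \<in> free_part d" "u \<in> T `` {[]}" for z u
    using nbrs_rooted_class[OF that(1)] that(2) by blast
  have "\<exists>R. \<forall>z'\<in>free_part d. agree R z z' \<longrightarrow> c (rooted_class z' [], rooted_class z' u) = c (rooted_class z [], rooted_class z u)"
    if u: "u \<in> T `` {[]}" for u
  proof -
    have uV: "u \<in> TV" using u tree.edge_in_V by blast
    let ?e = "(rooted_class z [], rooted_class z u)"
    have cm: "continuous_map (half_edge_topology ?Q ?E) (discrete_topology (labels P)) c"
      using c by (simp add: continuous_solution_def)
    have top: "topspace (half_edge_topology ?Q ?E) = ?E"
      by (rule topspace_half_edge[OF free_edges_subset])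
    have "c ?e \<in> labels P"
      using continuous_map_image_subset_topspace[OF cm] edge[OF z u] top by auto
    then have o: "openin (half_edge_topology ?Q ?E) {e \<in> ?E. c e \<in> {c ?e}}"
      using openin_continuous_map_preimage[OF cm, of "{c ?e}"] top by simp
    have "?e \<in> {e \<in> ?E. c e \<in> {c ?e}}" using edge[OF z u] by simp
    from half_edge_topology_base[OF o this] obtain U W where UW: "clopenin ?Q U" "clopenin ?Q W" "rooted_class z [] \<in> U" "rooted_class z u \<in> W"
        "(U \<times> W) \<inter> ?E \<subseteq> {e \<in> ?E. c e \<in> {c ?e}}"
      by (elim exE conjE)
    obtain R1 where R1: "\<forall>z'\<in>free_part d. agree R1 z z' \<longrightarrow> rooted_class z' [] \<in> U"
      using rooted_class_open_nbhd[OF _ z Nil_in_tree_vertices UW(3)] UW(1) unfolding clopenin_def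
        by blast
    obtain R2 where R2: "\<forall>z'\<in>free_part d. agree R2 z z' \<longrightarrow> rooted_class z' u \<in> W"
      using rooted_class_open_nbhd[OF _ z uV UW(4)] UW(2) unfolding clopenin_def by blast
    have "c (rooted_class z' [], rooted_class z' u) = c ?e" if "z' \<in> free_part d" "agree (R1 + R2) z z'" for z'
    proof -
      have "agree R1 z z'" "agree R2 z z'" using agree_mono[OF that(2)] by simp_all
      then have "(rooted_class z' [], rooted_class z' u) \<in> (U \<times> W) \<inter> ?E"
        using R1 R2 that(1) edge[OF that(1) u] by blast
      then show ?thesis using UW(5) by blast
    qed
    then show ?thesis by blast
  qed
  then have "\<forall>u\<in>T `` {[]}. \<exists>R. \<forall>z'\<in>free_part d. agree R z z' \<longrightarrow> c (rooted_class z' [], rooted_class z' u) = c (rooted_class z [], rooted_class z u)"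
    by blast
  then obtain \<rho> where \<rho>: "\<forall>u\<in>T `` {[]}. \<forall>z'\<in>free_part d. agree (\<rho> u) z z' \<longrightarrow>
      c (rooted_class z' [], rooted_class z' u) = c (rooted_class z [], rooted_class z u)"
    by (rule bchoice[THEN exE])
  have "c (rooted_class z' [], rooted_class z' u) = c (rooted_class z [], rooted_class z u)"
    if "z' \<in> free_part d" "agree (Max (\<rho> ` (T `` {[]}))) z z'" "u \<in> T `` {[]}" for z' u
  proof -
    have "\<rho> u \<le> Max (\<rho> ` (T `` {[]}))"
      using that(3) tree.finite_nbrs by (intro Max_ge) auto
    then show ?thesis using \<rho> agree_mono[OF that(2)] that(1,3) by blast
  qed
  then show ?thesis by blast
qed

section \<open>The compact set of rigid labellings\<close>

definition rigid_labellings :: "nat \<Rightarrow> (nat list \<Rightarrow> bool) set" where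
  "rigid_labellings n = {z \<in> topspace LS. \<forall>k<n. rigid TV T z k (rigidity_radius k)}"

lemma rigid_labellings_antimono: "n \<le> m \<Longrightarrow> rigid_labellings m \<subseteq> rigid_labellings n"
  unfolding rigid_labellings_def by auto

text \<open>A failure of rigidity is witnessed by one isomorphism of two finite balls, so it
  persists for labellings that agree on a large ball.\<close>

lemma closedin_rigid_labellings: "closedin LS (rigid_labellings n)"
proof -
  have "openin LS (topspace LS - rigid_labellings n)"
  proof (subst openin_subopen, intro ballI)
    fix z assume z: "z \<in> topspace LS - rigid_labellings n"
    then obtain k where k: "k < n" "\<not> rigid TV T z k (rigidity_radius k)"
      by (auto simp: rigid_labellings_def)
    let ?\<rho> = "rigidity_radius k"
    obtain x y \<theta> where x: "x \<in> TV" "y \<in> gball T x k" "giso T T z z ?\<rho> x y \<theta>" "y \<noteq> x"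
      using k(2) unfolding rigid_def by blast
    have yT: "y \<in> TV" using tree.gball_in_V[OF x(1,2)] .
    define R where "R = gdist T [] x + gdist T [] y + ?\<rho>"
    have ball: "v \<in> gball T [] R" if "v \<in> gball T x ?\<rho> \<or> v \<in> gball T y ?\<rho>" for v
    proof -
      have xy: "x \<in> gball T [] (gdist T [] x)" "y \<in> gball T [] (gdist T [] y)"
        using x(1) yT by (simp_all add: mem_gball_tree)
      show ?thesis
        using that gball_le[OF gball_trans[OF xy(1)], of v ?\<rho> R] gball_le[OF gball_trans[OF xy(2)], of v ?\<rho> R]
        by (auto simp: R_def)
    qed
    have "{z' \<in> topspace LS. agree R z z'} \<subseteq> topspace LS - rigid_labellings n"
    proof
      fix z' assume z': "z' \<in> {z' \<in> topspace LS. agree R z z'}"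
      have "giso T T z' z' ?\<rho> x y \<theta>"
      proof (rule giso_relabel[OF x(3)])
        fix u assume u: "u \<in> gball T x ?\<rho>" "z (\<theta> u) = z u"
        then show "z' (\<theta> u) = z' u" using z' ball gisoD(5)[OF x(3) u(1)] by (simp add: agree_def)
      qed
      then have "\<not> rigid TV T z' k ?\<rho>" using x unfolding rigid_def by blast
      then show "z' \<in> topspace LS - rigid_labellings n"
        using k(1) z' by (auto simp: rigid_labellings_def)
    qed
    then show "\<exists>S. openin LS S \<and> z \<in> S \<and> S \<subseteq> topspace LS - rigid_labellings n"
      using openin_agree[of R z] agree_refl z by blast
  qed
  then show ?thesis by (auto simp: closedin_def rigid_labellings_def)
qed

lemma act_rigid_labellings:
  assumes z: "z \<in> rigid_labellings n" and g: "g \<in> tree_Aut d"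
  shows "act g z \<in> rigid_labellings n"
proof -
  have "rigid TV T (act g z) k \<rho>" if "rigid TV T z k \<rho>" for k \<rho>
  proof (rule rigid_pullback[OF tree_pair _ tree_connected _ that])
    show "giso T T (act g z) z R [] (inv g []) (inv g)" for R
      using giso_Aut[OF Aut_inv[OF g] Nil_in_tree_vertices, of "act g z" R] act_inv_act[OF g] by simp
    show "inv g [] \<in> TV" using AutD(3)[OF Aut_inv[OF g] Nil_in_tree_vertices] .
  qed
  then show ?thesis using z act_labelling[OF g] unfolding rigid_labellings_def by blast
qed

text \<open>A label-preserving automorphism that moves \<open>u\<close> by distance \<open>k\<close>
  contradicts rigidity at scale \<open>k\<close>.\<close>

lemma rigid_labellings_free: "(\<Inter>n. rigid_labellings n) \<subseteq> free_part d"
proof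
  fix z assume z: "z \<in> (\<Inter>n. rigid_labellings n)"
  then have zL: "z \<in> topspace LS" by (auto simp: rigid_labellings_def)
  have "act g z \<noteq> z" if g: "g \<in> tree_Aut d" "g \<noteq> id" for g
  proof
    assume eq: "act g z = z"
    obtain u where u: "g u \<noteq> u" using g(2) by (auto simp: fun_eq_iff)
    then have uT: "u \<in> TV" using AutD(1)[OF g(1)] by (auto simp: permutes_def)
    define k where "k = gdist T u (g u)"
    have "giso T T z z (rigidity_radius k) u (g u) g" using giso_Aut[OF g(1) uT, of z] eq by simp
    moreover have "g u \<in> gball T u k"
      using uT AutD(3)[OF g(1) uT] by (simp add: mem_gball_tree k_def)
    moreover have "rigid TV T z k (rigidity_radius k)" using z by (auto simp: rigid_labellings_def)
    ultimately show False using u uT unfolding rigid_def by blast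
  qed
  then show "z \<in> free_part d" using zL by (simp add: free_part_def)
qed

lemma compact_LS: "compact_space LS"
  unfolding labelling_space_def
    by (simp add: compact_space_product_topology compact_space_discrete_topology)

text \<open>The sets \<open>rigid_labellings n - N\<close> are closed and decreasing with empty
  intersection, so compactness makes one of them empty.\<close>

lemma rigid_labellings_approx: "\<exists>n. \<forall>w\<in>rigid_labellings n. \<exists>z\<in>\<Inter>n. rigid_labellings n. agree R z w"
proof -
  define N where "N = (\<Union>z\<in>\<Inter>n. rigid_labellings n. {w \<in> topspace LS. agree R z w})"
  have "openin LS N" unfolding N_def using openin_agree by blast
  then have cl: "closedin LS (rigid_labellings n - N)" for n
    by (rule closedin_diff[OF closedin_rigid_labellings])
  have "w \<notin> (\<Inter>n. rigid_labellings n - N)" for w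
  proof
    assume w: "w \<in> (\<Inter>n. rigid_labellings n - N)"
    then have "\<forall>n. w \<in> rigid_labellings n" by simp
    moreover from this have "w \<in> topspace LS" unfolding rigid_labellings_def by simp
    ultimately have "w \<in> N" unfolding N_def using agree_refl by blast
    then show False using w by simp
  qed
  then have "(\<Inter>n. rigid_labellings n - N) = {}" by blast
  moreover have "decseq (\<lambda>n. rigid_labellings n - N)" unfolding decseq_def
    using rigid_labellings_antimono by blast
  ultimately obtain n where "rigid_labellings n - N = {}"
    using compact_space_imp_nest[OF compact_LS cl] by meson
  then have "\<exists>z\<in>\<Inter>n. rigid_labellings n. agree R z w" if "w \<in> rigid_labellings n" for w
    using that unfolding N_def by blast
  then show ?thesis by blast
qed

text \<open>Every free labelling has a local radius. On the compact set of rigid labellings finitely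
  many suffice, and two labellings that agree up to their maximum are compared through the centre of
  a common covering set.\<close>

lemma uniform_radius:
  assumes c: "continuous_solution P (free_quotient_space d) (free_labelled_tree_graph d) c"
  shows "\<exists>R. \<forall>z\<in>\<Inter>n. rigid_labellings n. \<forall>z'\<in>\<Inter>n. rigid_labellings n. agree R z z' \<longrightarrow>
    (\<forall>u\<in>T `` {[]}. c (rooted_class z' [], rooted_class z' u) = c (rooted_class z [], rooted_class z u))"
proof -
  let ?rigid_labellings = "\<Inter>n. rigid_labellings n"
  have "\<forall>z\<in>?rigid_labellings. \<exists>R. \<forall>z'\<in>free_part d. agree R z z' \<longrightarrow> (\<forall>u\<in>T `` {[]}. c (rooted_class z' [], rooted_class z' u) = c (rooted_class z [], rooted_class z u))"
    using solution_locally_constant[OF c] rigid_labellings_free by blast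
  then obtain \<rho> where \<rho>: "\<forall>z\<in>?rigid_labellings. \<forall>z'\<in>free_part d. agree (\<rho> z) z z' \<longrightarrow>
      (\<forall>u\<in>T `` {[]}. c (rooted_class z' [], rooted_class z' u) = c (rooted_class z [], rooted_class z u))"
    by (rule bchoice[THEN exE])
  let ?B = "\<lambda>z. {w \<in> topspace LS. agree (\<rho> z) z w}"
  have cpt: "compactin LS ?rigid_labellings"
    by (rule closedin_compact_space[OF compact_LS]) (auto intro: closedin_rigid_labellings)
  have cov: "?rigid_labellings \<subseteq> \<Union> (?B ` ?rigid_labellings)"
  proof
    fix z assume z: "z \<in> ?rigid_labellings"
    then have "z \<in> topspace LS" unfolding rigid_labellings_def by simp
    then show "z \<in> \<Union> (?B ` ?rigid_labellings)" using z agree_refl by blast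
  qed
  have op: "openin LS S" if "S \<in> ?B ` ?rigid_labellings" for S using that openin_agree by blast
  obtain \<F> where F: "finite \<F>" "\<F> \<subseteq> ?B ` ?rigid_labellings" "?rigid_labellings \<subseteq> \<Union> \<F>"
    using compactinD[OF cpt _ cov] op by (metis (no_types, lifting))
  obtain Z where Z: "finite Z" "Z \<subseteq> ?rigid_labellings" "\<F> = ?B ` Z"
    using finite_subset_image[OF F(1,2)] by (elim exE conjE)
  define R where "R = Max (insert 0 (\<rho> ` Z))"
  have "c (rooted_class z' [], rooted_class z' u) = c (rooted_class z [], rooted_class z u)"
    if z: "z \<in> ?rigid_labellings" "z' \<in> ?rigid_labellings" "agree R z z'" "u \<in> T `` {[]}" for z z' u
  proof -
    obtain z0 where z0: "z0 \<in> Z" "agree (\<rho> z0) z0 z" using F(3) z(1) Z(3) by blast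
    have "\<rho> z0 \<le> R" unfolding R_def using Z(1) z0(1) by (intro Max_ge) auto
    then have "agree (\<rho> z0) z0 z'" using agree_trans[OF z0(2) agree_mono[OF z(3)]] by blast
    then have "c (rooted_class z' [], rooted_class z' u) = c (rooted_class z0 [], rooted_class z0 u)"
      "c (rooted_class z [], rooted_class z u) = c (rooted_class z0 [], rooted_class z0 u)"
      using \<rho> z0 Z(2) z rigid_labellings_free by blast+
    then show ?thesis by simp
  qed
  then show ?thesis by blast
qed

end

section \<open>Transferring the solution\<close>

locale solution_transfer = labelled_tree d + continuous_forest d X G
  for d :: nat and X :: "'a topology" and G :: "('a \<times> 'a) set" +
  fixes P :: "'l lcl" and c and f :: "'a \<Rightarrow> bool" and R n :: nat
  assumes solution: "continuous_solution P (free_quotient_space d) (free_labelled_tree_graph d) c"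
    and f_lc: "locally_constant X f"
    and f_rigid: "k < n \<Longrightarrow> rigid (topspace X) G f k (rigidity_radius k)"
    and R: "1 \<le> R"
    and uniform: "z \<in> (\<Inter>n. rigid_labellings n) \<Longrightarrow> z' \<in> (\<Inter>n. rigid_labellings n) \<Longrightarrow> agree R z z' \<Longrightarrow> u \<in> T `` {[]} \<Longrightarrow>
      c (rooted_class z' [], rooted_class z' u) = c (rooted_class z [], rooted_class z u)"
    and approx: "w \<in> rigid_labellings n \<Longrightarrow> \<exists>z\<in>\<Inter>n. rigid_labellings n. agree (R + 1) z w"
begin

lemma tree_X: "regular_forest_pair d TV T (topspace X) G"
  by (intro regular_forest_pair.intro forest regular_forest_axioms)

abbreviation val :: "(nat list \<Rightarrow> bool) \<Rightarrow> nat list \<Rightarrow> 'l" where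
  "val z u \<equiv> c (rooted_class z [], rooted_class z u)"

text \<open>A local picture of \<T> at \<open>x\<close> by a labelling that is rigid at all scales.
  Different points may need different \<open>z\<close>; no global map to the free part is
  obtained.\<close>

definition chart :: "nat \<Rightarrow> (nat list \<Rightarrow> bool) \<Rightarrow> 'a \<Rightarrow> (nat list \<Rightarrow> 'a) \<Rightarrow> bool" where
  "chart r z x \<iota> \<longleftrightarrow> z \<in> (\<Inter>n. rigid_labellings n) \<and> giso T G z f r [] x \<iota>"

text \<open>By \<open>val_unique\<close> all charts give the same value, so charts need not be
  chosen continuously.\<close>

definition sol :: "'a \<times> 'a \<Rightarrow> 'l" where
  "sol = (\<lambda>(x, y). SOME l. \<exists>z \<iota> u. chart R z x \<iota> \<and> u \<in> T `` {[]} \<and> \<iota> u = y \<and> l = val z u)"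

lemma chartD:
  assumes "chart r z x \<iota>"
  shows "z \<in> (\<Inter>n. rigid_labellings n)" "giso T G z f r [] x \<iota>" "z \<in> free_part d"
  using assms rigid_labellings_free unfolding chart_def by blast+

lemma chart_mono: "chart r z x \<iota> \<Longrightarrow> r' \<le> r \<Longrightarrow> chart r' z x \<iota>"
  unfolding chart_def using regular_forest_pair.giso_mono[OF tree_X] by (elim conjE) (intro conjI)

text \<open>The labels of the component of \<open>x\<close> are copied to the regular tree along an
  isometry \<open>\<pi>\<close>. The copy is rigid below \<open>n\<close>, hence close to a
  labelling rigid at all scales.\<close>

lemma ex_chart:
  assumes x: "x \<in> topspace X"
  shows "\<exists>z \<iota>. chart (R + 1) z x \<iota>"
proof -
  have "giso T G (\<lambda>_. ()) (\<lambda>_. ()) 0 [] x (\<lambda>_. x)"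
    by (auto simp: giso_def bij_betw_def)
  then obtain \<pi> where \<pi>: "\<And>r. giso T G (\<lambda>_. ()) (\<lambda>_. ()) r [] x \<pi>"
    using regular_forest_pair.giso_extend[OF tree_X _ Nil_in_tree_vertices x] by blast
  \<comment> \<open>Off the tree, points of \<open>labelling_space\<close> take the value
    \<open>undefined\<close>.\<close>
  define w where "w v = (if v \<in> TV then f (\<pi> v) else undefined)" for v
  have w: "giso T G w f r [] x \<pi>" for r
    by (rule giso_relabel[OF \<pi>]) (simp add: w_def mem_gball_tree)
  have "rigid TV T w k (rigidity_radius k)" if "k < n" for k
    by (rule rigid_pullback[OF tree_X w tree_connected x f_rigid[OF that]])
  then have "w \<in> rigid_labellings n" by (simp add: rigid_labellings_def labelling_iff w_def)
  then obtain z where z: "z \<in> (\<Inter>n. rigid_labellings n)" "agree (R + 1) z w"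
    using approx by blast
  have "giso T G z f (R + 1) [] x \<pi>"
    by (rule giso_relabel[OF w]) (use z(2) in \<open>simp add: agree_def\<close>)
  then show ?thesis using z(1) unfolding chart_def by blast
qed

lemma root_nbr: "u \<in> T `` {[]} \<Longrightarrow> u \<in> TV" "u \<in> T `` {[]} \<Longrightarrow> u \<in> gball T [] R"
proof -
  assume u: "u \<in> T `` {[]}"
  then show "u \<in> TV" using tree.edge_in_V by blast
  then show "u \<in> gball T [] R" using u tree.\<delta>_edge[of "[]" u] R by (simp add: mem_gball_tree)
qed

text \<open>On the ball two charts at \<open>x\<close> differ by an isomorphism fixing the root,
  which extends to an automorphism. \<open>uniform\<close> compares the labelling moved by it with
  the second one.\<close>

lemma val_unique:
  assumes z: "chart R z x \<iota>" and z': "chart R z' x \<iota>'"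
    and u: "u \<in> T `` {[]}" and u': "u' \<in> T `` {[]}" and eq: "\<iota> u = \<iota>' u'"
  shows "val z u = val z' u'"
proof -
  note i = chartD(2)[OF z] and i' = chartD(2)[OF z']
  let ?h = "\<lambda>v. inv_into (gball T [] R) \<iota>' (\<iota> v)"
  have inv: "?h v = v'" if "v' \<in> gball T [] R" "\<iota> v = \<iota>' v'" for v v'
    using that gisoD(2)[OF i'] by (simp add: bij_betw_def)
  have h: "giso T T z z' R [] [] ?h" using giso_comp[OF i giso_inv[OF i']] .
  obtain g where g: "g \<in> tree_Aut d" "\<forall>v\<in>gball T [] R. g v = ?h v"
    using Aut_extends_giso[OF h Nil_in_tree_vertices Nil_in_tree_vertices] by blast
  have gu: "g u = u'" using g(2) root_nbr(2)[OF u] inv[OF root_nbr(2)[OF u'] eq] by simp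
  have g0: "g [] = []" using g(2) gisoD(1)[OF h] by simp
  have "agree R z' (act g z)"
    unfolding agree_def
  proof
    fix v assume "v \<in> gball T [] R"
    then obtain w where w: "w \<in> gball T [] R" "v = ?h w" using giso_surj[OF h] by blast
    then have "v = g w" using g(2) by simp
    then have "act g z v = z w" using act_apply[OF g(1)] by simp
    also have "z w = z' v" using gisoD(4)[OF h w(1)] w(2) by simp
    finally show "act g z v = z' v" .
  qed
  moreover have "act g z \<in> (\<Inter>n. rigid_labellings n)"
    using act_rigid_labellings[OF _ g(1)] chartD(1)[OF z] by blast
  ultimately have "val (act g z) u' = val z' u'" using uniform chartD(1)[OF z'] u' by blast
  moreover have "rooted_class (act g z) u' = rooted_class z u" "rooted_class (act g z) [] = rooted_class z []"
    using rooted_class_act[OF g(1), of z u] rooted_class_act[OF g(1), of z "[]"] gu g0 by simp_all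
  ultimately show ?thesis by simp
qed

lemma sol_eq:
  assumes z: "chart R z x \<iota>" and u: "u \<in> T `` {[]}"
  shows "sol (x, \<iota> u) = val z u"
  unfolding sol_def prod.case
proof (rule some_equality)
  show "\<exists>z' \<iota>' u'. chart R z' x \<iota>' \<and> u' \<in> T `` {[]} \<and> \<iota>' u' = \<iota> u \<and> val z u = val z' u'"
    using z u by blast
  show "l = val z u" if "\<exists>z' \<iota>' u'. chart R z' x \<iota>' \<and> u' \<in> T `` {[]} \<and> \<iota>' u' = \<iota> u \<and> l = val z' u'" for l
  proof -
    from that obtain z' \<iota>' u' where z': "chart R z' x \<iota>'" "u' \<in> T `` {[]}" "\<iota>' u' = \<iota> u" "l = val z' u'"
      by (elim exE conjE)
    then show ?thesis using val_unique[OF z z'(1) u z'(2)] by simp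
  qed
qed

lemma chart_nbrs:
  assumes z: "chart R z x \<iota>"
  shows "bij_betw \<iota> (T `` {[]}) (G `` {x})"
proof -
  note i = chartD(2)[OF z]
  have root: "\<iota> [] = x" using gisoD(1)[OF i] .
  have edge: "(x, \<iota> v) \<in> G \<longleftrightarrow> ([], v) \<in> T" if "v \<in> gball T [] R" for v
    using regular_forest_pair.giso_edge_iff[OF tree_X i gball_refl that] root by simp
  have "\<iota> ` (T `` {[]}) = G `` {x}"
  proof (intro subset_antisym subsetI)
    fix y assume "y \<in> \<iota> ` (T `` {[]})"
    then show "y \<in> G `` {x}" using edge root_nbr(2) by blast
  next
    fix y assume y: "y \<in> G `` {x}"
    then have "y \<in> gball G x R" using \<delta>_edge[of x y] R by (auto simp: gball_def)
    then obtain v where v: "v \<in> gball T [] R" "y = \<iota> v" using giso_surj[OF i] by blast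
    then show "y \<in> \<iota> ` (T `` {[]})" using edge[OF v(1)] y by blast
  qed
  moreover have "inj_on \<iota> (T `` {[]})"
    using gisoD(2)[OF i] root_nbr(2) unfolding bij_betw_def by (meson inj_on_subset subsetI)
  ultimately show ?thesis by (simp add: bij_betw_def)
qed

lemma coloring: "lcl_coloring P (free_part d // root_orbit_rel d) (free_labelled_tree_graph d) c"
  using solution by (simp add: continuous_solution_def topspace_free_quotient)

lemma edge_rooted_class: "z \<in> free_part d \<Longrightarrow> u \<in> T `` {[]} \<Longrightarrow> (rooted_class z [], rooted_class z u) \<in> free_labelled_tree_graph d"
  using nbrs_rooted_class by blast

lemma sol_vertex:
  assumes x: "x \<in> topspace X"
  shows "image_mset (\<lambda>y. sol (x, y)) (mset_set (G `` {x})) \<in> vertex_constraint P"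
proof -
  obtain z \<iota> where z: "chart R z x \<iota>"
    using ex_chart[OF x] chart_mono[of "R + 1" _ x _ R] by auto
  note b = chart_nbrs[OF z]
  have "mset_set (G `` {x}) = image_mset \<iota> (mset_set (T `` {[]}))"
    using image_mset_mset_set[of \<iota> "T `` {[]}"] b by (simp add: bij_betw_def)
  then have "image_mset (\<lambda>y. sol (x, y)) (mset_set (G `` {x})) = image_mset (val z) (mset_set (T `` {[]}))"
    using sol_eq[OF z] tree.finite_nbrs by (auto simp: multiset.map_comp intro!: image_mset_cong)
  also have "\<dots> = image_mset (\<lambda>B. c (rooted_class z [], B)) (image_mset (rooted_class z) (mset_set (T `` {[]})))"
    by (simp add: multiset.map_comp comp_def)
  \<comment> \<open>Injectivity of \<open>rooted_class z\<close> keeps the multiplicities, so the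
    vertex constraint is the one at the class of \<open>z\<close>.\<close>
  also have "image_mset (rooted_class z) (mset_set (T `` {[]})) = mset_set (rooted_class z ` (T `` {[]}))"
    using rooted_class_inj[OF chartD(3)[OF z]] root_nbr(1) by (intro image_mset_mset_set) (meson inj_onI)
  also have "rooted_class z ` (T `` {[]}) = free_labelled_tree_graph d `` {rooted_class z []}"
    using nbrs_rooted_class[OF chartD(3)[OF z]] by simp
  also have "image_mset (\<lambda>B. c (rooted_class z [], B)) (mset_set \<dots>) \<in> vertex_constraint P"
    using coloring rooted_class_free_quotient[OF chartD(3)[OF z] Nil_in_tree_vertices]
    unfolding lcl_coloring_def by blast
  finally show ?thesis .
qed

text \<open>The extra unit of radius is spent here: a chart of radius \<open>R + 1\<close> at
  \<open>x\<close> becomes, rerooted at a neighbour, a chart of radius \<open>R\<close> at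
  \<open>y\<close>. Both halves of the edge are thus read from one edge of the quotient
  graph.\<close>

lemma sol_edge:
  assumes xy: "(x, y) \<in> G"
  shows "sol (x, y) \<in> labels P" "{#sol (x, y), sol (y, x)#} \<in> edge_constraint P"
proof -
  have x: "x \<in> topspace X" using edge_in_V[OF xy] by simp
  obtain z \<iota> where z1: "chart (R + 1) z x \<iota>" using ex_chart[OF x] by blast
  then have z: "chart R z x \<iota>" by (rule chart_mono) simp
  obtain u where u: "u \<in> T `` {[]}" "y = \<iota> u"
    using chart_nbrs[OF z] xy by (auto simp: bij_betw_def)
  note zf = chartD(3)[OF z] and uV = root_nbr(1)[OF u(1)]
  have sxy: "sol (x, y) = val z u" using sol_eq[OF z u(1)] u(2) by simp
  obtain g where g: "g \<in> tree_Aut d" "g u = []" using Aut_transitive[OF uV] by blast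
  have iu: "inv g [] = u" using AutD(4)[OF g(1), of u] g(2) by simp
  have "giso T T (act g z) z R [] u (inv g)"
    using giso_Aut[OF Aut_inv[OF g(1)] Nil_in_tree_vertices, of "act g z" R] act_inv_act[OF g(1)] iu
      by simp
  moreover have "u \<in> gball T [] 1"
    using u(1) tree.\<delta>_edge[of "[]" u] uV by (simp add: mem_gball_tree)
  then have "giso T G z f R u y \<iota>"
    using regular_forest_pair.giso_subball[OF tree_X chartD(2)[OF z1], of u 1 R] u(2) by simp
  ultimately have "giso T G (act g z) f R [] y (\<lambda>v. \<iota> (inv g v))" by (rule giso_comp)
  moreover have "act g z \<in> (\<Inter>n. rigid_labellings n)"
    using act_rigid_labellings[OF _ g(1)] chartD(1)[OF z] by blast
  ultimately have z': "chart R (act g z) y (\<lambda>v. \<iota> (inv g v))" by (simp add: chart_def)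
  have "([], u) \<in> T" using u(1) by simp
  then have g0: "g [] \<in> T `` {[]}" using AutD(6)[OF g(1) tree.edge_sym[of "[]" u]] g(2) by simp
  have "\<iota> (inv g (g [])) = x" using AutD(4)[OF g(1)] gisoD(1)[OF chartD(2)[OF z]] by simp
  then have "sol (y, x) = val (act g z) (g [])" using sol_eq[OF z' g0] by simp
  also have "\<dots> = c (rooted_class z u, rooted_class z [])"
    using rooted_class_act[OF g(1), of z u] rooted_class_act[OF g(1), of z "[]"] g(2) by simp
  finally have syx: "sol (y, x) = c (rooted_class z u, rooted_class z [])" .
  show "sol (x, y) \<in> labels P" "{#sol (x, y), sol (y, x)#} \<in> edge_constraint P"
    using coloring edge_rooted_class[OF zf u(1)] unfolding lcl_coloring_def sxy syx
      by (blast dest: funcset_mem)+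
qed

lemma sol_locally_constant:
  assumes xy: "(x, y) \<in> G"
  shows "\<exists>U W. clopenin X U \<and> clopenin X W \<and> x \<in> U \<and> y \<in> W \<and> (\<forall>x'\<in>U. \<forall>y'\<in>W. (x', y') \<in> G \<longrightarrow> sol (x', y') = sol (x, y))"
proof -
  have V: "x \<in> topspace X" "y \<in> topspace X" using edge_in_V[OF xy] by simp_all
  obtain z \<iota> where "chart (R + 1) z x \<iota>" using ex_chart[OF V(1)] by blast
  then have z: "chart R z x \<iota>" by (rule chart_mono) simp
  have cl: "closedin X (G `` {x} - {y})"
    using finite_nbrs edge_in_V by (intro closedin_finite) auto
  obtain W where W: "clopenin X W" "y \<in> W" "W \<subseteq> topspace X - (G `` {x} - {y})"
    using clopen_base[OF openin_diff[OF openin_topspace cl], of y] V(2) by blast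
  \<comment> \<open>Membership in \<open>W\<close> singles out \<open>y\<close> among the neighbours
    of \<open>x\<close>, so an isomorphism of balls has to carry it to \<open>y'\<close>.\<close>
  let ?f = "\<lambda>v. (f v, v \<in> W)"
  obtain U0 where U0: "openin X U0" "x \<in> U0" "\<forall>x'\<in>U0. \<exists>\<sigma>. giso G G ?f ?f R x x' \<sigma>"
    using locally_isometric[OF locally_constant_Pair[OF f_lc locally_constant_clopenin[OF W(1)]] V(1), of R]
      by blast
  obtain U where U: "clopenin X U" "x \<in> U" "U \<subseteq> U0" using clopen_base[OF U0(1,2)] by blast
  have "sol (x', y') = sol (x, y)" if x': "x' \<in> U" and y': "y' \<in> W" and e: "(x', y') \<in> G" for x' y'
  proof -
    obtain \<sigma> where \<sigma>: "giso G G ?f ?f R x x' \<sigma>" using U0(3) U(3) x' by blast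
    have z': "chart R z x' (\<lambda>v. \<sigma> (\<iota> v))"
      unfolding chart_def
    proof
      show "z \<in> (\<Inter>n. rigid_labellings n)" by (rule chartD(1)[OF z])
      have "giso G G f f R x x' \<sigma>" using \<sigma> by (rule giso_relabel) simp
      then show "giso T G z f R [] x' (\<lambda>v. \<sigma> (\<iota> v))"
        by (rule giso_comp[OF chartD(2)[OF z]])
    qed
    obtain u where u: "u \<in> T `` {[]}" "y' = \<sigma> (\<iota> u)"
      using chart_nbrs[OF z'] e by (auto simp: bij_betw_def)
    have nb: "\<iota> u \<in> G `` {x}" using bij_betwE[OF chart_nbrs[OF z]] u(1) by blast
    then have "\<iota> u \<in> gball G x R"
      using \<delta>_edge[of x "\<iota> u"] R by (auto simp: gball_def)
    then have "\<iota> u \<in> W" using gisoD(4)[OF \<sigma>] y' u(2) by blast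
    then have "\<iota> u = y" using W(3) nb by blast
    then show ?thesis using sol_eq[OF z u(1)] sol_eq[OF z' u(1)] u(2) by simp
  qed
  then show ?thesis using U(1,2) W(1,2) by blast
qed

lemma continuous_solution_sol: "continuous_solution P X G sol"
  unfolding continuous_solution_def
proof
  show "lcl_coloring P (topspace X) G sol"
    unfolding lcl_coloring_def using sol_vertex sol_edge by auto
  have top: "topspace (half_edge_topology X G) = G"
    using simple by (intro topspace_half_edge) (simp add: simple_graph_def)
  have "openin (half_edge_topology X G) {e \<in> G. sol e \<in> S}" for S
  proof (rule openin_half_edge)
    fix x y assume xy: "(x, y) \<in> {e \<in> G. sol e \<in> S}"
    then obtain U W where UW: "clopenin X U" "clopenin X W" "x \<in> U" "y \<in> W"
        "\<forall>x'\<in>U. \<forall>y'\<in>W. (x', y') \<in> G \<longrightarrow> sol (x', y') = sol (x, y)"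
      using sol_locally_constant[of x y] by blast
    have "(U \<times> W) \<inter> G \<subseteq> {e \<in> G. sol e \<in> S}"
    proof
      fix e assume e: "e \<in> (U \<times> W) \<inter> G"
      then have "sol e = sol (x, y)" using UW(5) by (cases e) blast
      then show "e \<in> {e \<in> G. sol e \<in> S}" using e xy by simp
    qed
    then show "\<exists>U W. clopenin X U \<and> clopenin X W \<and> x \<in> U \<and> y \<in> W \<and> (U \<times> W) \<inter> G \<subseteq> {e \<in> G. sol e \<in> S}"
      using UW(1-4) by blast
  qed auto
  then show "continuous_map (half_edge_topology X G) (discrete_topology (labels P)) sol"
    using sol_edge(1) by (auto simp: continuous_map_def top)
qed

end

theorem theorem3p4:
  fixes \<Delta> :: nat
    and P :: "'l lcl"
    and X :: "'a topology"
    and \<T> :: "('a \<times> 'a) set"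
  assumes "\<Delta> > 2"
    and "is_lcl \<Delta> P"
    and "\<exists>c. continuous_solution P (free_quotient_space \<Delta>) (free_labelled_tree_graph \<Delta>) c"
    and "continuous_tree \<Delta> X \<T>"
  shows "\<exists>c. continuous_solution P X \<T> c"
proof -
  obtain c where c: "continuous_solution P (free_quotient_space \<Delta>) (free_labelled_tree_graph \<Delta>) c"
    using assms(3) by blast
  interpret labelled_tree \<Delta> by (rule labelled_tree.intro[OF assms(1)])
  interpret X: continuous_forest \<Delta> X \<T>
    using assms(1,4) unfolding continuous_tree_def continuous_graph_def
    by unfold_locales (auto simp: continuous_graph_def)
  obtain R where R: "\<forall>z\<in>\<Inter>n. rigid_labellings n. \<forall>z'\<in>\<Inter>n. rigid_labellings n. agree R z z' \<longrightarrow>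
      (\<forall>u\<in>T `` {[]}. c (rooted_class z' [], rooted_class z' u) = c (rooted_class z [], rooted_class z u))"
    using uniform_radius[OF c] by blast
  obtain n where n: "\<forall>w\<in>rigid_labellings n. \<exists>z\<in>\<Inter>n. rigid_labellings n. agree (R + 1 + 1) z w"
    using rigid_labellings_approx by blast
  obtain f :: "'a \<Rightarrow> bool" where f: "locally_constant X f" "\<forall>k<n. rigid (topspace X) \<T> f k (rigidity_radius k)"
    using X.ex_rigid_labelling[of n] by (elim exE conjE)
  \<comment> \<open>\<open>R + 1\<close> guarantees a radius of at least 1, so that charts contain
    the neighbours of the root.\<close>
  interpret solution_transfer \<Delta> X \<T> P c f "R + 1" n
  proof unfold_locales
    show "c (rooted_class z' [], rooted_class z' u) = c (rooted_class z [], rooted_class z u)"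
      if "z \<in> (\<Inter>n. rigid_labellings n)" "z' \<in> (\<Inter>n. rigid_labellings n)" "agree (R + 1) z z'" "u \<in> T `` {[]}" for z z' u
      using R that(1,2,4) agree_mono[OF that(3), of R] by simp
  qed (use c f n in auto)
  show ?thesis using continuous_solution_sol by blast
qed

end
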